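(* Let $k\ge 1$. The linking number modulo $k$ between any two components of a link in $S^3$ is preserved under $k$-equivalence; that is, if an oriented link $L'$ is obtained from an oriented link $L$ by a finite sequence of isotopies and $k$-moves (which carry components to components, with orientations), and components $C_1\ne C_2$ of $L$ correspond to components $C_1',C_2'$ of $L'$, then $\mathrm{lk}(C_1,C_2)\equiv \mathrm{lk}(C_1',C_2') \pmod k$. Thus, for every $k\ge 2$, there are links that are not $k$-equivalent to trivial links.
   Context: Arrow diagrams. Let $B$ be the closed unit disk with its standard orientation, $S^1=\mathbb R/\mathbb Z$, $T=B\times S^1$. The sphere $S^3$ is obtained from $T$ by gluing a second solid torus $T'$ whose meridian disk is attached along the curve $\{(e^{-2\pi i s},s)\}\subset\partial T$; $S^3$ has the orientation extending the product orientation of $T$. The circles $\{x\}\times S^1$ are then fibres of the Hopf fibration, with pairwise linking number $+1$. Every link in $S^3$ can be isotoped into the interior of $T$. An arrow diagram is a generic immersion of closed curves in the interior of $B$, with over/under information at the double points (crossings), together with finitely many arrows placed on the curves away from crossings, each pointing along the curve in one of its two directions. It represents a link in $T$ (hence in $S^3$) that projects to the curves in $B$ and meets $B\times\{0\}$ exactly above the arrows: at an arrow, when travelling in the direction of the arrow, the height in $[0,1]$ (cut open $S^1$) increases to $1$ and then continues from $0$. At a crossing, the over-strand is the one of larger height in $[0,1]$. Diagrams without arrows are ordinary link diagrams. $k$-moves. For $k\ge1$, a $k$-move on an arrow diagram is the addition or removal of $k$ arrows lying on one strand with no crossing between them, all pointing in the same direction. Two links in $S^3$ are $k$-equivalent if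 one can pass from an arrow diagram of one to an arrow diagram of the other by a finite sequence of $k$-moves and changes of arrow diagram that preserve the isotopy class of the represented link in $S^3$ (equivalently, Reidemeister moves for arrow diagrams). *)

theory Defs
  imports "HOL-Analysis.Analysis" "HOL-Number_Theory.Cong"
begin

section \<open>The three-sphere and the solid torus\<close>

abbreviation S3 :: "(complex \<times> complex) set"
  where "S3 \<equiv> sphere 0 1"

text \<open>
  The inclusion of the solid torus \<open>T = B \<times> S\<^sup>1\<close> into the three-sphere, with \<open>S\<^sup>1\<close> unrolled to the
  real line. The lemmas below identify the unit sphere of \<open>\<complex>\<^sup>2\<close> with the result of the gluing: the
  map is injective modulo integers in the second argument, its image is the solid torus
  \<open>|z| \<le> |w|\<close>, and the curve \<open>(exp (- 2 \<pi> i s), s)\<close> bounds the disc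
  \<open>{(sqrt (1 - |u|\<^sup>2), u). |u| \<le> 1 / sqrt 2}\<close>, a meridian disc of the complementary solid torus.
  With the boundary orientation of \<open>S3\<close> the map preserves orientation, and the circles
  \<open>{x} \<times> S\<^sup>1\<close> are the fibres of the Hopf map \<open>(z, w) \<mapsto> z / w\<close>.
\<close>

definition torus_embed :: "complex \<Rightarrow> real \<Rightarrow> complex \<times> complex"
  where "torus_embed x s = (1 / sqrt (1 + (cmod x)\<^sup>2)) *\<^sub>R (x * cis (2 * pi * s), cis (2 * pi * s))"

lemma torus_embed_pos: "0 < 1 / sqrt (1 + (cmod x)\<^sup>2)"
  by (simp add: add_pos_nonneg)

lemma torus_embed_in_S3: "torus_embed x s \<in> S3"
proof -
  have "0 < 1 + (cmod x)\<^sup>2"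
    by (simp add: add_pos_nonneg)
  then have "(1 / sqrt (1 + (cmod x)\<^sup>2))\<^sup>2 + (cmod x / sqrt (1 + (cmod x)\<^sup>2))\<^sup>2 = 1"
    by (simp add: power_divide flip: add_divide_distrib)
  then show ?thesis
    by (simp add: torus_embed_def norm_Pair norm_mult add.commute)
qed

lemma torus_embed_eq_iff: "torus_embed x s = torus_embed y t \<longleftrightarrow> x = y \<and> s - t \<in> \<int>"
proof -
  define r q where "r = 1 / sqrt (1 + (cmod x)\<^sup>2)" and "q = 1 / sqrt (1 + (cmod y)\<^sup>2)"
  have pos: "0 < r" "0 < q"
    unfolding r_def q_def by (rule torus_embed_pos)+
  have per: "cis (2 * pi * s) = cis (2 * pi * t) \<longleftrightarrow> s - t \<in> \<int>"
  proof -
    have "cis (2 * pi * s) = cis (2 * pi * t) \<longleftrightarrow> cis (2 * pi * (s - t)) = 1"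
      by (simp add: right_diff_distrib flip: cis_divide)
    also have "\<dots> \<longleftrightarrow> (\<exists>n::int. s - t = of_int n)"
    proof
      assume "cis (2 * pi * (s - t)) = 1"
      then have "cos (2 * pi * (s - t)) = 1"
        by (simp add: complex_eq_iff)
      then obtain n :: int where "2 * pi * (s - t) = of_int n * 2 * pi"
        by (auto simp: cos_one_2pi_int)
      then have "s - t = of_int n"
        by simp
      then show "\<exists>n::int. s - t = of_int n" ..
    next
      assume "\<exists>n::int. s - t = of_int n"
      then show "cis (2 * pi * (s - t)) = 1"
        by (auto intro: cis_multiple_2pi)
    qed
    finally show ?thesis
      by (auto simp: Ints_def)
  qed
  show ?thesis
  proof
    assume eq: "torus_embed x s = torus_embed y t"
    then have w: "r *\<^sub>R cis (2 * pi * s) = q *\<^sub>R cis (2 * pi * t)"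
      and z: "r *\<^sub>R (x * cis (2 * pi * s)) = q *\<^sub>R (y * cis (2 * pi * t))"
      by (simp_all add: torus_embed_def r_def q_def)
    from w have "norm (r *\<^sub>R cis (2 * pi * s)) = norm (q *\<^sub>R cis (2 * pi * t))"
      by simp
    then have rq: "r = q"
      using pos by simp
    with w pos have c: "cis (2 * pi * s) = cis (2 * pi * t)"
      by simp
    with z rq pos have "x = y"
      by simp
    with c per show "x = y \<and> s - t \<in> \<int>"
      by simp
  next
    assume "x = y \<and> s - t \<in> \<int>"
    with per show "torus_embed x s = torus_embed y t"
      by (simp add: torus_embed_def)
  qed
qed

lemma torus_embed_image:
  "(\<lambda>(x, s). torus_embed x s) ` (cball 0 1 \<times> UNIV) = {(z, w). (z, w) \<in> S3 \<and> cmod z \<le> cmod w}"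
proof (intro equalityI subsetI)
  fix p assume "p \<in> (\<lambda>(x, s). torus_embed x s) ` (cball 0 1 \<times> UNIV)"
  then obtain x s where xs: "cmod x \<le> 1" "p = torus_embed x s"
    by auto
  have "cmod (fst p) \<le> cmod (snd p)"
    using xs torus_embed_pos[of x]
    by (simp add: torus_embed_def norm_mult divide_right_mono)
  moreover have "p \<in> S3"
    using xs torus_embed_in_S3 by simp
  ultimately show "p \<in> {(z, w). (z, w) \<in> S3 \<and> cmod z \<le> cmod w}"
    by (cases p) auto
next
  fix p assume "p \<in> {(z, w). (z, w) \<in> S3 \<and> cmod z \<le> cmod w}"
  then obtain z w where p: "p = (z, w)" "(cmod z)\<^sup>2 + (cmod w)\<^sup>2 = 1" "cmod z \<le> cmod w"
    by (auto simp: norm_Pair)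
  then have w0: "w \<noteq> 0"
    by auto
  have "1 + (cmod (z / w))\<^sup>2 = ((cmod z)\<^sup>2 + (cmod w)\<^sup>2) / (cmod w)\<^sup>2"
    using w0 by (simp add: norm_divide power_divide field_simps)
  then have "1 + (cmod (z / w))\<^sup>2 = (1 / cmod w)\<^sup>2"
    using p by (simp add: power_divide)
  then have "1 / sqrt (1 + (cmod (z / w))\<^sup>2) = cmod w"
    by (simp add: real_sqrt_divide)
  moreover have "cis (2 * pi * (Arg w / (2 * pi))) = w / cmod w"
    using w0 by (simp add: cis_Arg sgn_eq)
  ultimately have "p = torus_embed (z / w) (Arg w / (2 * pi))"
    using w0 p by (simp add: torus_embed_def scaleR_conv_of_real)
  moreover have "z / w \<in> cball 0 1"
    using p w0 by (simp add: norm_divide divide_le_eq)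
  ultimately show "p \<in> (\<lambda>(x, s). torus_embed x s) ` (cball 0 1 \<times> UNIV)"
    by force
qed

lemma torus_embed_meridian:
  "torus_embed (cis (- 2 * pi * s)) s = (1 / sqrt 2) *\<^sub>R (1, cis (2 * pi * s))"
  by (simp add: torus_embed_def cis_mult)


section \<open>Links and isotopy\<close>

definition smooth_curve :: "(real \<Rightarrow> 'a::real_normed_vector) \<Rightarrow> bool"
  where "smooth_curve c \<longleftrightarrow>
    (\<exists>F. F 0 = c \<and> (\<forall>n s. (F n has_vector_derivative F (Suc n) s) (at s)))"

definition regular_closed_curve :: "(real \<Rightarrow> 'a::real_normed_vector) \<Rightarrow> bool"
  where "regular_closed_curve c \<longleftrightarrow>
    smooth_curve c \<and> (\<forall>s. c (s + 1) = c s) \<and> (\<forall>s. vector_derivative c (at s) \<noteq> 0)"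

text \<open>
  An oriented link with numbered components, each component being parametrised by \<open>\<real> / \<int>\<close>.
\<close>

type_synonym link = "(real \<Rightarrow> complex \<times> complex) list"

definition is_link :: "link \<Rightarrow> bool"
  where "is_link L \<longleftrightarrow>
    (\<forall>c\<in>set L. regular_closed_curve c \<and> range c \<subseteq> S3) \<and>
    (\<forall>i<length L. \<forall>j<length L. \<forall>s t. (L ! i) s = (L ! j) t \<longrightarrow> i = j \<and> s - t \<in> \<int>)"

definition same_oriented_curve :: "(real \<Rightarrow> 'a) \<Rightarrow> (real \<Rightarrow> 'a) \<Rightarrow> bool"
  where "same_oriented_curve c d \<longleftrightarrow>
    (\<exists>\<phi>::real \<Rightarrow> real. continuous_on UNIV \<phi> \<and> strict_mono \<phi> \<and> (\<forall>s. \<phi> (s + 1) = \<phi> s + 1) \<and>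
      (\<forall>s. c s = d (\<phi> s)))"

text \<open>Ambient isotopy, respecting the numbering and the orientations of the components.\<close>

definition isotopic :: "link \<Rightarrow> link \<Rightarrow> bool"
  where "isotopic L L' \<longleftrightarrow> is_link L \<and> is_link L' \<and> length L = length L' \<and>
    (\<exists>f. homotopic_with_canon (\<lambda>h. \<exists>g. homeomorphism S3 S3 h g) S3 S3 id f \<and>
      (\<forall>i<length L. same_oriented_curve (f \<circ> L ! i) (L' ! i)))"


section \<open>Linking numbers\<close>

text \<open>
  Stereographic projection of \<open>S3 - {p}\<close> to \<open>\<real>\<^sup>3\<close>. The three vectors form an orthonormal basis of the
  orthogonal complement of \<open>p\<close>; the sign of the last one makes the projection preserve
  orientation, so that two distinct Hopf fibres have linking number \<open>+1\<close>.
\<close>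

definition stereo :: "complex \<times> complex \<Rightarrow> complex \<times> complex \<Rightarrow> real^3"
  where "stereo p x = (case p of (z, w) \<Rightarrow>
    (1 / (1 - p \<bullet> x)) *\<^sub>R
      vector [(\<i> * z, \<i> * w) \<bullet> x, (- cnj w, cnj z) \<bullet> x, (\<i> * cnj w, - \<i> * cnj z) \<bullet> x])"

definition gauss_integral :: "(real \<Rightarrow> real^3) \<Rightarrow> (real \<Rightarrow> real^3) \<Rightarrow> real"
  where "gauss_integral a b =
    1 / (4 * pi) * integral {0..1} (\<lambda>s. integral {0..1} (\<lambda>t.
      (a s - b t) \<bullet> cross3 (vector_derivative a (at s)) (vector_derivative b (at t)) /
      norm (a s - b t) ^ 3))"

text \<open>
  Gauss's linking integral of two disjoint closed curves is an integer that does not depend on the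
  point \<open>p\<close> from which they are projected; \<open>round\<close> only serves to turn this real number into an
  element of type \<open>int\<close>.
\<close>

definition linking_number :: "(real \<Rightarrow> complex \<times> complex) \<Rightarrow> (real \<Rightarrow> complex \<times> complex) \<Rightarrow> int"
  where "linking_number a b =
    (let p = (SOME p. p \<in> S3 - (range a \<union> range b))
     in round (gauss_integral (stereo p \<circ> a) (stereo p \<circ> b)))"


section \<open>Arrow diagrams\<close>

text \<open>
  A place \<open>(i, s)\<close> with \<open>0 \<le> s < 1\<close> is the parameter value \<open>s\<close> on the \<open>i\<close>-th curve. A pair \<open>(p, q)\<close>
  in \<open>over\<close> records that at the crossing formed by the places \<open>p\<close> and \<open>q\<close>, the strand through \<open>p\<close>
  is the over-strand. The arrows at the places in \<open>forward\<close> point in the direction of increasing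
  parameter, those in \<open>backward\<close> in the opposite direction.
\<close>

type_synonym place = "nat \<times> real"

record arrow_diagram =
  curves :: "(real \<Rightarrow> complex) list"
  over :: "(place \<times> place) set"
  forward :: "place set"
  backward :: "place set"

definition places :: "arrow_diagram \<Rightarrow> place set"
  where "places D = {..<length (curves D)} \<times> {0..<1}"

definition location :: "arrow_diagram \<Rightarrow> place \<Rightarrow> complex"
  where "location D p = (curves D ! fst p) (snd p)"

definition velocity :: "arrow_diagram \<Rightarrow> place \<Rightarrow> complex"
  where "velocity D p = vector_derivative (curves D ! fst p) (at (snd p))"

definition arrows :: "arrow_diagram \<Rightarrow> place set"
  where "arrows D = forward D \<union> backward D"

definition crossing :: "arrow_diagram \<Rightarrow> place \<Rightarrow> place \<Rightarrow> bool"
  where "crossing D p q \<longleftrightarrow>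
    p \<in> places D \<and> q \<in> places D \<and> p \<noteq> q \<and> location D p = location D q"

text \<open>
  The condition \<open>Im (cnj u * v) \<noteq> 0\<close> says that \<open>u\<close> and \<open>v\<close> are linearly independent over the reals.
  The double points are then isolated, hence finite in number.
\<close>

definition is_arrow_diagram :: "arrow_diagram \<Rightarrow> bool"
  where "is_arrow_diagram D \<longleftrightarrow>
    (\<forall>c\<in>set (curves D). regular_closed_curve c \<and> range c \<subseteq> ball 0 1) \<and>
    (\<forall>p q. crossing D p q \<longrightarrow> Im (cnj (velocity D p) * velocity D q) \<noteq> 0) \<and>
    (\<forall>p q r. crossing D p q \<and> crossing D p r \<longrightarrow> q = r) \<and>
    (\<forall>p q. (p, q) \<in> over D \<longrightarrow> crossing D p q) \<and>
    (\<forall>p q. crossing D p q \<longrightarrow> ((p, q) \<in> over D \<longleftrightarrow> (q, p) \<notin> over D)) \<and>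
    finite (arrows D) \<and> arrows D \<subseteq> places D \<and> forward D \<inter> backward D = {} \<and>
    (\<forall>p q. crossing D p q \<longrightarrow> p \<notin> arrows D)"

text \<open>
  The function \<open>h i\<close> is a lift to the reals of the \<open>S\<^sup>1\<close>-coordinate of the \<open>i\<close>-th component, so the
  component lies in \<open>B \<times> {0}\<close> where \<open>h i\<close> is an integer, and its height in the cut-open circle
  is \<open>frac (h i s)\<close>.
\<close>

definition represents :: "arrow_diagram \<Rightarrow> link \<Rightarrow> bool"
  where "represents D L \<longleftrightarrow> is_arrow_diagram D \<and> is_link L \<and> length L = length (curves D) \<and>
    (\<exists>h :: nat \<Rightarrow> real \<Rightarrow> real.
      (\<forall>i<length L.
        continuous_on UNIV (h i) \<and>
        (\<forall>s. (L ! i) s = torus_embed ((curves D ! i) s) (h i s)) \<and>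
        (\<forall>s. h i s \<in> \<int> \<longleftrightarrow> (i, frac s) \<in> arrows D) \<and>
        (\<forall>s. (i, frac s) \<in> forward D \<longrightarrow>
          (\<forall>\<^sub>F t in at_left s. h i t < h i s) \<and> (\<forall>\<^sub>F t in at_right s. h i s < h i t)) \<and>
        (\<forall>s. (i, frac s) \<in> backward D \<longrightarrow>
          (\<forall>\<^sub>F t in at_left s. h i s < h i t) \<and> (\<forall>\<^sub>F t in at_right s. h i t < h i s))) \<and>
      (\<forall>i s j t. ((i, s), (j, t)) \<in> over D \<longrightarrow> frac (h j t) < frac (h i s)))"

definition arrow_diagram_of :: "arrow_diagram \<Rightarrow> link \<Rightarrow> bool"
  where "arrow_diagram_of D L \<longleftrightarrow> (\<exists>L0. represents D L0 \<and> isotopic L0 L)"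


section \<open>Equivalence by k-moves\<close>

text \<open>The interval \<open>{a..b}\<close> of parameters is the part of the strand that carries the new arrows.\<close>

definition adds_arrows :: "nat \<Rightarrow> arrow_diagram \<Rightarrow> arrow_diagram \<Rightarrow> bool"
  where "adds_arrows k D D' \<longleftrightarrow> is_arrow_diagram D \<and> is_arrow_diagram D' \<and>
    (\<exists>i a b S. i < length (curves D) \<and> a \<le> b \<and> b < a + 1 \<and> S \<subseteq> {a..b} \<and> finite S \<and> card S = k \<and>
      (\<forall>s\<in>{a..b}. \<forall>q. \<not> crossing D (i, frac s) q) \<and>
      (\<forall>s\<in>S. (i, frac s) \<notin> arrows D) \<and>
      (let A = (\<lambda>s. (i, frac s)) ` S in
        D' = D\<lparr>forward := forward D \<union> A\<rparr> \<or> D' = D\<lparr>backward := backward D \<union> A\<rparr>))"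

definition k_move :: "nat \<Rightarrow> arrow_diagram \<Rightarrow> arrow_diagram \<Rightarrow> bool"
  where "k_move k D D' \<longleftrightarrow> adds_arrows k D D' \<or> adds_arrows k D' D"

definition same_link :: "arrow_diagram \<Rightarrow> arrow_diagram \<Rightarrow> bool"
  where "same_link D D' \<longleftrightarrow> (\<exists>L. arrow_diagram_of D L \<and> arrow_diagram_of D' L)"

definition k_equivalent :: "nat \<Rightarrow> link \<Rightarrow> link \<Rightarrow> bool"
  where "k_equivalent k L L' \<longleftrightarrow>
    (\<exists>D D'. arrow_diagram_of D L \<and> arrow_diagram_of D' L' \<and>
      (\<lambda>D1 D2. k_move k D1 D2 \<or> same_link D1 D2)\<^sup>*\<^sup>* D D')"

text \<open>
  Links without orientation and without numbering of the components are subsets of the sphere. A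
  choice of numbering and orientations for the first link of a sequence of moves propagates along
  the sequence.
\<close>

definition link_set :: "link \<Rightarrow> (complex \<times> complex) set"
  where "link_set L = (\<Union>c\<in>set L. range c)"

definition unoriented_link :: "(complex \<times> complex) set \<Rightarrow> bool"
  where "unoriented_link X \<longleftrightarrow> (\<exists>L. is_link L \<and> link_set L = X)"

definition unoriented_k_equivalent ::
    "nat \<Rightarrow> (complex \<times> complex) set \<Rightarrow> (complex \<times> complex) set \<Rightarrow> bool"
  where "unoriented_k_equivalent k X Y \<longleftrightarrow>
    (\<exists>L L'. link_set L = X \<and> link_set L' = Y \<and> k_equivalent k L L')"

text \<open>A link is trivial if it has a diagram without crossings and without arrows.\<close>

definition trivial_link :: "(complex \<times> complex) set \<Rightarrow> bool"
  where "trivial_link X \<longleftrightarrow>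
    (\<exists>L D. link_set L = X \<and> arrow_diagram_of D L \<and> (\<forall>p q. \<not> crossing D p q) \<and> arrows D = {})"

end

(*
  Linking numbers modulo k are invariant because they can be computed for continuous loops. Gauss's
  integrand is a closed form, so the integral of two C^1 loops of R^3 does not change when the loops
  are moved slightly off each other; since the complement of two C^1 loops of S^3 is connected, it
  does not depend on the centre of the stereographic projection either. Hence a number lk is
  attached to two disjoint continuous loops of S^3 by approximation. It is invariant under homotopies
  through disjoint loops and additive under concatenation of loops with the same base point.

  Two lifts of the same diagram to T are joined by interpolating the heights, which are determined
  by the diagram up to the order of the strands at the crossings and the number of arrows passed.
  A k-move on a strand x amounts to inserting k turns of the fibre over x, which adds k times the
  linking number of that fibre with the other component. This is an integer: a homotopy of the
  logarithm of c - x turns a curve c avoiding x into a multiple of a circle around the fibre, and for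
  the circle Gauss's integral is found to be 1 in the limit where one of the two fibres degenerates
  to a straight line.
*)

theory Submission
  imports Defs
begin

section \<open>The Gauss linking integral of arcs\<close>

text \<open>The obstacle is regularity. \<open>isotopic\<close> allows arbitrary homeomorphisms and
  continuous reparametrisations, and the heights over a diagram are merely continuous, whereas
  \<open>linking_number\<close> is an integral over derivatives. So the number has to be defined for
  continuous loops before any move can be studied.

  \<open>linking_number\<close> also rounds a real number. The argument controls differences: a
  k-move changes the real value \<open>lk\<close> by k times an integer, and \<open>round\<close>
  commutes with adding an integer. That factor is the linking number of a fibre with a curve
  avoiding it, so sign and normalisation of Gauss's integral have to be settled once, for two Hopf
  fibres.

  For the last claim a link is a set, which can be renumbered, reversed and reparametrised. The Hopf
  link serves as the example because the linking number of its components is 1 or -1 under every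
  such choice, while it is 0 for the components of a trivial link.\<close>

definition gauss_kernel :: "real^3 \<Rightarrow> real^3 \<Rightarrow> real^3 \<Rightarrow> real"
  where "gauss_kernel d u v = (d \<bullet> cross3 u v) / norm d ^ 3"

lemma bounded_bilinear_cross3: "bounded_bilinear cross3"
  by (intro bilinear_conv_bounded_bilinear[THEN iffD1])
     (auto simp: bilinear_def linear_iff left_diff_distrib cross_add_left cross_add_right cross_mult_left cross_mult_right)

lemma continuous_on_gauss_kernel [continuous_intros]:
  assumes "continuous_on X d" "continuous_on X u" "continuous_on X v" "\<And>x. x \<in> X \<Longrightarrow> d x \<noteq> 0"
  shows "continuous_on X (\<lambda>x. gauss_kernel (d x) (u x) (v x))"
  unfolding gauss_kernel_def using assms
  by (intro continuous_intros bounded_bilinear.continuous_on[OF bounded_bilinear_cross3]) auto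

lemma has_vector_derivative_gauss_kernel:
  assumes d: "(d has_vector_derivative d') (at x within X)"
    and u: "(u has_vector_derivative u') (at x within X)" and 0: "d x \<noteq> 0"
  shows "((\<lambda>x. gauss_kernel (d x) (u x) v) has_vector_derivative
    ((d' \<bullet> cross3 (u x) v + d x \<bullet> cross3 u' v) / norm (d x) ^ 3
      - 3 * (d x \<bullet> d') * (d x \<bullet> cross3 (u x) v) / norm (d x) ^ 5)) (at x within X)"
proof -
  from bounded_linear.has_vector_derivative[OF bounded_bilinear.bounded_linear_left[OF bounded_bilinear_cross3] u]
  have c: "((\<lambda>x. cross3 (u x) v) has_vector_derivative cross3 u' v) (at x within X)" .
  have n: "((\<lambda>x. norm (d x)) has_vector_derivative (d x \<bullet> d') / norm (d x)) (at x within X)"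
    unfolding has_vector_derivative_def
    by (rule has_derivative_eq_rhs, rule has_derivative_compose[OF d[unfolded has_vector_derivative_def]],
        rule has_derivative_norm[OF 0])
       (auto simp: fun_eq_iff sgn_div_norm inner_commute divide_inverse ac_simps)
  have i: "((\<lambda>x. d x \<bullet> cross3 (u x) v) has_vector_derivative
      (d' \<bullet> cross3 (u x) v + d x \<bullet> cross3 u' v)) (at x within X)"
    using d c unfolding has_vector_derivative_def
    by (auto intro!: derivative_eq_intros simp: fun_eq_iff algebra_simps)
  show ?thesis
    unfolding gauss_kernel_def has_real_derivative_iff_has_vector_derivative[symmetric]
    by (rule derivative_eq_intros i[folded has_real_derivative_iff_has_vector_derivative]
        n[folded has_real_derivative_iff_has_vector_derivative] refl | simp add: 0)+
       (use 0 in \<open>simp add: field_simps power_eq_if\<close>)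
qed

text \<open>Four vectors of three-dimensional space are linearly dependent: Cramer's rule writes
  \<open>(u \<bullet> cross3 v w) *\<^sub>R d\<close> as a combination of u, v and w, and this is
  its inner product with d.\<close>

lemma cross3_quadruple:
  "(d \<bullet> u) * (d \<bullet> cross3 v w) + (d \<bullet> v) * (d \<bullet> cross3 w u) + (d \<bullet> w) * (d \<bullet> cross3 u v)
    = (u \<bullet> cross3 v w) * (d \<bullet> d)"
  by (simp add: cross3_simps)

text \<open>\<open>gauss_kernel d\<close> is the solid angle form, the pull-back of the area form of
  the unit sphere under normalisation of d; its exterior derivative is evaluated here on \<delta>, u
  and w. The terms with \<delta>' cancel as mixed second derivatives. What remains is three times
  one triple product, which \<open>cross3_quadruple\<close> matches with the other terms.\<close>

lemma gauss_kernel_closed: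
  assumes "d \<noteq> 0"
  shows "((\<delta> \<bullet> cross3 u w + d \<bullet> cross3 \<delta>' w) / norm d ^ 3 - 3 * (d \<bullet> \<delta>) * (d \<bullet> cross3 u w) / norm d ^ 5)
    - ((u \<bullet> cross3 \<delta> w + d \<bullet> cross3 \<delta>' w) / norm d ^ 3 - 3 * (d \<bullet> u) * (d \<bullet> cross3 \<delta> w) / norm d ^ 5)
    = ((- w) \<bullet> cross3 \<delta> u + d \<bullet> cross3 0 u) / norm d ^ 3 - 3 * (d \<bullet> (- w)) * (d \<bullet> cross3 \<delta> u) / norm d ^ 5"
proof -
  define N where "N = norm d"
  have N: "N \<noteq> 0" "d \<bullet> d = N^2" using assms by (auto simp: N_def dot_square_norm)
  have e: "u \<bullet> cross3 \<delta> w = - (\<delta> \<bullet> cross3 u w)" "w \<bullet> cross3 \<delta> u = \<delta> \<bullet> cross3 u w"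
     "d \<bullet> cross3 w \<delta> = - (d \<bullet> cross3 \<delta> w)"
    by (simp_all add: cross3_simps)
  have "(\<delta> \<bullet> cross3 u w) * N^2 = (d \<bullet> \<delta>) * (d \<bullet> cross3 u w) - (d \<bullet> u) * (d \<bullet> cross3 \<delta> w) + (d \<bullet> w) * (d \<bullet> cross3 \<delta> u)"
    using cross3_quadruple[of d \<delta> u w] e N by simp
  moreover have "((T + X) / N ^ 3 - 3 * A1 * A2 / N ^ 5) - ((- T + X) / N ^ 3 - 3 * B1 * B2 / N ^ 5)
      = (- T + 0) / N ^ 3 - 3 * (- C1) * C2 / N ^ 5"
    if "T * N\<^sup>2 = A1 * A2 - B1 * B2 + C1 * C2" for T X A1 A2 B1 B2 C1 C2 :: real
  proof -
    have "T / N ^ 3 = (A1 * A2 - B1 * B2 + C1 * C2) / N ^ 5"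
      unfolding that[symmetric] using N by (simp add: field_simps power_eq_if)
    then have "3 * (T / N ^ 3) = 3 * A1 * A2 / N ^ 5 - 3 * B1 * B2 / N ^ 5 + 3 * C1 * C2 / N ^ 5"
      by (simp add: diff_divide_distrib add_divide_distrib mult.assoc)
    then show ?thesis by (simp add: diff_divide_distrib add_divide_distrib)
  qed
  ultimately show ?thesis
    by (simp add: N_def[symmetric] e)
qed

lemma continuous_on_compose_intro:
  "continuous_on T f \<Longrightarrow> continuous_on S g \<Longrightarrow> (\<And>x. x \<in> S \<Longrightarrow> g x \<in> T) \<Longrightarrow> continuous_on S (\<lambda>x. f (g x))"
  by (rule continuous_on_compose2) auto

text \<open>
  Gauss's integrand is a closed form on the space of pairs of points, so its integral over the
  boundary of a ruled square, times a closed curve, vanishes.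
\<close>

lemma gauss_ruled_square:
  fixes a0 a1 b :: "real \<Rightarrow> real^3"
  assumes a0: "\<And>s. s \<in> {0..1} \<Longrightarrow> (a0 has_vector_derivative a0' s) (at s within {0..1})" "continuous_on {0..1} a0'"
    and a1: "\<And>s. s \<in> {0..1} \<Longrightarrow> (a1 has_vector_derivative a1' s) (at s within {0..1})" "continuous_on {0..1} a1'"
    and b: "\<And>s. s \<in> {0..1} \<Longrightarrow> (b has_vector_derivative b' s) (at s within {0..1})" "continuous_on {0..1} b'"
    and closed: "b 0 = b 1"
    and sep: "\<And>r s t. r \<in> {0..1} \<Longrightarrow> s \<in> {0..1} \<Longrightarrow> t \<in> {0..1} \<Longrightarrow> (1 - r) *\<^sub>R a0 s + r *\<^sub>R a1 s \<noteq> b t"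
  defines "J \<equiv> \<lambda>a a'. integral {0..1} (\<lambda>s. integral {0..1} (\<lambda>t. gauss_kernel (a s - b t) (a' s) (b' t)))"
  defines "E \<equiv> \<lambda>x y. J (\<lambda>r. (1 - r) *\<^sub>R x + r *\<^sub>R y) (\<lambda>_. y - x)"
  shows "J a1 a1' - J a0 a0' = E (a0 1) (a1 1) - E (a0 0) (a1 0)"
proof -
  have ca0: "continuous_on {0..1} a0" and ca1: "continuous_on {0..1} a1" and cb: "continuous_on {0..1} b"
    by (auto simp: continuous_on_eq_continuous_within intro!: has_vector_derivative_continuous a0(1) a1(1) b(1))
  note ci = continuous_on_compose_intro[OF ca0] continuous_on_compose_intro[OF ca1]
    continuous_on_compose_intro[OF cb] continuous_on_compose_intro[OF a0(2)]
    continuous_on_compose_intro[OF a1(2)] continuous_on_compose_intro[OF b(2)]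
  define F where "F = (\<lambda>r s. (1 - r) *\<^sub>R a0 s + r *\<^sub>R a1 s)"
  define Fs where "Fs = (\<lambda>r s. (1 - r) *\<^sub>R a0' s + r *\<^sub>R a1' s)"
  define \<delta> where "\<delta> = (\<lambda>s. a1 s - a0 s)"
  define \<delta>' where "\<delta>' = (\<lambda>s. a1' s - a0' s)"
  define D where "D = (\<lambda>d u u' v w. (v \<bullet> cross3 u w + d \<bullet> cross3 u' w) / norm d ^ 3
      - 3 * (d \<bullet> v) * (d \<bullet> cross3 u w) / norm d ^ (5::nat))"
  have ne: "F r s - b t \<noteq> 0" if "r \<in> {0..1}" "s \<in> {0..1}" "t \<in> {0..1}" for r s t
    using sep[OF that] by (simp add: F_def)
  \<comment> \<open>Q uses the velocity of the ruled square in the direction of s, P the one in the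
    direction of r; Qr and Ps are their derivatives in the respective other parameter.\<close>
  define Q where "Q = (\<lambda>r s. integral {0..1} (\<lambda>t. gauss_kernel (F r s - b t) (Fs r s) (b' t)))"
  define P where "P = (\<lambda>r s. integral {0..1} (\<lambda>t. gauss_kernel (F r s - b t) (\<delta> s) (b' t)))"
  define Qr where "Qr = (\<lambda>r s. integral {0..1} (\<lambda>t. D (F r s - b t) (Fs r s) (\<delta>' s) (\<delta> s) (b' t)))"
  define Ps where "Ps = (\<lambda>r s. integral {0..1} (\<lambda>t. D (F r s - b t) (\<delta> s) (\<delta>' s) (Fs r s) (b' t)))"
  have Dc: "continuous_on X (\<lambda>x. D (d x) (u x) (u' x) (v x) (w x))"
    if "continuous_on X d" "continuous_on X u" "continuous_on X u'" "continuous_on X v" "continuous_on X w"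
      "\<And>x. x \<in> X \<Longrightarrow> d x \<noteq> 0" for X :: "'x::t2_space set" and d u u' v w
    unfolding D_def using that by (intro continuous_intros continuous_on_cross) auto
  have Q_der: "((\<lambda>r. Q r s) has_vector_derivative Qr r s) (at r within {0..1})"
    if "r \<in> {0..1}" "s \<in> {0..1}" for r s
    unfolding Q_def Qr_def
  proof (rule leibniz_rule_vector_derivative[where a = "0::real" and b = 1, unfolded cbox_interval])
    fix r t :: real assume rt: "r \<in> {0..1}" "t \<in> {0..1}"
    show "((\<lambda>r. gauss_kernel (F r s - b t) (Fs r s) (b' t)) has_vector_derivative
        D (F r s - b t) (Fs r s) (\<delta>' s) (\<delta> s) (b' t)) (at r within {0..1})"
      unfolding D_def
      by (rule has_vector_derivative_gauss_kernel)
         (use rt that ne in \<open>auto simp: F_def Fs_def \<delta>_def \<delta>'_def algebra_simps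
            intro!: derivative_eq_intros\<close>)
  next
    fix r :: real assume rt: "r \<in> {0..1}"
    show "(\<lambda>t. gauss_kernel (F r s - b t) (Fs r s) (b' t)) integrable_on {0..1}"
      by (rule integrable_continuous_interval) (use rt that ne cb b(2) in \<open>auto intro!: continuous_intros\<close>)
  next
    show "continuous_on ({0..1} \<times> {0..1}) (\<lambda>(r, t). D (F r s - b t) (Fs r s) (\<delta>' s) (\<delta> s) (b' t))"
      unfolding case_prod_beta F_def Fs_def
      by (intro Dc continuous_intros ci) (use that ne[unfolded F_def] in auto)
  qed (use that in auto)
  have Fs: "((\<lambda>s. F r s) has_vector_derivative Fs r s) (at s within {0..1})" if "s \<in> {0..1}" for r s
    unfolding F_def Fs_def using a0(1)[OF that] a1(1)[OF that]
    by (auto intro!: derivative_eq_intros)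
  have \<delta>s: "(\<delta> has_vector_derivative \<delta>' s) (at s within {0..1})" if "s \<in> {0..1}" for s
    unfolding \<delta>_def \<delta>'_def using a0(1)[OF that] a1(1)[OF that]
    by (auto intro!: derivative_eq_intros)
  have P_der: "((\<lambda>s. P r s) has_vector_derivative Ps r s) (at s within {0..1})"
    if "r \<in> {0..1}" "s \<in> {0..1}" for r s
    unfolding P_def Ps_def
  proof (rule leibniz_rule_vector_derivative[where a = "0::real" and b = 1, unfolded cbox_interval])
    fix s t :: real assume rt: "s \<in> {0..1}" "t \<in> {0..1}"
    have "((\<lambda>s. F r s - b t) has_vector_derivative Fs r s) (at s within {0..1})"
      using has_vector_derivative_diff[OF Fs[OF rt(1)] has_vector_derivative_const] by simp
    then show "((\<lambda>s. gauss_kernel (F r s - b t) (\<delta> s) (b' t)) has_vector_derivative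
        D (F r s - b t) (\<delta> s) (\<delta>' s) (Fs r s) (b' t)) (at s within {0..1})"
      unfolding D_def
      by (rule has_vector_derivative_gauss_kernel) (use rt that ne \<delta>s in auto)
  next
    fix s :: real assume rt: "s \<in> {0..1}"
    show "(\<lambda>t. gauss_kernel (F r s - b t) (\<delta> s) (b' t)) integrable_on {0..1}"
      by (rule integrable_continuous_interval) (use rt that ne cb b(2) in \<open>auto intro!: continuous_intros\<close>)
  next
    show "continuous_on ({0..1} \<times> {0..1}) (\<lambda>(s, t). D (F r s - b t) (\<delta> s) (\<delta>' s) (Fs r s) (b' t))"
      unfolding case_prod_beta F_def Fs_def \<delta>_def \<delta>'_def
      by (intro Dc continuous_intros ci) (use that ne[unfolded F_def] in auto)
  qed (use that in auto)
  \<comment> \<open>By closedness the two integrands differ by R, a derivative with respect to t,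
    whose integral vanishes because b is closed.\<close>
  have eq: "Qr r s = Ps r s" if rs: "r \<in> {0..1}" "s \<in> {0..1}" for r s
  proof -
    define R where "R = (\<lambda>t. D (F r s - b t) (\<delta> s) 0 (- b' t) (Fs r s))"
    have "((\<lambda>t. gauss_kernel (F r s - b t) (\<delta> s) (Fs r s)) has_vector_derivative R t) (at t within {0..1})"
      if t: "t \<in> {0..1}" for t
    proof -
      have "((\<lambda>t. F r s - b t) has_vector_derivative - b' t) (at t within {0..1})"
        using has_vector_derivative_diff[OF has_vector_derivative_const b(1)[OF t]] by simp
      then show ?thesis
        unfolding R_def D_def
        by (rule has_vector_derivative_gauss_kernel) (use ne rs t in auto)
    qed
    then have "(R has_integral gauss_kernel (F r s - b 1) (\<delta> s) (Fs r s) - gauss_kernel (F r s - b 0) (\<delta> s) (Fs r s)) {0..1}"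
      by (intro fundamental_theorem_of_calculus) auto
    then have R0: "(R has_integral 0) {0..1}" using closed by simp
    have "D (F r s - b t) (Fs r s) (\<delta>' s) (\<delta> s) (b' t) = D (F r s - b t) (\<delta> s) (\<delta>' s) (Fs r s) (b' t) + R t"
      if "t \<in> {0..1}" for t
      using gauss_kernel_closed[OF ne[OF rs that], of "\<delta> s" "Fs r s" "b' t" "\<delta>' s"]
      unfolding R_def D_def by linarith
    then have "Qr r s = integral {0..1} (\<lambda>t. D (F r s - b t) (\<delta> s) (\<delta>' s) (Fs r s) (b' t) + R t)"
      unfolding Qr_def by (intro integral_cong) auto
    also have "\<dots> = Ps r s + integral {0..1} R"
      unfolding Ps_def
      by (rule integral_add[OF _ has_integral_integrable[OF R0]])
         (use rs ne cb b(2) in \<open>auto intro!: integrable_continuous_interval Dc continuous_intros\<close>)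
    finally show ?thesis using R0 by (simp add: integral_unique)
  qed
  have "integral {0..1} (\<lambda>r. Qr r s) = Q 1 s - Q 0 s" if "s \<in> {0..1}" for s
    by (rule integral_unique, rule fundamental_theorem_of_calculus) (use Q_der that in auto)
  then have 1: "integral {0..1} (\<lambda>s. Q 1 s - Q 0 s) = integral {0..1} (\<lambda>s. integral {0..1} (\<lambda>r. Qr r s))"
    by (intro integral_cong) auto
  have "integral {0..1} (\<lambda>s. Ps r s) = P r 1 - P r 0" if "r \<in> {0..1}" for r
    by (rule integral_unique, rule fundamental_theorem_of_calculus) (use P_der that in auto)
  then have "integral {0..1} (\<lambda>s. Qr r s) = P r 1 - P r 0" if "r \<in> {0..1}" for r
    using integral_cong[of "{0..1}" "Qr r" "Ps r"] eq that by simp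
  then have 2: "integral {0..1} (\<lambda>r. P r 1 - P r 0) = integral {0..1} (\<lambda>r. integral {0..1} (\<lambda>s. Qr r s))"
    by (intro integral_cong) auto
  \<comment> \<open>Integrated first over r, the mixed derivative leaves the sides along a0 and a1;
    first over s, it leaves the sides between corresponding end points. Fubini equates the
    two.\<close>
  have "continuous_on ({0..1} \<times> {0..1}) (\<lambda>(s, r). Qr r s)"
    unfolding Qr_def case_prod_beta
    by (rule integral_continuous_on_param[where a = "0::real" and b = 1, unfolded cbox_interval])
       (unfold case_prod_beta F_def Fs_def \<delta>_def \<delta>'_def,
        intro Dc continuous_intros ci, use ne[unfolded F_def] in auto)
  then have 3: "integral {0..1} (\<lambda>s. integral {0..1} (\<lambda>r. Qr r s)) = integral {0..1} (\<lambda>r. integral {0..1} (\<lambda>s. Qr r s))"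
    using integral_swap_continuous[of 0 0 "1::real" "1::real" "\<lambda>s r. Qr r s"] by (simp add: cbox_Pair_eq)
  have Qi: "(\<lambda>s. Q r s) integrable_on {0..1}" if "r \<in> {0..1}" for r
    unfolding Q_def 
    by (rule integrable_continuous_interval, rule integral_continuous_on_param[where a = "0::real" and b = 1, unfolded cbox_interval])
       (unfold case_prod_beta F_def Fs_def, intro continuous_intros ci, use that ne[unfolded F_def] in auto)
  have Pi: "(\<lambda>r. P r s) integrable_on {0..1}" if "s \<in> {0..1}" for s
    unfolding P_def 
    by (rule integrable_continuous_interval, rule integral_continuous_on_param[where a = "0::real" and b = 1, unfolded cbox_interval])
       (unfold case_prod_beta F_def Fs_def, intro continuous_intros ci, use that ne[unfolded F_def] in auto)
  have "J a1 a1' - J a0 a0' = integral {0..1} (\<lambda>s. Q 1 s - Q 0 s)"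
    using Qi[of 0] Qi[of 1] by (simp add: integral_diff) (simp add: J_def Q_def F_def Fs_def)
  also have "\<dots> = integral {0..1} (\<lambda>r. P r 1 - P r 0)" using 1 2 3 by simp
  also have "\<dots> = E (a0 1) (a1 1) - E (a0 0) (a1 0)"
    using Pi[of 0] Pi[of 1] by (simp add: integral_diff) (simp add: E_def J_def P_def F_def \<delta>_def)
  finally show ?thesis .
qed

lemma gauss_integral_kernel:
  "gauss_integral a b = 1 / (4 * pi) * integral {0..1} (\<lambda>s. integral {0..1} (\<lambda>t.
    gauss_kernel (a s - b t) (vector_derivative a (at s)) (vector_derivative b (at t))))"
  by (simp add: gauss_integral_def gauss_kernel_def)

lemma C1_differentiable_on_vector_derivative:
  assumes "f C1_differentiable_on {0..1}"
  shows "\<And>s. s \<in> {0..1} \<Longrightarrow> (f has_vector_derivative vector_derivative f (at s)) (at s)"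
    and "\<And>s. s \<in> {0..1} \<Longrightarrow> (f has_vector_derivative vector_derivative f (at s)) (at s within {0..1})"
    and "continuous_on {0..1} (\<lambda>s. vector_derivative f (at s))" and "continuous_on {0..1} f"
proof -
  show *: "(f has_vector_derivative vector_derivative f (at s)) (at s)" if "s \<in> {0..1}" for s
    using assms that by (simp add: C1_differentiable_on_eq vector_derivative_works)
  then show "(f has_vector_derivative vector_derivative f (at s)) (at s within {0..1})" if "s \<in> {0..1}" for s
    using that has_vector_derivative_at_within by blast
  then show "continuous_on {0..1} f"
    unfolding continuous_on_eq_continuous_within by (blast intro: has_vector_derivative_continuous)
  show "continuous_on {0..1} (\<lambda>s. vector_derivative f (at s))"
    using assms by (simp add: C1_differentiable_on_eq)
qed

lemma vector_derivative_linepath: "vector_derivative (linepath x y) (at r) = y - x"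
  by (rule vector_derivative_at) (rule has_vector_derivative_linepath_within)

text \<open>The right side belongs to the segments between corresponding end points. For closed
  curves these two terms cancel; for consecutive arcs they cancel against those of the neighbour,
  which \<open>gauss_integral_join\<close> exploits.\<close>

lemma gauss_integral_ruled_square:
  assumes "a0 C1_differentiable_on {0..1}" "a1 C1_differentiable_on {0..1}" "b C1_differentiable_on {0..1}"
    and "b 0 = b 1"
    and "\<And>s t. s \<in> {0..1} \<Longrightarrow> t \<in> {0..1} \<Longrightarrow> b t \<notin> closed_segment (a0 s) (a1 s)"
  shows "gauss_integral a1 b - gauss_integral a0 b =
    gauss_integral (linepath (a0 1) (a1 1)) b - gauss_integral (linepath (a0 0) (a1 0)) b"
proof -
  have "(1 - r) *\<^sub>R a0 s + r *\<^sub>R a1 s \<noteq> b t" if "r \<in> {0..1}" "s \<in> {0..1}" "t \<in> {0..1}" for r s t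
    using assms(5)[OF that(2,3)] that(1) by (force simp: closed_segment_def)
  note * = gauss_ruled_square[OF C1_differentiable_on_vector_derivative(2,3)[OF assms(1)]
      C1_differentiable_on_vector_derivative(2,3)[OF assms(2)]
      C1_differentiable_on_vector_derivative(2,3)[OF assms(3)] assms(4) this]
  show ?thesis
    unfolding gauss_integral_kernel vector_derivative_linepath
    using * by (simp add: linepath_def flip: right_diff_distrib diff_divide_distrib)
qed

lemma gauss_integral_homotopic_left:
  assumes "a0 C1_differentiable_on {0..1}" "a1 C1_differentiable_on {0..1}" "b C1_differentiable_on {0..1}"
    and "a0 0 = a0 1" "a1 0 = a1 1" "b 0 = b 1"
    and "\<And>s t. s \<in> {0..1} \<Longrightarrow> t \<in> {0..1} \<Longrightarrow> b t \<notin> closed_segment (a0 s) (a1 s)"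
  shows "gauss_integral a0 b = gauss_integral a1 b"
  using gauss_integral_ruled_square[of a0 a1 b] assms by simp

text \<open>Exchanging the curves reverses d and transposes the velocities; the two signs cancel in
  the kernel, and Fubini does the rest.\<close>

lemma gauss_integral_commute:
  assumes "a C1_differentiable_on {0..1}" "b C1_differentiable_on {0..1}"
    and "\<And>s t. s \<in> {0..1} \<Longrightarrow> t \<in> {0..1} \<Longrightarrow> a s \<noteq> b t"
  shows "gauss_integral a b = gauss_integral b a"
proof -
  note a = C1_differentiable_on_vector_derivative(3,4)[OF assms(1)]
  note b = C1_differentiable_on_vector_derivative(3,4)[OF assms(2)]
  note ci = a[THEN continuous_on_compose_intro] b[THEN continuous_on_compose_intro]
  have sym: "gauss_kernel (x - y) u v = gauss_kernel (y - x) v u" for x y u v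
    by (simp add: gauss_kernel_def norm_minus_commute) (simp add: cross3_simps)
  have "continuous_on ({0..1} \<times> {0..1}) (\<lambda>(s, t).
      gauss_kernel (a s - b t) (vector_derivative a (at s)) (vector_derivative b (at t)))"
    unfolding case_prod_beta by (intro continuous_intros ci) (use assms(3) in auto)
  then show ?thesis
    unfolding gauss_integral_kernel
    using integral_swap_continuous[of 0 0 "1::real" "1::real" "\<lambda>s t.
      gauss_kernel (a s - b t) (vector_derivative a (at s)) (vector_derivative b (at t))"]
    by (simp add: cbox_Pair_eq sym[of "a _" "b _"])
qed

lemma not_in_closed_segment_if_dist:
  fixes x y :: "'a::euclidean_space"
  assumes "dist x x' < dist x y"
  shows "y \<notin> closed_segment x x'"
  using assms dist_in_closed_segment[of y x x'] by (auto simp: dist_commute)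

text \<open>The curves move along segments one after the other. After the first motion the distance
  from \<open>a1 s\<close> to \<open>b0 t\<close> still exceeds the length of the second, which is
  why the two displacements are added in the bound.\<close>

lemma gauss_integral_near:
  assumes "a0 C1_differentiable_on {0..1}" "a1 C1_differentiable_on {0..1}"
    "b0 C1_differentiable_on {0..1}" "b1 C1_differentiable_on {0..1}"
    and "a0 0 = a0 1" "a1 0 = a1 1" "b0 0 = b0 1" "b1 0 = b1 1"
    and near: "\<And>s t. s \<in> {0..1} \<Longrightarrow> t \<in> {0..1} \<Longrightarrow> dist (a0 s) (a1 s) + dist (b0 t) (b1 t) < dist (a0 s) (b0 t)"
  shows "gauss_integral a0 b0 = gauss_integral a1 b1"
proof -
  have sep: "b0 t \<notin> closed_segment (a0 s) (a1 s)" "a1 s \<notin> closed_segment (b0 t) (b1 t)"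
    if "s \<in> {0..1}" "t \<in> {0..1}" for s t
  proof (rule not_in_closed_segment_if_dist)
    show "dist (a0 s) (a1 s) < dist (a0 s) (b0 t)"
      using near[OF that] zero_le_dist[of "b0 t" "b1 t"] by linarith
    show "a1 s \<notin> closed_segment (b0 t) (b1 t)"
      using near[OF that] dist_triangle[of "a0 s" "b0 t" "a1 s"]
      by (intro not_in_closed_segment_if_dist) (simp add: dist_commute)
  qed
  have "gauss_integral a0 b0 = gauss_integral a1 b0"
    using assms sep by (intro gauss_integral_homotopic_left) auto
  also have "\<dots> = gauss_integral b0 a1"
    using assms(1-8) sep(1) by (intro gauss_integral_commute) (auto, metis atLeastAtMost_iff ends_in_segment(2))
  also have "\<dots> = gauss_integral b1 a1"
    using assms sep by (intro gauss_integral_homotopic_left) auto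
  also have "\<dots> = gauss_integral a1 b1"
    using assms(1-8) sep(2) by (intro gauss_integral_commute) (auto, metis atLeastAtMost_iff ends_in_segment(2))
  finally show ?thesis .
qed

section \<open>Subdividing and joining arcs\<close>

lemma C1_differentiable_on_affine:
  assumes "\<gamma> C1_differentiable_on {0..1::real}" "0 \<le> c" "0 \<le> d" "c + d \<le> 1"
  shows "(\<lambda>s. \<gamma> (c * s + d)) C1_differentiable_on {0..1}"
    and "\<And>s. s \<in> {0..1} \<Longrightarrow>
      vector_derivative (\<lambda>s. \<gamma> (c * s + d)) (at s) = c *\<^sub>R vector_derivative \<gamma> (at (c * s + d))"
proof -
  note \<gamma> = C1_differentiable_on_vector_derivative[OF assms(1)]
  have in01: "c * s + d \<in> {0..1}" if "s \<in> {0..1}" for s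
  proof -
    have "c * s \<le> c * 1" using that assms by (intro mult_left_mono) auto
    then show ?thesis using that assms by auto
  qed
  have d: "((\<lambda>s. \<gamma> (c * s + d)) has_vector_derivative c *\<^sub>R vector_derivative \<gamma> (at (c * s + d))) (at s)"
    if "s \<in> {0..1}" for s
  proof -
    have "((\<lambda>s. c * s + d) has_vector_derivative c) (at s)"
      unfolding has_real_derivative_iff_has_vector_derivative[symmetric]
      by (auto intro!: derivative_eq_intros)
    from vector_diff_chain_at[OF this \<gamma>(1)[OF in01[OF that]]] show ?thesis
      by (simp add: o_def)
  qed
  then show "\<And>s. s \<in> {0..1} \<Longrightarrow>
      vector_derivative (\<lambda>s. \<gamma> (c * s + d)) (at s) = c *\<^sub>R vector_derivative \<gamma> (at (c * s + d))"
    by (simp add: vector_derivative_at)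
  have "continuous_on {0..1} (\<lambda>s. c *\<^sub>R vector_derivative \<gamma> (at (c * s + d)))"
    by (intro continuous_intros continuous_on_compose_intro[OF \<gamma>(3)]) (use in01 in auto)
  with d show "(\<lambda>s. \<gamma> (c * s + d)) C1_differentiable_on {0..1}"
    unfolding C1_differentiable_on_def
    by (intro exI[of _ "\<lambda>s. c *\<^sub>R vector_derivative \<gamma> (at (c * s + d))"]) auto
qed

text \<open>The substitution is carried out on the primitive of the outer integrand f: each half
  contributes a difference of two of its values. The form \<open>1/2 * s + d\<close> treats both
  halves at once.\<close>

lemma gauss_integral_halves:
  assumes "\<gamma> C1_differentiable_on {0..1}" "b C1_differentiable_on {0..1}"
    and ne: "\<And>s t. s \<in> {0..1} \<Longrightarrow> t \<in> {0..1} \<Longrightarrow> \<gamma> s \<noteq> b t"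
  shows "gauss_integral \<gamma> b =
    gauss_integral (\<lambda>s. \<gamma> (1/2 * s + 0)) b + gauss_integral (\<lambda>s. \<gamma> (1/2 * s + 1/2)) b"
proof -
  note \<gamma> = C1_differentiable_on_vector_derivative(3,4)[OF assms(1)]
  note b = C1_differentiable_on_vector_derivative(3,4)[OF assms(2)]
  note ci = \<gamma>[THEN continuous_on_compose_intro] b[THEN continuous_on_compose_intro]
  define f where "f = (\<lambda>s. integral {0..1} (\<lambda>t.
      gauss_kernel (\<gamma> s - b t) (vector_derivative \<gamma> (at s)) (vector_derivative b (at t))))"
  have "continuous_on {0..1} f"
    unfolding f_def
    by (rule integral_continuous_on_param[where a = "0::real" and b = 1, unfolded cbox_interval],
        unfold case_prod_beta, intro continuous_intros ci) (use ne in auto)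
  from integral_has_vector_derivative[OF this]
  have \<Phi>: "((\<lambda>x. integral {0..x} f) has_vector_derivative f x) (at x within {0..1})" if "x \<in> {0..1}" for x
    using that by auto
  have scale: "gauss_kernel x (c *\<^sub>R u) v = c * gauss_kernel x u v" for x u v c
    by (simp add: gauss_kernel_def cross_mult_left)
  have half: "gauss_integral (\<lambda>s. \<gamma> (1/2 * s + d)) b = 1 / (4 * pi) * (integral {0..1/2 + d} f - integral {0..d} f)"
    if d: "d = 0 \<or> d = 1/2" for d :: real
  proof -
    have "integral {0..1} (\<lambda>s. (1/2) *\<^sub>R f (1/2 * s + d)) =
        integral {0..1/2 * 1 + d} f - integral {0..1/2 * 0 + d} f"
    proof (rule integral_unique, rule fundamental_theorem_of_calculus)
      fix s :: real assume s: "s \<in> {0..1}"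
      have "((\<lambda>s. 1/2 * s + d) has_vector_derivative 1/2) (at s within {0..1})"
        unfolding has_real_derivative_iff_has_vector_derivative[symmetric]
        by (auto intro!: derivative_eq_intros)
      moreover have "((\<lambda>x. integral {0..x} f) has_vector_derivative f (1/2 * s + d))
          (at (1/2 * s + d) within (\<lambda>s. 1/2 * s + d) ` {0..1})"
        using s d by (intro has_vector_derivative_within_subset[OF \<Phi>]) auto
      ultimately show "((\<lambda>s. integral {0..1/2 * s + d} f) has_vector_derivative (1/2) *\<^sub>R f (1/2 * s + d))
          (at s within {0..1})"
        using vector_diff_chain_within[of "\<lambda>s. 1/2 * s + d" "1/2" s "{0..1}" "\<lambda>x. integral {0..x} f"]
        by (simp add: o_def)
    qed auto
    moreover have "integral {0..1} (\<lambda>s. integral {0..1} (\<lambda>t. gauss_kernel (\<gamma> (1/2 * s + d) - b t)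
        (vector_derivative (\<lambda>s. \<gamma> (1/2 * s + d)) (at s)) (vector_derivative b (at t)))) =
        integral {0..1} (\<lambda>s. (1/2) *\<^sub>R f (1/2 * s + d))"
      by (rule integral_cong, subst C1_differentiable_on_affine(2)[OF assms(1)])
         (use d in \<open>auto simp: scale f_def\<close>)
    ultimately show ?thesis
      unfolding gauss_integral_kernel by simp
  qed
  show ?thesis
    using half[of 0] half[of "1/2"] unfolding gauss_integral_kernel f_def[symmetric]
    by (simp add: right_diff_distrib)
qed

text \<open>A join of C1 loops may have corners, so a C1 loop \<gamma> close to it takes its place.
  Each half of \<gamma> is moved along segments onto its loop; the segment from
  \<open>\<gamma> (1/2)\<close> to q occurs with both signs, and the other two cancel because
  \<gamma> is closed.\<close>

lemma gauss_integral_join: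
  assumes "\<gamma> C1_differentiable_on {0..1}" "a1 C1_differentiable_on {0..1}"
    "a2 C1_differentiable_on {0..1}" "b C1_differentiable_on {0..1}"
    and "\<gamma> 0 = \<gamma> 1" "a1 0 = q" "a1 1 = q" "a2 0 = q" "a2 1 = q" "b 0 = b 1"
    and near: "\<And>s t. s \<in> {0..1} \<Longrightarrow> t \<in> {0..1} \<Longrightarrow> dist (\<gamma> s) ((a1 +++ a2) s) < dist (\<gamma> s) (b t)"
  shows "gauss_integral \<gamma> b = gauss_integral a1 b + gauss_integral a2 b"
proof -
  have near1: "b t \<notin> closed_segment (\<gamma> (1/2 * s + 0)) (a1 s)"
    and near2: "b t \<notin> closed_segment (\<gamma> (1/2 * s + 1/2)) (a2 s)" if "s \<in> {0..1}" "t \<in> {0..1}" for s t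
  proof -
    show "b t \<notin> closed_segment (\<gamma> (1/2 * s + 0)) (a1 s)"
      using near[of "1/2 * s" t] that by (intro not_in_closed_segment_if_dist) (auto simp: joinpaths_def)
    have "(a1 +++ a2) (1/2 * s + 1/2) = a2 s"
      using that assms by (cases "s = 0") (auto simp: joinpaths_def)
    then show "b t \<notin> closed_segment (\<gamma> (1/2 * s + 1/2)) (a2 s)"
      using near[of "1/2 * s + 1/2" t] that by (intro not_in_closed_segment_if_dist) auto
  qed
  have ne: "\<gamma> s \<noteq> b t" if "s \<in> {0..1}" "t \<in> {0..1}" for s t
    using near[OF that] zero_le_dist[of "\<gamma> s" "(a1 +++ a2) s"] by (auto simp del: zero_le_dist)
  have 1: "gauss_integral a1 b - gauss_integral (\<lambda>s. \<gamma> (1/2 * s + 0)) b =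
      gauss_integral (linepath (\<gamma> (1/2)) q) b - gauss_integral (linepath (\<gamma> 0) q) b"
    using gauss_integral_ruled_square[of "\<lambda>s. \<gamma> (1/2 * s + 0)" a1 b] near1 assms
      C1_differentiable_on_affine(1)[OF assms(1), of "1/2" 0] by simp
  have 2: "gauss_integral a2 b - gauss_integral (\<lambda>s. \<gamma> (1/2 * s + 1/2)) b =
      gauss_integral (linepath (\<gamma> 1) q) b - gauss_integral (linepath (\<gamma> (1/2)) q) b"
    using gauss_integral_ruled_square[of "\<lambda>s. \<gamma> (1/2 * s + 1/2)" a2 b] near2 assms
      C1_differentiable_on_affine(1)[OF assms(1), of "1/2" "1/2"] by simp
  show ?thesis
    using 1 2 gauss_integral_halves[OF assms(1,4) ne] assms(5) by simp
qed

section \<open>Linking numbers of loops in the three-sphere\<close>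

lemma vector_3_axis:
  "vector [x, y, z] = x *\<^sub>R axis 1 1 + y *\<^sub>R axis 2 1 + z *\<^sub>R (axis 3 1 :: real^3)"
  by (simp add: vec_eq_iff forall_3 axis_def)

text \<open>Parseval's identity: together with \<open>(z, w)\<close> itself, the three vectors used
  by \<open>stereo\<close> are pairwise orthogonal and of equal norm in a space of real dimension
  four.\<close>

lemma stereo_frame:
  fixes z w :: complex
  shows "((\<i> * z, \<i> * w) \<bullet> x) * ((\<i> * z, \<i> * w) \<bullet> y) + ((- cnj w, cnj z) \<bullet> x) * ((- cnj w, cnj z) \<bullet> y)
    + ((\<i> * cnj w, - \<i> * cnj z) \<bullet> x) * ((\<i> * cnj w, - \<i> * cnj z) \<bullet> y)
    = ((z, w) \<bullet> (z, w)) * (x \<bullet> y) - ((z, w) \<bullet> x) * ((z, w) \<bullet> y)"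
  by (cases x; cases y) (simp add: inner_complex_def algebra_simps)

lemma inner_vector_3: "vector [a, b, c] \<bullet> (vector [x, y, z] :: real^3) = a * x + b * y + c * z"
  by (simp add: inner_vec_def sum_3)

lemma stereo_inner:
  assumes "p \<in> S3"
  shows "stereo p x \<bullet> stereo p y = (x \<bullet> y - (p \<bullet> x) * (p \<bullet> y)) / ((1 - p \<bullet> x) * (1 - p \<bullet> y))"
proof -
  obtain z w where p: "p = (z, w)" by (cases p)
  have "(z, w) \<bullet> (z, w) = 1" using assms p by (simp add: dot_square_norm)
  then show ?thesis
    unfolding p stereo_def using stereo_frame[of z w x y]
    by (simp add: inner_vector_3 del: inner_Pair)
qed

lemma norm_diff_sq_S3:
  assumes "p \<in> S3" "x \<in> S3"
  shows "(dist p x)\<^sup>2 = 2 * (1 - p \<bullet> x)"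
proof -
  have "p \<bullet> p = 1" "x \<bullet> x = 1" using assms by (auto simp: dot_square_norm)
  then show ?thesis
    by (simp add: dist_norm power2_norm_eq_inner inner_diff_left inner_diff_right inner_commute)
qed

text \<open>Expanding the square by \<open>stereo_inner\<close> leaves a rational identity in three
  inner products, since the squared chord between points x and y of the sphere is 2 (1 - x \<bullet>
  y). Injectivity of the projection and Lipschitz bounds in both directions follow from this
  formula.\<close>

lemma dist_stereo:
  assumes "p \<in> S3" "x \<in> S3" "y \<in> S3" "x \<noteq> p" "y \<noteq> p"
  shows "dist (stereo p x) (stereo p y) = 2 * dist x y / (dist p x * dist p y)"
proof -
  define a b X where "a = p \<bullet> x" and "b = p \<bullet> y" and "X = x \<bullet> y"
  have xx: "x \<bullet> x = 1" "y \<bullet> y = 1" using assms by (auto simp: dot_square_norm)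
  have px: "(dist p x)\<^sup>2 = 2 * (1 - a)" and py: "(dist p y)\<^sup>2 = 2 * (1 - b)" and xy: "(dist x y)\<^sup>2 = 2 * (1 - X)"
    using norm_diff_sq_S3 assms by (auto simp: a_def b_def X_def)
  have "dist p x \<noteq> 0" "dist p y \<noteq> 0" using assms by auto
  then have ne: "1 - a \<noteq> 0" "1 - b \<noteq> 0" using px py by force+
  have "(dist (stereo p x) (stereo p y))\<^sup>2 =
      stereo p x \<bullet> stereo p x - 2 * (stereo p x \<bullet> stereo p y) + stereo p y \<bullet> stereo p y"
    unfolding dist_norm power2_norm_eq_inner
    by (simp add: inner_diff_left inner_diff_right inner_commute[of "stereo p y" "stereo p x"])
  also have "\<dots> = (1 - a\<^sup>2) / (1 - a)\<^sup>2 - 2 * ((X - a * b) / ((1 - a) * (1 - b))) + (1 - b\<^sup>2) / (1 - b)\<^sup>2"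
    unfolding stereo_inner[OF assms(1)] xx a_def b_def X_def by (simp add: power2_eq_square)
  also have "\<dots> = 2 * (1 - X) / ((1 - a) * (1 - b))"
  proof -
    have sq: "(1 - c\<^sup>2) / (1 - c)\<^sup>2 = (1 + c) / (1 - c)" if "1 - c \<noteq> 0" for c :: real
      using that by (simp add: power2_eq_square square_diff_one_factored frac_eq_eq) algebra
    define \<alpha> \<beta> where "\<alpha> = 1 - a" and "\<beta> = 1 - b"
    then have ab: "a = 1 - \<alpha>" "b = 1 - \<beta>" "\<alpha> \<noteq> 0" "\<beta> \<noteq> 0" using ne by auto
    show ?thesis
      unfolding sq[OF ne(1)] sq[OF ne(2)] unfolding ab(1,2)
      using ab(3,4) by (simp add: field_simps)
  qed
  also have "\<dots> = (2 * dist x y / (dist p x * dist p y))\<^sup>2"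
  proof -
    have "(2 * dist x y / (dist p x * dist p y))\<^sup>2 = 4 * (2 * (1 - X)) / ((2 * (1 - a)) * (2 * (1 - b)))"
      unfolding power_divide power_mult_distrib px py xy by simp
    also have "\<dots> = 2 * (1 - X) / ((1 - a) * (1 - b))"
      using ne by (simp add: divide_simps) (simp add: algebra_simps)
    finally show ?thesis ..
  qed
  finally show ?thesis
    by (simp add: power2_eq_iff_nonneg)
qed

lemma stereo_eq_iff:
  assumes "p \<in> S3" "x \<in> S3" "y \<in> S3" "x \<noteq> p" "y \<noteq> p"
  shows "stereo p x = stereo p y \<longleftrightarrow> x = y"
  using dist_stereo[OF assms] assms(4,5) by (metis dist_eq_0_iff divide_eq_0_iff mult_eq_0_iff zero_neq_numeral)

lemma inner_S3_eq_1_iff: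
  assumes "p \<in> S3" "x \<in> S3"
  shows "p \<bullet> x = 1 \<longleftrightarrow> p = x"
  using norm_diff_sq_S3[OF assms] by auto

lemma continuous_on_stereo:
  assumes "continuous_on X f" "continuous_on X g" "\<And>x. x \<in> X \<Longrightarrow> f x \<in> S3"
    "\<And>x. x \<in> X \<Longrightarrow> g x \<in> S3" "\<And>x. x \<in> X \<Longrightarrow> f x \<noteq> g x"
  shows "continuous_on X (\<lambda>x. stereo (f x) (g x))"
  unfolding stereo_def vector_3_axis case_prod_beta
  using assms inner_S3_eq_1_iff[of "f _" "g _"]
  by (intro continuous_intros) (auto simp del: inner_Pair)

lemma C1_differentiable_on_bounded_linear:
  assumes "bounded_linear L" "f C1_differentiable_on X"
  shows "(\<lambda>s. L (f s)) C1_differentiable_on X"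
proof -
  obtain D where D: "\<And>s. s \<in> X \<Longrightarrow> (f has_vector_derivative D s) (at s)" "continuous_on X D"
    using assms(2) by (auto simp: C1_differentiable_on_def)
  then show ?thesis
    unfolding C1_differentiable_on_def
    using bounded_linear.has_vector_derivative[OF assms(1)] bounded_linear.continuous_on[OF assms(1)]
    by (intro exI[of _ "\<lambda>s. L (D s)"]) auto
qed

lemma C1_differentiable_on_inverse:
  fixes f :: "real \<Rightarrow> real"
  assumes "f C1_differentiable_on X" "\<And>s. s \<in> X \<Longrightarrow> f s \<noteq> 0"
  shows "(\<lambda>s. inverse (f s)) C1_differentiable_on X"
proof -
  obtain D where D: "\<And>s. s \<in> X \<Longrightarrow> (f has_vector_derivative D s) (at s)" "continuous_on X D"
    using assms(1) by (auto simp: C1_differentiable_on_def)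
  have "continuous_on X f"
    using D(1) unfolding continuous_on_eq_continuous_within
    by (blast intro: has_vector_derivative_continuous has_vector_derivative_at_within)
  with D assms(2) show ?thesis
    unfolding C1_differentiable_on_def has_real_derivative_iff_has_vector_derivative[symmetric]
    by (intro exI[of _ "\<lambda>s. - (inverse (f s) * D s * inverse (f s))"])
      (auto intro!: continuous_intros derivative_eq_intros)
qed

lemma C1_differentiable_on_norm:
  fixes f :: "real \<Rightarrow> 'a::real_inner"
  assumes "f C1_differentiable_on X" "\<And>s. s \<in> X \<Longrightarrow> f s \<noteq> 0"
  shows "(\<lambda>s. norm (f s)) C1_differentiable_on X"
proof -
  obtain D where D: "\<And>s. s \<in> X \<Longrightarrow> (f has_vector_derivative D s) (at s)" "continuous_on X D"
    using assms(1) by (auto simp: C1_differentiable_on_def)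
  have c: "continuous_on X f"
    using D(1) unfolding continuous_on_eq_continuous_within
    by (blast intro: has_vector_derivative_continuous has_vector_derivative_at_within)
  have "((\<lambda>s. norm (f s)) has_vector_derivative sgn (f s) \<bullet> D s) (at s)" if "s \<in> X" for s
    unfolding has_vector_derivative_def
    by (rule has_derivative_eq_rhs, rule has_derivative_compose[OF D(1)[OF that, unfolded has_vector_derivative_def]],
        rule has_derivative_norm) (use assms(2) that in \<open>auto simp: fun_eq_iff inner_commute\<close>)
  moreover have "continuous_on X (\<lambda>s. sgn (f s) \<bullet> D s)"
    using c D assms(2) by (auto intro!: continuous_intros simp: sgn_div_norm)
  ultimately show ?thesis
    unfolding C1_differentiable_on_def by (intro exI[of _ "\<lambda>s. sgn (f s) \<bullet> D s"]) auto
qed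

lemma C1_differentiable_on_stereo:
  assumes "a C1_differentiable_on X" "p \<in> S3" "\<And>s. s \<in> X \<Longrightarrow> a s \<in> S3" "\<And>s. s \<in> X \<Longrightarrow> a s \<noteq> p"
  shows "(\<lambda>s. stereo p (a s)) C1_differentiable_on X"
proof -
  have "1 - p \<bullet> a s \<noteq> 0" if "s \<in> X" for s
    using inner_S3_eq_1_iff[OF assms(2,3)] assms(4) that by (metis diff_eq_diff_eq diff_self)
  then show ?thesis
    unfolding stereo_def vector_3_axis case_prod_beta inverse_eq_divide[symmetric]
    by (intro C1_differentiable_on_scaleR C1_differentiable_on_inverse C1_differentiable_on_add
        C1_differentiable_on_diff C1_differentiable_on_const
        C1_differentiable_on_bounded_linear[OF bounded_linear_inner_right assms(1)]) auto
qed


text \<open>Only the values on the unit interval count, without periodicity, so that the join by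
  \<open>+++\<close> of two loops with a common base point is again a loop.\<close>

definition loop :: "(real \<Rightarrow> complex \<times> complex) \<Rightarrow> bool"
  where "loop a \<longleftrightarrow> continuous_on {0..1} a \<and> (\<forall>s\<in>{0..1}. a s \<in> S3) \<and> a 0 = a 1"

definition C1_loop :: "(real \<Rightarrow> complex \<times> complex) \<Rightarrow> bool"
  where "C1_loop a \<longleftrightarrow> a C1_differentiable_on {0..1} \<and> (\<forall>s\<in>{0..1}. a s \<in> S3) \<and> a 0 = a 1"

definition apart :: "(real \<Rightarrow> 'a) \<Rightarrow> (real \<Rightarrow> 'a) \<Rightarrow> bool"
  where "apart a b \<longleftrightarrow> a ` {0..1} \<inter> b ` {0..1} = {}"

definition near :: "real \<Rightarrow> (real \<Rightarrow> 'a::metric_space) \<Rightarrow> (real \<Rightarrow> 'a) \<Rightarrow> bool"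
  where "near \<delta> a b \<longleftrightarrow> (\<forall>s\<in>{0..1}. dist (a s) (b s) < \<delta>)"

text \<open>The real number that \<open>linking_number\<close> rounds, with images of the unit
  interval in place of ranges; for components of a link these sets coincide, so both choose the same
  centre.\<close>

definition gauss_linking :: "(real \<Rightarrow> complex \<times> complex) \<Rightarrow> (real \<Rightarrow> complex \<times> complex) \<Rightarrow> real"
  where "gauss_linking a b =
    (let p = SOME p. p \<in> S3 - (a ` {0..1} \<union> b ` {0..1})
     in gauss_integral (stereo p \<circ> a) (stereo p \<circ> b))"

section \<open>Independence of the centre of projection\<close>

lemma apartI: "(\<And>s t. s \<in> {0..1} \<Longrightarrow> t \<in> {0..1} \<Longrightarrow> a s \<noteq> b t) \<Longrightarrow> apart a b"
  unfolding apart_def by blast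

lemma C1_loop_stereo:
  assumes "C1_loop f" "p \<in> S3" "\<And>s. s \<in> {0..1} \<Longrightarrow> f s \<noteq> p"
  shows "(stereo p \<circ> f) C1_differentiable_on {0..1}" "(stereo p \<circ> f) 0 = (stereo p \<circ> f) 1"
proof -
  show "(stereo p \<circ> f) C1_differentiable_on {0..1}"
    unfolding o_def using assms by (intro C1_differentiable_on_stereo) (auto simp: C1_loop_def)
  show "(stereo p \<circ> f) 0 = (stereo p \<circ> f) 1" using assms(1) by (simp add: C1_loop_def)
qed

lemma C1_loop_imp_loop: "C1_loop a \<Longrightarrow> loop a"
  by (auto simp: C1_loop_def loop_def intro: C1_differentiable_on_vector_derivative(4))

lemma loop_compact: "loop a \<Longrightarrow> compact (a ` {0..1})"
  by (auto simp: loop_def intro: compact_continuous_image)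

text \<open>The sphere is connected, hence not the union of two disjoint nonempty closed sets. This
  covers continuous loops, whose images need not be small.\<close>

lemma exists_off:
  assumes "compact A" "compact B" "A \<subseteq> S3" "B \<subseteq> S3" "A \<inter> B = {}" "A \<noteq> {}" "B \<noteq> {}"
  obtains p where "p \<in> S3 - (A \<union> B)"
proof -
  have "connected S3"
    by (rule connected_sphere) simp
  then have "\<not> S3 \<subseteq> A \<union> B"
    using connected_closedD[of S3 A B] compact_imp_closed[OF assms(1)] compact_imp_closed[OF assms(2)] assms(3-7)
    by blast
  then show thesis using that by blast
qed

lemma loops_exists_off:
  assumes "loop a" "loop b" "apart a b"
  obtains p where "p \<in> S3 - (a ` {0..1} \<union> b ` {0..1})"
proof (rule exists_off[OF loop_compact[OF assms(1)] loop_compact[OF assms(2)]])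
  show "a ` {0..1} \<subseteq> S3" "b ` {0..1} \<subseteq> S3" using assms by (auto simp: loop_def)
qed (use assms that in \<open>auto simp: apart_def\<close>)

text \<open>Three parameters are mapped differentiably into a space of real dimension four. The set
  collects the planes spanned by x and the points of the curve.\<close>

lemma negligible_cone:
  fixes c :: "real \<Rightarrow> complex \<times> complex"
  assumes "c C1_differentiable_on {0..1}"
  shows "negligible {u *\<^sub>R c s + v *\<^sub>R x |u v s. s \<in> {0..1}}"
proof -
  have "negligible ((\<lambda>z::real \<times> real \<times> real. fst z *\<^sub>R c (snd (snd z)) + fst (snd z) *\<^sub>R x) `
      (UNIV \<times> UNIV \<times> {0..1}))"
  proof (rule negligible_differentiable_image_lowdim)
    have "(\<lambda>z::real \<times> real \<times> real. c (snd (snd z))) differentiable at z within S"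
      if "z \<in> UNIV \<times> UNIV \<times> {0..1}" for z S
    proof -
      have "c differentiable at (snd (snd z))"
        using assms that by (auto simp: C1_differentiable_on_eq)
      moreover have "(\<lambda>z::real \<times> real \<times> real. snd (snd z)) differentiable at z within S"
        by (intro bounded_linear_imp_differentiable bounded_linear_compose[OF bounded_linear_snd bounded_linear_snd])
      ultimately show ?thesis
        using differentiable_chain_within[of "\<lambda>z. snd (snd z)" z S c]
        by (auto simp: o_def intro: differentiable_at_withinI)
    qed
    moreover have "(\<lambda>z::real \<times> real \<times> real. fst z) differentiable at z within S"
      "(\<lambda>z::real \<times> real \<times> real. fst (snd z)) differentiable at z within S" for z S
      by (intro bounded_linear_imp_differentiable bounded_linear_fst
          bounded_linear_compose[OF bounded_linear_fst bounded_linear_snd])+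
    ultimately show "(\<lambda>z::real \<times> real \<times> real. fst z *\<^sub>R c (snd (snd z)) + fst (snd z) *\<^sub>R x)
        differentiable_on (UNIV \<times> UNIV \<times> {0..1})"
      unfolding differentiable_on_def by (auto intro!: derivative_intros)
  qed simp
  moreover have "u *\<^sub>R c s + v *\<^sub>R x \<in> (\<lambda>z::real \<times> real \<times> real. fst z *\<^sub>R c (snd (snd z)) + fst (snd z) *\<^sub>R x) `
      (UNIV \<times> UNIV \<times> {0..1})" if "s \<in> {0..1}" for u v s
    using that by (intro image_eqI[of _ _ "(u, v, s)"]) auto
  ultimately show ?thesis
    by (elim negligible_subset) blast
qed

text \<open>The segment from x to m, pushed back to the sphere, can run into a curve only if m lies
  in one of the planes spanned by x and a point of the curve. A point m outside four such negligible
  sets can be reached from x and from y alike.\<close>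

lemma connected_off_C1_loops:
  assumes a: "C1_loop a" and b: "C1_loop b"
    and x: "x \<in> S3 - (a ` {0..1} \<union> b ` {0..1})" and y: "y \<in> S3 - (a ` {0..1} \<union> b ` {0..1})"
  shows "path_component (S3 - (a ` {0..1} \<union> b ` {0..1})) x y"
proof -
  define N where "N = (\<lambda>c x. {u *\<^sub>R c s + v *\<^sub>R (x::complex\<times>complex) |u v s. s \<in> {0..1::real}})"
  have "negligible (N a x \<union> N a y \<union> N b x \<union> N b y)"
    using negligible_cone a b by (auto simp: N_def C1_loop_def)
  then obtain m where m: "m \<notin> N a x \<union> N a y \<union> N b x \<union> N b y"
    using non_negligible_UNIV by (metis UNIV_eq_I)
  have *: "path_component (S3 - (a ` {0..1} \<union> b ` {0..1})) x (sgn m)"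
    if x: "x \<in> S3 - (a ` {0..1} \<union> b ` {0..1})" and m: "m \<notin> N a x" "m \<notin> N b x" for x
  proof -
    define l where "l = (\<lambda>r. (1 - r) *\<^sub>R x + r *\<^sub>R m)"
    \<comment> \<open>The equation is solved for m. The case u = 0 also shows that the segment
      avoids the origin.\<close>
    have off: "l r \<noteq> u *\<^sub>R c s" if "r \<in> {0..1}" "m \<notin> N c x" "s \<in> {0..1}" "r \<noteq> 0" for r u c s
    proof
      assume "l r = u *\<^sub>R c s"
      then have "r *\<^sub>R m = u *\<^sub>R c s - (1 - r) *\<^sub>R x"
        by (simp add: l_def algebra_simps)
      then have "(1 / r) *\<^sub>R r *\<^sub>R m = (1 / r) *\<^sub>R (u *\<^sub>R c s - (1 - r) *\<^sub>R x)"
        by simp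
      then have "m = (u / r) *\<^sub>R c s + (- ((1 - r) / r)) *\<^sub>R x"
        using that by (simp add: scaleR_diff_right)
      then have "m \<in> N c x"
        unfolding N_def using that(3) by blast
      then show False using that(2) by blast
    qed
    have l0: "l r \<noteq> 0" if "r \<in> {0..1}" for r
      using off[OF that m(1), of 0 0] x by (cases "r = 0") (auto simp: l_def)
    have "path (\<lambda>r. sgn (l r))"
      unfolding path_def sgn_div_norm using l0
      by (auto simp: l_def intro!: continuous_intros)
    moreover have "sgn (l r) \<in> S3 - (a ` {0..1} \<union> b ` {0..1})" if r: "r \<in> {0..1}" for r
    proof (cases "r = 0")
      case True
      then show ?thesis using x by (auto simp: l_def sgn_div_norm)
    next
      case False
      have "sgn (l r) \<noteq> c s" if "m \<notin> N c x" "s \<in> {0..1}" for c s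
      proof
        assume "sgn (l r) = c s"
        then have "norm (l r) *\<^sub>R c s = norm (l r) *\<^sub>R (l r /\<^sub>R norm (l r))" by (simp add: sgn_div_norm)
        also have "\<dots> = l r" using l0[OF r] by simp
        finally have "l r = norm (l r) *\<^sub>R c s" ..
        then show False using off[OF r that False] by blast
      qed
      with m have "sgn (l r) \<notin> a ` {0..1} \<union> b ` {0..1}" by force
      then show ?thesis using l0[OF r] by (auto simp: norm_sgn)
    qed
    moreover have "sgn (l 0) = x" "l 1 = m" using x by (auto simp: l_def sgn_div_norm)
    ultimately show ?thesis
      unfolding path_component_def path_image_def pathstart_def pathfinish_def
      by (intro exI[of _ "\<lambda>r. sgn (l r)"] conjI image_subsetI) simp_all
  qed
  show ?thesis
    using *[OF x] *[OF y] m path_component_sym path_component_trans by blast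
qed

lemma constant_on_unit_interval:
  fixes f :: "real \<Rightarrow> 'b"
  assumes "\<And>x. x \<in> {0..1} \<Longrightarrow> \<exists>d>0. \<forall>y\<in>{0..1}. dist y x < d \<longrightarrow> f y = f x"
  shows "f 0 = f 1"
proof (rule connected_local_const[of "{0..1}"])
  show "\<forall>a\<in>{0..1}. eventually (\<lambda>b. f a = f b) (at a within {0..1})"
    unfolding eventually_at using assms by metis
qed auto

lemma near_slices:
  fixes \<Phi> :: "real \<Rightarrow> real \<Rightarrow> 'a::metric_space"
  assumes "continuous_on ({0..1} \<times> {0..1}) (\<lambda>(x, s). \<Phi> x s)" "0 < e"
  obtains d where "d > 0" "\<And>x y. x \<in> {0..1} \<Longrightarrow> y \<in> {0..1} \<Longrightarrow> dist y x < d \<Longrightarrow> near e (\<Phi> x) (\<Phi> y)"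
proof -
  have "uniformly_continuous_on ({0..1} \<times> {0..1}) (\<lambda>(x, s). \<Phi> x s)"
    by (rule compact_uniformly_continuous[OF assms(1)]) (auto intro: compact_Times)
  from uniformly_continuous_onE[OF this assms(2)] obtain d where d: "d > 0"
    "\<And>z z'. z \<in> {0..1} \<times> {0..1} \<Longrightarrow> z' \<in> {0..1} \<times> {0..1} \<Longrightarrow> dist z' z < d \<Longrightarrow>
      dist (case z' of (x, s) \<Rightarrow> \<Phi> x s) (case z of (x, s) \<Rightarrow> \<Phi> x s) < e"
    by metis
  have "near e (\<Phi> x) (\<Phi> y)" if "x \<in> {0..1}" "y \<in> {0..1}" "dist y x < d" for x y
    using d(2)[of "(x, _)" "(y, _)"] that by (auto simp: near_def dist_Pair_Pair dist_commute)
  with d(1) show thesis using that by blast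
qed

lemma continuous_on_slice:
  assumes "continuous_on (X \<times> Y) (\<lambda>(x, s). \<Phi> x s)" "x \<in> X"
  shows "continuous_on Y (\<Phi> x)"
proof -
  have "continuous_on Y (\<lambda>s. (x, s))" by (intro continuous_intros)
  from continuous_on_compose2[OF assms(1) this] assms(2) show ?thesis by auto
qed

lemma apart_dist:
  fixes a b :: "real \<Rightarrow> 'a::heine_borel"
  assumes "continuous_on {0..1} a" "continuous_on {0..1} b" "apart a b"
  obtains \<mu> :: real where "\<mu> > 0" "\<And>s t. s \<in> {0..1} \<Longrightarrow> t \<in> {0..1} \<Longrightarrow> \<mu> \<le> dist (a s) (b t)"
proof -
  have "compact (a ` {0..1})" "closed (b ` {0..1})"
    using assms by (auto intro!: compact_continuous_image compact_imp_closed)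
  from separate_compact_closed[OF this] assms(3) obtain \<mu> :: real where
    "\<mu> > 0" "\<forall>x\<in>a ` {0..1}. \<forall>y\<in>b ` {0..1}. \<mu> \<le> dist x y"
    unfolding apart_def by blast
  then show thesis using that by blast
qed

text \<open>The centre moves from p to q along a path off both curves. The projected curves move
  continuously and stay disjoint, so the integral is locally constant by
  \<open>gauss_integral_near\<close>.\<close>

lemma gauss_integral_stereo_indep:
  assumes a: "C1_loop a" and b: "C1_loop b" and "apart a b"
    and p: "p \<in> S3 - (a ` {0..1} \<union> b ` {0..1})" and q: "q \<in> S3 - (a ` {0..1} \<union> b ` {0..1})"
  shows "gauss_integral (stereo p \<circ> a) (stereo p \<circ> b) = gauss_integral (stereo q \<circ> a) (stereo q \<circ> b)"
proof -
  obtain g where g: "path g" "path_image g \<subseteq> S3 - (a ` {0..1} \<union> b ` {0..1})" "g 0 = p" "g 1 = q"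
    using connected_off_C1_loops[OF a b p q]
    by (auto simp: path_component_def pathstart_def pathfinish_def)
  have gin: "g x \<in> S3 - (a ` {0..1} \<union> b ` {0..1})" if "x \<in> {0..1}" for x
    using g(2) that unfolding path_image_def by blast
  have cont: "continuous_on ({0..1} \<times> {0..1}) (\<lambda>(x, s). stereo (g x) (c s))"
    if "C1_loop c" "c ` {0..1} \<subseteq> a ` {0..1} \<union> b ` {0..1}" for c
  proof -
    have "continuous_on {0..1} c" using C1_loop_imp_loop[OF that(1)] by (simp add: loop_def)
    note c = continuous_on_compose_intro[OF this]
    note g' = continuous_on_compose_intro[OF g(1)[unfolded path_def]]
    show ?thesis
      unfolding case_prod_beta
    proof (rule continuous_on_stereo)
      fix z :: "real \<times> real" assume "z \<in> {0..1} \<times> {0..1}"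
      then have z: "fst z \<in> {0..1}" "snd z \<in> {0..1}" by (auto simp: mem_Times_iff)
      show "g (fst z) \<in> S3" using gin[OF z(1)] by blast
      show "c (snd z) \<in> S3" using that(1) z(2) unfolding C1_loop_def by blast
      have "c (snd z) \<in> a ` {0..1} \<union> b ` {0..1}" using that(2) z(2) by blast
      moreover have "g (fst z) \<notin> a ` {0..1} \<union> b ` {0..1}" using gin[OF z(1)] by blast
      ultimately show "g (fst z) \<noteq> c (snd z)" by metis
    next
      show "continuous_on ({0..1} \<times> {0..1}) (\<lambda>z::real \<times> real. g (fst z))"
        by (rule g') (auto intro: continuous_intros)
      show "continuous_on ({0..1} \<times> {0..1}) (\<lambda>z::real \<times> real. c (snd z))"
        by (rule c) (auto intro: continuous_intros)
    qed
  qed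
  have C1: "(stereo (g x) \<circ> c) C1_differentiable_on {0..1}"
    if "C1_loop c" "c ` {0..1} \<subseteq> a ` {0..1} \<union> b ` {0..1}" "x \<in> {0..1}" for c x
  proof (rule C1_loop_stereo(1)[OF that(1)])
    show "c s \<noteq> g x" if s: "s \<in> {0..1}" for s
    proof -
      have "c s \<in> a ` {0..1} \<union> b ` {0..1}" using \<open>c ` {0..1} \<subseteq> _\<close> s by blast
      moreover have "g x \<notin> a ` {0..1} \<union> b ` {0..1}" using gin[OF \<open>x \<in> {0..1}\<close>] by blast
      ultimately show ?thesis by metis
    qed
    show "g x \<in> S3" using gin[OF \<open>x \<in> {0..1}\<close>] by blast
  qed
  define G where "G = (\<lambda>x. gauss_integral (stereo (g x) \<circ> a) (stereo (g x) \<circ> b))"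
  have "G 0 = G 1"
  proof (rule constant_on_unit_interval)
    fix x :: real assume x: "x \<in> {0..1}"
    have "apart (stereo (g x) \<circ> a) (stereo (g x) \<circ> b)"
    proof -
      have "stereo (g x) (a s) \<noteq> stereo (g x) (b t)" if st: "s \<in> {0..1}" "t \<in> {0..1}" for s t
      proof -
        have "a s \<noteq> b t" using assms(3) st unfolding apart_def by blast
        moreover have "a s \<noteq> g x" "b t \<noteq> g x" using gin[OF x] st by (metis DiffD2 UnCI imageI)+
        ultimately show ?thesis
          using stereo_eq_iff[of "g x" "a s" "b t"] gin[OF x] a b st by (simp add: C1_loop_def)
      qed
      then show ?thesis unfolding apart_def by fastforce
    qed
    with continuous_on_slice[OF cont[OF a] x] continuous_on_slice[OF cont[OF b] x]
    obtain \<mu> where \<mu>: "\<mu> > 0" "\<And>s t. s \<in> {0..1} \<Longrightarrow> t \<in> {0..1} \<Longrightarrow> \<mu> \<le> dist (stereo (g x) (a s)) (stereo (g x) (b t))"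
      by (auto elim: apart_dist simp: o_def)
    obtain d1 where d1: "d1 > 0" "\<And>x y. x \<in> {0..1} \<Longrightarrow> y \<in> {0..1} \<Longrightarrow> dist y x < d1 \<Longrightarrow>
        near (\<mu> / 2) (\<lambda>s. stereo (g x) (a s)) (\<lambda>s. stereo (g y) (a s))"
      using near_slices[OF cont[OF a], of "\<mu> / 2"] \<mu>(1) by auto
    obtain d2 where d2: "d2 > 0" "\<And>x y. x \<in> {0..1} \<Longrightarrow> y \<in> {0..1} \<Longrightarrow> dist y x < d2 \<Longrightarrow>
        near (\<mu> / 2) (\<lambda>s. stereo (g x) (b s)) (\<lambda>s. stereo (g y) (b s))"
      using near_slices[OF cont[OF b], of "\<mu> / 2"] \<mu>(1) by auto
    have "G y = G x" if y: "y \<in> {0..1}" "dist y x < min d1 d2" for y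
      unfolding G_def
    proof (rule gauss_integral_near[symmetric])
      fix s t :: real assume st: "s \<in> {0..1}" "t \<in> {0..1}"
      have "dist (stereo (g x) (a s)) (stereo (g y) (a s)) < \<mu> / 2"
        "dist (stereo (g x) (b t)) (stereo (g y) (b t)) < \<mu> / 2"
        using d1(2)[OF x y(1)] d2(2)[OF x y(1)] y(2) st by (auto simp: near_def)
      with \<mu>(2)[OF st]
      show "dist ((stereo (g x) \<circ> a) s) ((stereo (g y) \<circ> a) s) + dist ((stereo (g x) \<circ> b) t) ((stereo (g y) \<circ> b) t)
          < dist ((stereo (g x) \<circ> a) s) ((stereo (g x) \<circ> b) t)"
        by simp
    qed (use C1[OF a _ x] C1[OF b _ x] C1[OF a _ y(1)] C1[OF b _ y(1)] a b in \<open>simp_all add: C1_loop_def\<close>)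
    then show "\<exists>d>0. \<forall>y\<in>{0..1}. dist y x < d \<longrightarrow> G y = G x"
      using d1(1) d2(1) by (intro exI[of _ "min d1 d2"]) auto
  qed
  then show ?thesis by (simp add: G_def g)
qed

lemma gauss_linking_stereo:
  assumes "C1_loop a" "C1_loop b" "apart a b" "p \<in> S3 - (a ` {0..1} \<union> b ` {0..1})"
  shows "gauss_linking a b = gauss_integral (stereo p \<circ> a) (stereo p \<circ> b)"
proof -
  have "(SOME p. p \<in> S3 - (a ` {0..1} \<union> b ` {0..1})) \<in> S3 - (a ` {0..1} \<union> b ` {0..1})"
    using assms(4) by (rule someI)
  from gauss_integral_stereo_indep[OF assms(1-3) this assms(4)] show ?thesis
    by (simp add: gauss_linking_def)
qed


section \<open>Extension of the Gauss integral to continuous loops\<close>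

lemma dist_stereo_le:
  assumes "p \<in> S3" "x \<in> S3" "y \<in> S3" "0 < e" "e \<le> dist p x" "e \<le> dist p y"
  shows "dist (stereo p x) (stereo p y) \<le> 2 * dist x y / e\<^sup>2"
proof -
  have "dist (stereo p x) (stereo p y) = 2 * dist x y / (dist p x * dist p y)"
    using assms by (intro dist_stereo) auto
  also have "\<dots> \<le> 2 * dist x y / (e * e)"
    using assms by (intro divide_left_mono mult_mono mult_pos_pos) auto
  finally show ?thesis by (simp add: power2_eq_square)
qed

lemma dist_stereo_ge:
  assumes "p \<in> S3" "x \<in> S3" "y \<in> S3" "x \<noteq> p" "y \<noteq> p"
  shows "dist x y / 2 \<le> dist (stereo p x) (stereo p y)"
proof -
  have "dist p z \<le> 2" if "z \<in> S3" for z
    using dist_triangle[of p z 0] assms(1) that by simp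
  then have "dist p x * dist p y \<le> 2 * 2"
    using assms by (intro mult_mono) auto
  then have "2 * dist x y / 4 \<le> 2 * dist x y / (dist p x * dist p y)"
    using assms by (intro divide_left_mono mult_pos_pos) auto
  then show ?thesis using assms by (simp add: dist_stereo)
qed

text \<open>A polynomial approximation is projected radially to the sphere. The base point is kept,
  so that approximations of two loops can be joined again in \<open>lk_join\<close>.\<close>

lemma C1_loop_approx:
  assumes "loop a" "0 < \<delta>"
  obtains a' where "C1_loop a'" "a' 0 = a 0" "near \<delta> a a'"
proof -
  \<comment> \<open>One e pays for the polynomial, the other for the radial projection, which moves
    \<open>h t\<close> by \<open>\<bar>1 - norm (h t)\<bar>\<close>. The bound 1/2 keeps h away from
    the origin.\<close>
  define e where "e = min (\<delta> / 2) (1 / 2)"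
  have e: "0 < e" "2 * e \<le> \<delta>" "e \<le> 1/2" using assms(2) by (auto simp: e_def)
  obtain h where h: "polynomial_function h" "h 0 = a 0" "h 1 = a 1" "\<And>t. t \<in> {0..1} \<Longrightarrow> norm (h t - a t) < e"
    using path_approx_polynomial_function[of a e] assms(1) e(1)
    by (auto simp: loop_def path_def pathstart_def pathfinish_def)
  have na: "norm (a t) = 1" if "t \<in> {0..1}" for t using assms(1) that by (auto simp: loop_def)
  have nh: "\<bar>norm (h t) - 1\<bar> < e" if "t \<in> {0..1}" for t
    using norm_triangle_ineq3[of "h t" "a t"] h(4)[OF that] na[OF that] by linarith
  have h0: "h t \<noteq> 0" if "t \<in> {0..1}" for t
    using nh[OF that] e(3) by auto
  obtain h' where "polynomial_function h'" "\<And>x. (h has_vector_derivative h' x) (at x)"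
    using has_vector_derivative_polynomial_function[OF h(1)] by blast
  then have C1: "h C1_differentiable_on {0..1}"
    unfolding C1_differentiable_on_def by (metis continuous_on_polymonial_function)
  show thesis
  proof
    show "C1_loop (\<lambda>s. inverse (norm (h s)) *\<^sub>R h s)"
      unfolding C1_loop_def
      using h0 h(2,3) assms(1)
      by (auto intro!: C1_differentiable_on_scaleR C1_differentiable_on_inverse C1_differentiable_on_norm C1
          simp: loop_def)
    show "inverse (norm (h 0)) *\<^sub>R h 0 = a 0"
      using h(2) na[of 0] by simp
    have "dist (a t) (inverse (norm (h t)) *\<^sub>R h t) < \<delta>" if t: "t \<in> {0..1}" for t
    proof -
      have "inverse (norm (h t)) *\<^sub>R h t - h t = (inverse (norm (h t)) - 1) *\<^sub>R h t"
        by (simp add: scaleR_diff_left)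
      then have "norm (inverse (norm (h t)) *\<^sub>R h t - h t) = \<bar>(inverse (norm (h t)) - 1) * norm (h t)\<bar>"
        by (simp add: abs_mult)
      also have "\<dots> = \<bar>1 - norm (h t)\<bar>"
        using h0[OF t] by (simp add: left_diff_distrib)
      finally have "dist (inverse (norm (h t)) *\<^sub>R h t) (h t) < e"
        using nh[OF t] by (simp add: dist_norm)
      moreover have "dist (h t) (a t) < e" using h(4)[OF t] by (simp add: dist_norm)
      ultimately show ?thesis
        using dist_triangle[of "inverse (norm (h t)) *\<^sub>R h t" "a t" "h t"] e(2) by (simp add: dist_commute)
    qed
    then show "near \<delta> a (\<lambda>s. inverse (norm (h s)) *\<^sub>R h s)" by (simp add: near_def)
  qed
qed

lemma loop_infdist:
  assumes "loop a" "p \<notin> a ` {0..1}"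
  obtains \<eta> where "\<eta> > 0" "\<And>s. s \<in> {0..1} \<Longrightarrow> \<eta> \<le> dist p (a s)"
  using separate_compact_closed[of "{p}" "a ` {0..1}"] assms compact_imp_closed[OF loop_compact[OF assms(1)]]
  by auto

text \<open>One \<delta> serves all approximations: passing from x, y to x', y' moves the
  projections by less than their distance, as \<open>gauss_integral_near\<close> demands.\<close>

lemma stereo_near:
  assumes a: "loop a" and b: "loop b" and ab: "apart a b" and p: "p \<in> S3 - (a ` {0..1} \<union> b ` {0..1})"
  obtains \<delta> where "\<delta> > 0"
    "\<And>s t x x' y y'. s \<in> {0..1} \<Longrightarrow> t \<in> {0..1} \<Longrightarrow> x \<in> S3 \<Longrightarrow> x' \<in> S3 \<Longrightarrow> y \<in> S3 \<Longrightarrow> y' \<in> S3 \<Longrightarrow>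
      dist (a s) x < \<delta> \<Longrightarrow> dist (a s) x' < \<delta> \<Longrightarrow> dist (b t) y < \<delta> \<Longrightarrow> dist (b t) y' < \<delta> \<Longrightarrow>
      x \<noteq> p \<and> y \<noteq> p \<and> x \<noteq> y \<and>
      dist (stereo p x) (stereo p x') + dist (stereo p y) (stereo p y') < dist (stereo p x) (stereo p y)"
proof -
  have pn: "p \<notin> a ` {0..1}" "p \<notin> b ` {0..1}" using p by blast+
  obtain \<mu> where \<mu>: "\<mu> > 0" "\<And>s t. s \<in> {0..1} \<Longrightarrow> t \<in> {0..1} \<Longrightarrow> \<mu> \<le> dist (a s) (b t)"
    by (rule apart_dist[OF _ _ ab]) (use a b that in \<open>auto simp: loop_def\<close>)
  obtain \<eta>1 where \<eta>1: "\<eta>1 > 0" "\<And>s. s \<in> {0..1} \<Longrightarrow> \<eta>1 \<le> dist p (a s)"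
    by (rule loop_infdist[OF a pn(1)]) (rule that)
  obtain \<eta>2 where \<eta>2: "\<eta>2 > 0" "\<And>s. s \<in> {0..1} \<Longrightarrow> \<eta>2 \<le> dist p (b s)"
    by (rule loop_infdist[OF b pn(2)]) (rule that)
  define e where "e = min \<eta>1 \<eta>2 / 2"
  have e: "e > 0" "2 * e \<le> \<eta>1" "2 * e \<le> \<eta>2" using \<eta>1(1) \<eta>2(1) by (auto simp: e_def)
  \<comment> \<open>The bound e keeps the approximating points at distance e from p. The bound
    \<mu>/4 keeps x and y at distance \<mu>/2 and their projections at distance \<mu>/4. The last
    bound lets each projection move by at most \<mu>/16.\<close>
  define \<delta> where "\<delta> = min e (min (\<mu> / 4) (\<mu> * e\<^sup>2 / 64))"
  have \<delta>: "\<delta> > 0" "\<delta> \<le> e" "\<delta> \<le> \<mu> / 4" "4 * \<delta> / e\<^sup>2 \<le> \<mu> / 16"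
  proof -
    have "\<delta> \<le> \<mu> * e\<^sup>2 / 64" by (simp add: \<delta>_def)
    then show "4 * \<delta> / e\<^sup>2 \<le> \<mu> / 16" using e(1) by (simp add: divide_simps)
  qed (use e(1) \<mu>(1) in \<open>auto simp: \<delta>_def\<close>)
  have close: "e \<le> dist p x \<and> dist (stereo p x) (stereo p x') \<le> \<mu> / 16"
    if "x \<in> S3" "x' \<in> S3" "dist z x < \<delta>" "dist z x' < \<delta>" "2 * e \<le> dist p z" for x x' z
  proof -
    have far: "e \<le> dist p x" "e \<le> dist p x'"
      using that \<delta>(2) dist_triangle[of p z x] dist_triangle[of p z x'] by (simp_all add: dist_commute)
    have "dist x x' \<le> 2 * \<delta>" using that dist_triangle[of x x' z] by (simp add: dist_commute)
    then have "2 * dist x x' / e\<^sup>2 \<le> 4 * \<delta> / e\<^sup>2" by (intro divide_right_mono) auto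
    moreover have "dist (stereo p x) (stereo p x') \<le> 2 * dist x x' / e\<^sup>2"
      by (rule dist_stereo_le[OF _ that(1,2) e(1) far]) (use p in blast)
    ultimately show ?thesis using far \<delta>(4) by linarith
  qed
  show thesis
  proof (rule that[OF \<delta>(1)])
    fix s t x x' y y'
    assume st: "s \<in> {0..1}" "t \<in> {0..1}" and S3: "x \<in> S3" "x' \<in> S3" "y \<in> S3" "y' \<in> S3"
      and d: "dist (a s) x < \<delta>" "dist (a s) x' < \<delta>" "dist (b t) y < \<delta>" "dist (b t) y' < \<delta>"
    have x: "e \<le> dist p x \<and> dist (stereo p x) (stereo p x') \<le> \<mu> / 16"
      by (rule close[OF S3(1,2) d(1,2)]) (use \<eta>1(2)[OF st(1)] e in linarith)
    have y: "e \<le> dist p y \<and> dist (stereo p y) (stereo p y') \<le> \<mu> / 16"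
      by (rule close[OF S3(3,4) d(3,4)]) (use \<eta>2(2)[OF st(2)] e in linarith)
    have ne: "x \<noteq> p" "y \<noteq> p" using x y e(1) by auto
    have sep: "\<mu> / 2 \<le> dist x y"
      using d \<delta>(3) \<mu>(2)[OF st] dist_triangle[of "a s" "b t" x] dist_triangle[of x "b t" y]
      by (simp add: dist_commute)
    moreover have "dist x y / 2 \<le> dist (stereo p x) (stereo p y)"
      by (rule dist_stereo_ge[OF _ S3(1,3) ne]) (use p in blast)
    ultimately show "x \<noteq> p \<and> y \<noteq> p \<and> x \<noteq> y \<and>
        dist (stereo p x) (stereo p x') + dist (stereo p y) (stereo p y') < dist (stereo p x) (stereo p y)"
      using ne x y \<mu>(1) by auto
  qed
qed

text \<open>For disjoint loops such a number exists by \<open>lk_near\<close>; it is unique because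
  C1 approximations exist within every \<delta>.\<close>

definition lk :: "(real \<Rightarrow> complex \<times> complex) \<Rightarrow> (real \<Rightarrow> complex \<times> complex) \<Rightarrow> real"
  where "lk a b = (SOME g. \<exists>\<delta>>0. \<forall>a' b'. C1_loop a' \<and> C1_loop b' \<and> near \<delta> a a' \<and> near \<delta> b b' \<longrightarrow>
    gauss_linking a' b' = g)"

text \<open>Any two pairs of C1 approximations within the \<delta> of \<open>stereo_near\<close> can
  be projected from the same centre p and are then joined by straight motions that keep the curves
  disjoint.\<close>

lemma lk_near:
  assumes a: "loop a" and b: "loop b" and ab: "apart a b"
  obtains \<delta> where "\<delta> > 0"
    "\<And>a' b'. C1_loop a' \<Longrightarrow> C1_loop b' \<Longrightarrow> near \<delta> a a' \<Longrightarrow> near \<delta> b b' \<Longrightarrow> apart a' b' \<and> gauss_linking a' b' = lk a b"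
proof -
  obtain p where p: "p \<in> S3 - (a ` {0..1} \<union> b ` {0..1})"
    by (rule loops_exists_off[OF a b ab])
  then have p': "p \<in> S3" by blast
  obtain \<delta> where "\<delta> > 0" and \<delta>: "\<And>s t x x' y y'. s \<in> {0..1} \<Longrightarrow> t \<in> {0..1} \<Longrightarrow> x \<in> S3 \<Longrightarrow> x' \<in> S3 \<Longrightarrow> y \<in> S3 \<Longrightarrow> y' \<in> S3 \<Longrightarrow>
      dist (a s) x < \<delta> \<Longrightarrow> dist (a s) x' < \<delta> \<Longrightarrow> dist (b t) y < \<delta> \<Longrightarrow> dist (b t) y' < \<delta> \<Longrightarrow>
      x \<noteq> p \<and> y \<noteq> p \<and> x \<noteq> y \<and>
      dist (stereo p x) (stereo p x') + dist (stereo p y) (stereo p y') < dist (stereo p x) (stereo p y)"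
    by (rule stereo_near[OF a b ab p]) (rule that)
  have S3: "c s \<in> S3" if "C1_loop c" "s \<in> {0..1}" for c s using that by (simp add: C1_loop_def)
  have near: "dist (c s) (c' s) < \<delta>" if "near \<delta> c c'" "s \<in> {0..1}" for c c' :: "real \<Rightarrow> complex \<times> complex" and s
    using that by (simp add: near_def)
  have sep: "a' s \<noteq> p \<and> b' t \<noteq> p \<and> a' s \<noteq> b' t \<and>
      dist (stereo p (a' s)) (stereo p (a'' s)) + dist (stereo p (b' t)) (stereo p (b'' t)) < dist (stereo p (a' s)) (stereo p (b' t))"
    if "s \<in> {0..1}" "t \<in> {0..1}" "C1_loop a'" "C1_loop a''" "C1_loop b'" "C1_loop b''"
      "near \<delta> a a'" "near \<delta> a a''" "near \<delta> b b'" "near \<delta> b b''" for a' a'' b' b'' s t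
    using that by (intro \<delta>[of s t] S3 near)
  have apart: "apart a' b'" and off: "p \<in> S3 - (a' ` {0..1} \<union> b' ` {0..1})"
    if "C1_loop a'" "C1_loop b'" "near \<delta> a a'" "near \<delta> b b'" for a' b'
  proof -
    have *: "a' s \<noteq> p \<and> b' t \<noteq> p \<and> a' s \<noteq> b' t" if "s \<in> {0..1}" "t \<in> {0..1}" for s t
      using sep[OF that \<open>C1_loop a'\<close> \<open>C1_loop a'\<close> \<open>C1_loop b'\<close> \<open>C1_loop b'\<close>] \<open>near \<delta> a a'\<close> \<open>near \<delta> b b'\<close> by blast
    then show "apart a' b'" by (intro apartI) blast
    have "a' s \<noteq> p" "b' s \<noteq> p" if "s \<in> {0..1}" for s using *[OF that that] by blast+
    then show "p \<in> S3 - (a' ` {0..1} \<union> b' ` {0..1})" using p' by blast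
  qed
  have eq: "gauss_linking a' b' = gauss_linking a'' b''"
    if C1: "C1_loop a'" "C1_loop b'" "C1_loop a''" "C1_loop b''"
      and n: "near \<delta> a a'" "near \<delta> b b'" "near \<delta> a a''" "near \<delta> b b''" for a' b' a'' b''
  proof -
    have ne: "a' s \<noteq> p" "b' s \<noteq> p" "a'' s \<noteq> p" "b'' s \<noteq> p" if "s \<in> {0..1}" for s
      using off[OF C1(1,2) n(1,2)] off[OF C1(3,4) n(3,4)] that by blast+
    note st = C1_loop_stereo[OF C1(1) p' ne(1)] C1_loop_stereo[OF C1(2) p' ne(2)]
      C1_loop_stereo[OF C1(3) p' ne(3)] C1_loop_stereo[OF C1(4) p' ne(4)]
    have "gauss_integral (stereo p \<circ> a') (stereo p \<circ> b') = gauss_integral (stereo p \<circ> a'') (stereo p \<circ> b'')"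
    proof (rule gauss_integral_near[OF st(1,5,3,7) st(2,6,4,8)])
      show "dist ((stereo p \<circ> a') s) ((stereo p \<circ> a'') s) + dist ((stereo p \<circ> b') t) ((stereo p \<circ> b'') t)
          < dist ((stereo p \<circ> a') s) ((stereo p \<circ> b') t)" if "s \<in> {0..1}" "t \<in> {0..1}" for s t
        using sep[OF that C1(1,3,2,4) n(1,3,2,4)] by simp
    qed
    then show ?thesis
      using gauss_linking_stereo[OF C1(1,2) apart[OF C1(1,2) n(1,2)] off[OF C1(1,2) n(1,2)]]
        gauss_linking_stereo[OF C1(3,4) apart[OF C1(3,4) n(3,4)] off[OF C1(3,4) n(3,4)]] by simp
  qed
  obtain a1 where a1: "C1_loop a1" "near \<delta> a a1" using C1_loop_approx[OF a \<open>\<delta> > 0\<close>] by blast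
  obtain b1 where b1: "C1_loop b1" "near \<delta> b b1" using C1_loop_approx[OF b \<open>\<delta> > 0\<close>] by blast
  have "\<exists>g. \<exists>\<delta>>0. \<forall>a' b'. C1_loop a' \<and> C1_loop b' \<and> near \<delta> a a' \<and> near \<delta> b b' \<longrightarrow> gauss_linking a' b' = g"
    using \<open>\<delta> > 0\<close> eq[OF a1(1) b1(1) _ _ a1(2) b1(2)] by metis
  then have "\<exists>\<delta>>0. \<forall>a' b'. C1_loop a' \<and> C1_loop b' \<and> near \<delta> a a' \<and> near \<delta> b b' \<longrightarrow> gauss_linking a' b' = lk a b"
    unfolding lk_def by (rule someI_ex)
  then obtain \<epsilon> where \<epsilon>: "\<epsilon> > 0"
    "\<And>a' b'. C1_loop a' \<Longrightarrow> C1_loop b' \<Longrightarrow> near \<epsilon> a a' \<Longrightarrow> near \<epsilon> b b' \<Longrightarrow> gauss_linking a' b' = lk a b"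
    by blast
  show thesis
  proof
    \<comment> \<open>Here \<delta> secures disjointness, while \<epsilon> comes from the choice in
      \<open>lk_def\<close> and secures the value.\<close>
    show "min \<delta> \<epsilon> > 0" using \<open>\<delta> > 0\<close> \<epsilon>(1) by simp
    fix a' b' assume C1: "C1_loop a'" "C1_loop b'" and "near (min \<delta> \<epsilon>) a a'" "near (min \<delta> \<epsilon>) b b'"
    then have n: "near \<delta> a a'" "near \<delta> b b'" "near \<epsilon> a a'" "near \<epsilon> b b'" by (auto simp: near_def)
    show "apart a' b' \<and> gauss_linking a' b' = lk a b"
      using apart[OF C1 n(1,2)] \<epsilon>(2)[OF C1 n(3,4)] ..
  qed
qed

section \<open>Homotopy invariance, symmetry and additivity\<close>

lemma near_refl: "\<delta> > 0 \<Longrightarrow> near \<delta> a a"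
  by (simp add: near_def)

lemma near_trans:
  assumes "near \<delta> a b" "near \<epsilon> b c"
  shows "near (\<delta> + \<epsilon>) a c"
  unfolding near_def
proof
  fix s :: real assume "s \<in> {0..1}"
  then have "dist (a s) (b s) < \<delta>" "dist (b s) (c s) < \<epsilon>" using assms by (auto simp: near_def)
  then show "dist (a s) (c s) < \<delta> + \<epsilon>" using dist_triangle[of "a s" "c s" "b s"] by linarith
qed

lemma near_mono: "near \<delta> a b \<Longrightarrow> \<delta> \<le> \<epsilon> \<Longrightarrow> near \<epsilon> a b"
  by (force simp: near_def)

lemma lk_C1_loop:
  assumes "C1_loop a" "C1_loop b" "apart a b"
  shows "lk a b = gauss_linking a b"
proof (rule lk_near[OF C1_loop_imp_loop[OF assms(1)] C1_loop_imp_loop[OF assms(2)] assms(3)])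
  fix \<delta> :: real
  assume "\<delta> > 0" and *: "\<And>a' b'. C1_loop a' \<Longrightarrow> C1_loop b' \<Longrightarrow> near \<delta> a a' \<Longrightarrow> near \<delta> b b' \<Longrightarrow>
    apart a' b' \<and> gauss_linking a' b' = lk a b"
  show ?thesis using *[OF assms(1,2) near_refl[OF \<open>\<delta> > 0\<close>] near_refl[OF \<open>\<delta> > 0\<close>]] by simp
qed

lemma lk_cong:
  assumes "\<And>s. s \<in> {0..1} \<Longrightarrow> a s = a' s" "\<And>s. s \<in> {0..1} \<Longrightarrow> b s = b' s"
  shows "lk a b = lk a' b'"
proof -
  have "near \<delta> a c \<longleftrightarrow> near \<delta> a' c" "near \<delta> b c \<longleftrightarrow> near \<delta> b' c" for \<delta> c
    using assms by (auto simp: near_def)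
  then show ?thesis by (simp add: lk_def)
qed

text \<open>The value is locally constant in x because neighbouring slices have C1 approximations in
  common.\<close>

lemma lk_homotopic:
  fixes A B :: "real \<Rightarrow> real \<Rightarrow> complex \<times> complex"
  assumes A: "continuous_on ({0..1} \<times> {0..1}) (\<lambda>(x, s). A x s)"
    and B: "continuous_on ({0..1} \<times> {0..1}) (\<lambda>(x, s). B x s)"
    and S3: "\<And>x s. x \<in> {0..1} \<Longrightarrow> s \<in> {0..1} \<Longrightarrow> A x s \<in> S3" "\<And>x s. x \<in> {0..1} \<Longrightarrow> s \<in> {0..1} \<Longrightarrow> B x s \<in> S3"
    and closed: "\<And>x. x \<in> {0..1} \<Longrightarrow> A x 0 = A x 1" "\<And>x. x \<in> {0..1} \<Longrightarrow> B x 0 = B x 1"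
    and ne: "\<And>x s t. x \<in> {0..1} \<Longrightarrow> s \<in> {0..1} \<Longrightarrow> t \<in> {0..1} \<Longrightarrow> A x s \<noteq> B x t"
  shows "lk (A 0) (B 0) = lk (A 1) (B 1)"
proof -
  have loops: "loop (A x)" "loop (B x)" "apart (A x) (B x)" if "x \<in> {0..1}" for x
  proof -
    show "loop (A x)" "loop (B x)"
      using continuous_on_slice[OF A that] continuous_on_slice[OF B that] S3[OF that] closed[OF that]
      unfolding loop_def by simp_all
    show "apart (A x) (B x)" by (rule apartI) (rule ne[OF that])
  qed
  show ?thesis
  proof (rule constant_on_unit_interval[where f = "\<lambda>x. lk (A x) (B x)"])
    fix x :: real assume x: "x \<in> {0..1}"
    obtain \<delta> where \<delta>: "\<delta> > 0"
      "\<And>a' b'. C1_loop a' \<Longrightarrow> C1_loop b' \<Longrightarrow> near \<delta> (A x) a' \<Longrightarrow> near \<delta> (B x) b' \<Longrightarrow> apart a' b' \<and> gauss_linking a' b' = lk (A x) (B x)"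
      by (rule lk_near[OF loops[OF x]]) (rule that)
    obtain d1 where d1: "d1 > 0" "\<And>x y. x \<in> {0..1} \<Longrightarrow> y \<in> {0..1} \<Longrightarrow> dist y x < d1 \<Longrightarrow> near (\<delta> / 2) (A x) (A y)"
      by (rule near_slices[OF A half_gt_zero[OF \<delta>(1)]]) (rule that)
    obtain d2 where d2: "d2 > 0" "\<And>x y. x \<in> {0..1} \<Longrightarrow> y \<in> {0..1} \<Longrightarrow> dist y x < d2 \<Longrightarrow> near (\<delta> / 2) (B x) (B y)"
      by (rule near_slices[OF B half_gt_zero[OF \<delta>(1)]]) (rule that)
    have "lk (A y) (B y) = lk (A x) (B x)" if y: "y \<in> {0..1}" "dist y x < min d1 d2" for y
    proof -
      obtain \<epsilon> where \<epsilon>: "\<epsilon> > 0"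
        "\<And>a' b'. C1_loop a' \<Longrightarrow> C1_loop b' \<Longrightarrow> near \<epsilon> (A y) a' \<Longrightarrow> near \<epsilon> (B y) b' \<Longrightarrow> apart a' b' \<and> gauss_linking a' b' = lk (A y) (B y)"
        by (rule lk_near[OF loops[OF y(1)]]) (rule that)
      \<comment> \<open>Approximations within \<epsilon> of the slice y compute its value. Being
        within \<delta>/2 of it, and the two slices being \<delta>/2-close, they also compute the
        value of the slice x.\<close>
      have m: "min \<epsilon> (\<delta> / 2) > 0" using \<epsilon>(1) \<delta>(1) by simp
      obtain a1 where a1: "C1_loop a1" "near (min \<epsilon> (\<delta> / 2)) (A y) a1" using C1_loop_approx[OF loops(1)[OF y(1)] m] by blast
      obtain b1 where b1: "C1_loop b1" "near (min \<epsilon> (\<delta> / 2)) (B y) b1" using C1_loop_approx[OF loops(2)[OF y(1)] m] by blast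
      have "near \<delta> (A x) a1"
        using near_trans[OF d1(2)[OF x y(1)] a1(2)] y(2) by (auto elim!: near_mono)
      moreover have "near \<delta> (B x) b1"
        using near_trans[OF d2(2)[OF x y(1)] b1(2)] y(2) by (auto elim!: near_mono)
      moreover have "near \<epsilon> (A y) a1" "near \<epsilon> (B y) b1"
        using a1 b1 by (auto elim!: near_mono)
      ultimately show ?thesis
        using \<delta>(2)[OF a1(1) b1(1)] \<epsilon>(2)[OF a1(1) b1(1)] by simp
    qed
    then show "\<exists>d>0. \<forall>y\<in>{0..1}. dist y x < d \<longrightarrow> lk (A y) (B y) = lk (A x) (B x)"
      using d1(1) d2(1) by (intro exI[of _ "min d1 d2"]) auto
  qed
qed

lemma apart_sym: "apart a b \<Longrightarrow> apart b a"
  unfolding apart_def by blast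

lemma gauss_linking_commute:
  assumes "C1_loop a" "C1_loop b" "apart a b"
  shows "gauss_linking a b = gauss_linking b a"
proof -
  obtain p where p: "p \<in> S3 - (a ` {0..1} \<union> b ` {0..1})"
    using loops_exists_off[OF C1_loop_imp_loop C1_loop_imp_loop] assms by blast
  have off: "a s \<noteq> p" "b s \<noteq> p" if "s \<in> {0..1}" for s using p that by auto
  have "gauss_integral (stereo p \<circ> a) (stereo p \<circ> b) = gauss_integral (stereo p \<circ> b) (stereo p \<circ> a)"
  proof (rule gauss_integral_commute)
    show "(stereo p \<circ> a) s \<noteq> (stereo p \<circ> b) t" if "s \<in> {0..1}" "t \<in> {0..1}" for s t
    proof -
      have "a s \<noteq> b t" using assms(3) that unfolding apart_def by blast
      then show ?thesis
        using stereo_eq_iff[of p "a s" "b t"] p off assms that by (simp add: C1_loop_def)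
    qed
  qed (use C1_loop_stereo[OF assms(1) _ off(1)] C1_loop_stereo[OF assms(2) _ off(2)] p in auto)
  moreover have "p \<in> S3 - (b ` {0..1} \<union> a ` {0..1})" using p by blast
  ultimately show ?thesis
    using gauss_linking_stereo[OF assms p] gauss_linking_stereo[OF assms(2,1) apart_sym[OF assms(3)]] by simp
qed

lemma lk_commute:
  assumes "loop a" "loop b" "apart a b"
  shows "lk a b = lk b a"
proof -
  have ba: "apart b a" using assms(3) by (rule apart_sym)
  obtain \<delta> where \<delta>: "\<delta> > 0"
    "\<And>a' b'. C1_loop a' \<Longrightarrow> C1_loop b' \<Longrightarrow> near \<delta> a a' \<Longrightarrow> near \<delta> b b' \<Longrightarrow> apart a' b' \<and> gauss_linking a' b' = lk a b"
    by (rule lk_near[OF assms]) (rule that)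
  obtain \<epsilon> where \<epsilon>: "\<epsilon> > 0"
    "\<And>a' b'. C1_loop a' \<Longrightarrow> C1_loop b' \<Longrightarrow> near \<epsilon> b a' \<Longrightarrow> near \<epsilon> a b' \<Longrightarrow> apart a' b' \<and> gauss_linking a' b' = lk b a"
    by (rule lk_near[OF assms(2,1) ba]) (rule that)
  have m: "min \<delta> \<epsilon> > 0" using \<delta>(1) \<epsilon>(1) by simp
  obtain a1 where a1: "C1_loop a1" "near (min \<delta> \<epsilon>) a a1" using C1_loop_approx[OF assms(1) m] by blast
  obtain b1 where b1: "C1_loop b1" "near (min \<delta> \<epsilon>) b b1" using C1_loop_approx[OF assms(2) m] by blast
  have n: "near \<delta> a a1" "near \<delta> b b1" "near \<epsilon> a a1" "near \<epsilon> b b1"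
    using a1 b1 by (auto elim!: near_mono)
  show ?thesis
    using \<delta>(2)[OF a1(1) b1(1) n(1,2)] \<epsilon>(2)[OF b1(1) a1(1) n(4,3)] gauss_linking_commute[OF a1(1) b1(1)]
    by simp
qed

lemma loop_join:
  assumes "loop a1" "loop a2" "a1 0 = a2 0"
  shows "loop (a1 +++ a2)"
proof -
  have "path a1" "path a2" "pathfinish a1 = pathstart a2"
    using assms by (auto simp: loop_def path_def pathfinish_def pathstart_def)
  then have "path (a1 +++ a2)" by simp
  with assms show ?thesis
    by (auto simp: loop_def path_def joinpaths_def)
qed

lemma near_join:
  assumes "near \<delta> a1 b1" "near \<delta> a2 b2"
  shows "near \<delta> (a1 +++ a2) (b1 +++ b2)"
  using assms by (auto simp: near_def joinpaths_def)

lemma joinpaths_in: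
  "s \<in> {0..1} \<Longrightarrow> (a1 +++ a2) s \<in> a1 ` {0..1} \<union> a2 ` {0..1}"
  by (auto simp: joinpaths_def)

text \<open>The join is approximated twice: by the join of a1' and a2', which closes up because base
  points are kept, and by a C1 loop c'. Both are close enough to be compared by
  \<open>gauss_integral_join\<close> after projection from one centre.\<close>

lemma lk_join:
  assumes a1: "loop a1" and a2: "loop a2" and b: "loop b" and base: "a1 0 = a2 0"
    and ab1: "apart a1 b" and ab2: "apart a2 b"
  shows "lk (a1 +++ a2) b = lk a1 b + lk a2 b"
proof -
  define c where "c = a1 +++ a2"
  have c: "loop c" unfolding c_def by (rule loop_join) fact+
  have cim: "c ` {0..1} \<subseteq> a1 ` {0..1} \<union> a2 ` {0..1}"
    unfolding c_def by (intro image_subsetI joinpaths_in)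
  with ab1 ab2 have cb: "apart c b" unfolding apart_def by blast
  obtain p where p: "p \<in> S3 - (c ` {0..1} \<union> b ` {0..1})" by (rule loops_exists_off[OF c b cb])
  then have p': "p \<in> S3" by blast
  obtain \<delta>3 where \<delta>3: "\<delta>3 > 0" "\<And>s t x x' y y'. s \<in> {0..1} \<Longrightarrow> t \<in> {0..1} \<Longrightarrow> x \<in> S3 \<Longrightarrow> x' \<in> S3 \<Longrightarrow> y \<in> S3 \<Longrightarrow> y' \<in> S3 \<Longrightarrow>
      dist (c s) x < \<delta>3 \<Longrightarrow> dist (c s) x' < \<delta>3 \<Longrightarrow> dist (b t) y < \<delta>3 \<Longrightarrow> dist (b t) y' < \<delta>3 \<Longrightarrow>
      x \<noteq> p \<and> y \<noteq> p \<and> x \<noteq> y \<and>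
      dist (stereo p x) (stereo p x') + dist (stereo p y) (stereo p y') < dist (stereo p x) (stereo p y)"
    by (rule stereo_near[OF c b cb p]) (rule that)
  obtain \<delta>0 where \<delta>0: "\<delta>0 > 0"
    "\<And>a' b'. C1_loop a' \<Longrightarrow> C1_loop b' \<Longrightarrow> near \<delta>0 c a' \<Longrightarrow> near \<delta>0 b b' \<Longrightarrow> apart a' b' \<and> gauss_linking a' b' = lk c b"
    by (rule lk_near[OF c b cb]) (rule that)
  obtain \<delta>1 where \<delta>1: "\<delta>1 > 0"
    "\<And>a' b'. C1_loop a' \<Longrightarrow> C1_loop b' \<Longrightarrow> near \<delta>1 a1 a' \<Longrightarrow> near \<delta>1 b b' \<Longrightarrow> apart a' b' \<and> gauss_linking a' b' = lk a1 b"
    by (rule lk_near[OF a1 b ab1]) (rule that)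
  obtain \<delta>2 where \<delta>2: "\<delta>2 > 0"
    "\<And>a' b'. C1_loop a' \<Longrightarrow> C1_loop b' \<Longrightarrow> near \<delta>2 a2 a' \<Longrightarrow> near \<delta>2 b b' \<Longrightarrow> apart a' b' \<and> gauss_linking a' b' = lk a2 b"
    by (rule lk_near[OF a2 b ab2]) (rule that)
  define \<delta> where "\<delta> = min (min \<delta>0 \<delta>1) (min \<delta>2 \<delta>3)"
  have \<delta>: "\<delta> > 0" "\<delta> \<le> \<delta>0" "\<delta> \<le> \<delta>1" "\<delta> \<le> \<delta>2" "\<delta> \<le> \<delta>3"
    using \<delta>0(1) \<delta>1(1) \<delta>2(1) \<delta>3(1) by (simp_all add: \<delta>_def)
  obtain a1' where a1': "C1_loop a1'" "a1' 0 = a1 0" "near \<delta> a1 a1'" using C1_loop_approx[OF a1 \<delta>(1)] by blast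
  obtain a2' where a2': "C1_loop a2'" "a2' 0 = a2 0" "near \<delta> a2 a2'" using C1_loop_approx[OF a2 \<delta>(1)] by blast
  obtain b' where b': "C1_loop b'" "near \<delta> b b'" using C1_loop_approx[OF b \<delta>(1)] by blast
  obtain c' where c': "C1_loop c'" "near \<delta> c c'" using C1_loop_approx[OF c \<delta>(1)] by blast
  have S3: "a1' s \<in> S3" "a2' s \<in> S3" "b' s \<in> S3" "c' s \<in> S3" if "s \<in> {0..1}" for s
    using a1'(1) a2'(1) b'(1) c'(1) that by (auto simp: C1_loop_def)
  have joined: "near \<delta> c (a1' +++ a2')" unfolding c_def by (rule near_join[OF a1'(3) a2'(3)])
  have join_in: "(a1' +++ a2') s \<in> S3" if "s \<in> {0..1}" for s
    using joinpaths_in[OF that, of a1' a2'] S3 by auto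
  have sep: "c' s \<noteq> p \<and> b' t \<noteq> p \<and> c' s \<noteq> b' t \<and>
      dist (stereo p (c' s)) (stereo p ((a1' +++ a2') s)) + dist (stereo p (b' t)) (stereo p (b' t)) < dist (stereo p (c' s)) (stereo p (b' t))"
    "(a1' +++ a2') s \<noteq> p" if s: "s \<in> {0..1}" and t: "t \<in> {0..1}" for s t
  proof -
    have d: "dist (c s) (c' s) < \<delta>3" "dist (c s) ((a1' +++ a2') s) < \<delta>3" "dist (b t) (b' t) < \<delta>3"
      using near_mono[OF c'(2) \<delta>(5)] near_mono[OF joined \<delta>(5)] near_mono[OF b'(2) \<delta>(5)] s t
      unfolding near_def by blast+
    show "c' s \<noteq> p \<and> b' t \<noteq> p \<and> c' s \<noteq> b' t \<and>
      dist (stereo p (c' s)) (stereo p ((a1' +++ a2') s)) + dist (stereo p (b' t)) (stereo p (b' t)) < dist (stereo p (c' s)) (stereo p (b' t))"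
      by (rule \<delta>3(2)[OF s t S3(4)[OF s] join_in[OF s] S3(3)[OF t] S3(3)[OF t] d(1,2) d(3) d(3)])
    show "(a1' +++ a2') s \<noteq> p"
      using \<delta>3(2)[OF s t join_in[OF s] join_in[OF s] S3(3)[OF t] S3(3)[OF t] d(2,2) d(3) d(3)] by blast
  qed
  have off: "a1' s \<noteq> p" "a2' s \<noteq> p" "b' s \<noteq> p" "c' s \<noteq> p" if s: "s \<in> {0..1}" for s
  proof -
    have "(a1' +++ a2') (s / 2) = a1' s" using s by (simp add: joinpaths_def)
    then show "a1' s \<noteq> p" using sep(2)[of "s / 2" 0] s by simp
    have "a1' 1 = a2' 0" using a1'(1,2) a2'(2) base by (simp add: C1_loop_def)
    then have "(a1' +++ a2') (s / 2 + 1 / 2) = a2' s" using s by (cases "s = 0") (auto simp: joinpaths_def)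
    then show "a2' s \<noteq> p" using sep(2)[of "s / 2 + 1 / 2" 0] s by simp
    show "b' s \<noteq> p" "c' s \<noteq> p" using sep(1)[OF s s] by blast+
  qed
  note st = C1_loop_stereo[OF c'(1) p' off(4)] C1_loop_stereo[OF a1'(1) p' off(1)]
    C1_loop_stereo[OF a2'(1) p' off(2)] C1_loop_stereo[OF b'(1) p' off(3)]
  have "gauss_integral (stereo p \<circ> c') (stereo p \<circ> b') =
      gauss_integral (stereo p \<circ> a1') (stereo p \<circ> b') + gauss_integral (stereo p \<circ> a2') (stereo p \<circ> b')"
  proof (rule gauss_integral_join[OF st(1,3,5,7) st(2) refl])
    show "(stereo p \<circ> a1') 1 = (stereo p \<circ> a1') 0" using st(4) by simp
    show "(stereo p \<circ> a2') 0 = (stereo p \<circ> a1') 0" using a1' a2' base by simp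
    then show "(stereo p \<circ> a2') 1 = (stereo p \<circ> a1') 0" using st(6) by simp
    show "(stereo p \<circ> b') 0 = (stereo p \<circ> b') 1" by (rule st(8))
    fix s t :: real assume "s \<in> {0..1}" "t \<in> {0..1}"
    moreover have "((stereo p \<circ> a1') +++ (stereo p \<circ> a2')) s = stereo p ((a1' +++ a2') s)"
      by (simp add: joinpaths_def)
    ultimately show "dist ((stereo p \<circ> c') s) (((stereo p \<circ> a1') +++ (stereo p \<circ> a2')) s)
        < dist ((stereo p \<circ> c') s) ((stereo p \<circ> b') t)" using sep(1) by simp
  qed
  moreover have "apart c' b' \<and> gauss_linking c' b' = lk c b"
    by (rule \<delta>0(2)[OF c'(1) b'(1) near_mono[OF c'(2) \<delta>(2)] near_mono[OF b'(2) \<delta>(2)]])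
  moreover have "apart a1' b' \<and> gauss_linking a1' b' = lk a1 b"
    by (rule \<delta>1(2)[OF a1'(1) b'(1) near_mono[OF a1'(3) \<delta>(3)] near_mono[OF b'(2) \<delta>(3)]])
  moreover have "apart a2' b' \<and> gauss_linking a2' b' = lk a2 b"
    by (rule \<delta>2(2)[OF a2'(1) b'(1) near_mono[OF a2'(3) \<delta>(4)] near_mono[OF b'(2) \<delta>(4)]])
  moreover have "p \<in> S3 - (c' ` {0..1} \<union> b' ` {0..1})" "p \<in> S3 - (a1' ` {0..1} \<union> b' ` {0..1})"
      "p \<in> S3 - (a2' ` {0..1} \<union> b' ` {0..1})"
    using off p' by blast+
  ultimately show ?thesis
    unfolding c_def[symmetric]
    using gauss_linking_stereo[OF c'(1) b'(1)] gauss_linking_stereo[OF a1'(1) b'(1)]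
      gauss_linking_stereo[OF a2'(1) b'(1)] by metis
qed

lemma lk_const:
  assumes "x \<in> S3" "y \<in> S3" "x \<noteq> y"
  shows "lk (\<lambda>_. x) (\<lambda>_. y) = 0"
proof -
  have "C1_loop (\<lambda>_. x)" "C1_loop (\<lambda>_. y)" "apart (\<lambda>_. x) (\<lambda>_. y)"
    using assms by (auto simp: C1_loop_def apart_def)
  then show ?thesis
    by (simp add: lk_C1_loop gauss_linking_def gauss_integral_def o_def Let_def cross_zero_left)
qed

section \<open>The linking number of two Hopf fibres\<close>

text \<open>The Hopf fibre over the centre of the disc. Its partner \<open>ring 0\<close> is the
  fibre w = 0, the core of the complementary solid torus.\<close>

definition core :: "real \<Rightarrow> complex \<times> complex"
  where "core s = (0, cis (2 * pi * s))"

text \<open>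
  The fibre \<open>ring 0\<close> passes through the point \<open>(1, 0)\<close>, from which the two curves are projected;
  for \<open>S > 0\<close> it is pushed off this point.
\<close>

definition ring :: "real \<Rightarrow> real \<Rightarrow> complex \<times> complex"
  where "ring S t = (complex_of_real (sqrt (1 - S\<^sup>2)) * cis (2 * pi * t), complex_of_real S)"

lemma has_vector_derivative_cis:
  "((\<lambda>s. cis (c * s)) has_vector_derivative of_real c * \<i> * cis (c * s)) (at s within X)"
proof -
  have "((\<lambda>z. exp (\<i> * (of_real c * z))) has_field_derivative of_real c * \<i> * cis (c * s)) (at (of_real s))"
    by (auto intro!: derivative_eq_intros simp: cis_conv_exp)
  from has_vector_derivative_real_field[OF this] show ?thesis
    by (simp add: cis_conv_exp)
qed

lemma stereo_at_1:
  "stereo (1, 0) (z, w) = (1 / (1 - Re z)) *\<^sub>R vector [Im z, Re w, - Im w]"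
  by (simp add: stereo_def inner_complex_def)

lemma has_vector_derivative_vector_3:
  assumes "(f has_real_derivative f') (at x)" "(g has_real_derivative g') (at x)" "(h has_real_derivative h') (at x)"
  shows "((\<lambda>x. vector [f x, g x, h x] :: real^3) has_vector_derivative vector [f', g', h']) (at x)"
  unfolding vector_3_axis
  using assms by (auto intro!: derivative_eq_intros)

lemma C1_loop_core: "C1_loop core"
proof -
  have "(core has_vector_derivative (0, of_real (2 * pi) * \<i> * cis (2 * pi * s))) (at s)" for s
    unfolding core_def
    by (rule has_vector_derivative_Pair[OF has_vector_derivative_const has_vector_derivative_cis])
  moreover have "continuous_on {0..1} (\<lambda>s. (0::complex, of_real (2 * pi) * \<i> * cis (2 * pi * s)))"
    by (intro continuous_intros)
  ultimately have "core C1_differentiable_on {0..1}"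
    unfolding C1_differentiable_on_def by (intro exI conjI ballI)
  then show ?thesis
    by (simp add: C1_loop_def core_def norm_Pair)
qed

lemma C1_loop_ring:
  assumes "0 \<le> S" "S < 1"
  shows "C1_loop (ring S)"
proof -
  have "(ring S has_vector_derivative (of_real (sqrt (1 - S\<^sup>2)) * (of_real (2 * pi) * \<i> * cis (2 * pi * s)), 0)) (at s)" for s
    unfolding ring_def
    by (intro has_vector_derivative_Pair has_vector_derivative_const has_vector_derivative_mult_right has_vector_derivative_cis)
  moreover have "continuous_on {0..1} (\<lambda>s. (of_real (sqrt (1 - S\<^sup>2)) * (of_real (2 * pi) * \<i> * cis (2 * pi * s)), 0::complex))"
    by (intro continuous_intros)
  ultimately have "ring S C1_differentiable_on {0..1}"
    unfolding C1_differentiable_on_def by (intro exI conjI ballI)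
  moreover have "S\<^sup>2 \<le> 1" using assms by (simp add: power_le_one)
  ultimately show ?thesis
    by (simp add: C1_loop_def ring_def norm_Pair norm_mult)
qed

text \<open>
  The squared distance of the projected points is \<open>2 * E / D\<close>, hence Gauss's integrand is a sum of
  two products of functions of a single parameter.
\<close>

lemma gauss_kernel_hopf:
  fixes C S ct st cs ss :: real
  assumes CS: "C\<^sup>2 + S\<^sup>2 = 1" and t: "ct\<^sup>2 + st\<^sup>2 = 1" and s: "cs\<^sup>2 + ss\<^sup>2 = 1"
  defines "D \<equiv> 1 - C * ct" and "E \<equiv> 1 - S * cs"
  assumes D: "D > 0" and E: "E > 0"
  shows "gauss_kernel (vector [0, cs, - ss] - vector [C * st / D, S / D, 0])
      (vector [0, - ss, - cs]) (vector [(C * ct - C\<^sup>2) / D\<^sup>2, - (S * C * st) / D\<^sup>2, 0])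
    = 1 / (2 * sqrt 2) * (C\<^sup>2 / (E * sqrt E) * (1 / sqrt D) - C / sqrt E * (ct / sqrt D))"
proof -
  define d :: "real^3" where "d = vector [0, cs, - ss] - vector [C * st / D, S / D, 0]"
  have "d \<bullet> d = (C * st / D)\<^sup>2 + (cs - S / D)\<^sup>2 + ss\<^sup>2"
    by (simp add: d_def inner_vec_def sum_3 power2_eq_square)
  also have "\<dots> = ((C * st)\<^sup>2 + S\<^sup>2 - 2 * cs * S * D + D\<^sup>2) / D\<^sup>2"
  proof -
    have "(C * st / D)\<^sup>2 + (cs - S / D)\<^sup>2 + ss\<^sup>2 = ((C * st)\<^sup>2 + S\<^sup>2 - 2 * cs * S * D + (cs\<^sup>2 + ss\<^sup>2) * D\<^sup>2) / D\<^sup>2"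
      using D by (simp add: field_simps power2_eq_square)
    then show ?thesis using s by simp
  qed
  also have "(C * st)\<^sup>2 + S\<^sup>2 - 2 * cs * S * D + D\<^sup>2 = 2 * E * D"
  proof -
    have "S\<^sup>2 = 1 - C\<^sup>2" "st\<^sup>2 = 1 - ct\<^sup>2" using CS t by auto
    then show ?thesis by (simp add: D_def E_def power2_eq_square algebra_simps) algebra
  qed
  also have "2 * E * D / D\<^sup>2 = 2 * E / D" using D by (simp add: power2_eq_square)
  finally have "norm d = sqrt (2 * E / D)" by (simp add: norm_eq_sqrt_inner)
  then have "norm d ^ 3 = 2 * E / D * sqrt (2 * E / D)"
    using D E by (simp add: power3_eq_cube)
  also have "\<dots> = 2 * sqrt 2 * (E * sqrt E) / (D * sqrt D)"
    by (simp add: real_sqrt_divide real_sqrt_mult)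
  finally have n: "norm d ^ 3 = 2 * sqrt 2 * (E * sqrt E) / (D * sqrt D)" .
  have "d \<bullet> cross3 (vector [0, - ss, - cs]) (vector [(C * ct - C\<^sup>2) / D\<^sup>2, - (S * C * st) / D\<^sup>2, 0]) =
     ((C * st / D) * (S * C * st) * cs - (cs - S / D) * (C * ct - C\<^sup>2) * cs - (C * ct - C\<^sup>2) * ss\<^sup>2) / D\<^sup>2"
    using D by (simp add: d_def cross3_def inner_vec_def sum_3 field_simps power2_eq_square)
  also have "\<dots> = (C\<^sup>2 - C * ct * E) / D\<^sup>2"
  proof -
    have "(C * st / D) * (S * C * st) * cs - (cs - S / D) * (C * ct - C\<^sup>2) * cs - (C * ct - C\<^sup>2) * ss\<^sup>2
      = ((C * st) * (S * C * st) * cs + S * (C * ct - C\<^sup>2) * cs) / D - (C * ct - C\<^sup>2) * (cs\<^sup>2 + ss\<^sup>2)"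
      using D by (simp add: field_simps power2_eq_square)
    also have "(C * st) * (S * C * st) * cs + S * (C * ct - C\<^sup>2) * cs = S * C * ct * cs * D"
    proof -
      have "st\<^sup>2 = 1 - ct\<^sup>2" using t by auto
      then show ?thesis by (simp add: D_def power2_eq_square algebra_simps) algebra
    qed
    finally show ?thesis using D s by (simp add: E_def algebra_simps)
  qed
  finally have k: "d \<bullet> cross3 (vector [0, - ss, - cs]) (vector [(C * ct - C\<^sup>2) / D\<^sup>2, - (S * C * st) / D\<^sup>2, 0])
    = (C\<^sup>2 - C * ct * E) / D\<^sup>2" .
  define x y where "x = sqrt D" and "y = sqrt E"
  have xy: "D = x\<^sup>2" "E = y\<^sup>2" "x > 0" "y > 0" using D E by (simp_all add: x_def y_def)
  show ?thesis
    unfolding gauss_kernel_def d_def[symmetric] k n x_def[symmetric] y_def[symmetric]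
    unfolding xy(1,2) using xy(3,4) by (simp add: field_simps power2_eq_square)
qed

text \<open>With y = sqrt (1 - x) both remainders are \<open>(1 - y)\<^sup>2\<close> times a
  rational function of y, while \<open>x\<^sup>2 = (1 - y)\<^sup>2 * (1 + y)\<^sup>2\<close>. The
  linear term is split off because for x proportional to a cosine it integrates to 0 over a
  period.\<close>

lemma inverse_sqrt_expansion:
  fixes x :: real
  assumes "\<bar>x\<bar> \<le> 1/2"
  shows "\<bar>1 / sqrt (1 - x) - 1 - x / 2\<bar> \<le> 26 * x\<^sup>2"
    and "\<bar>1 / ((1 - x) * sqrt (1 - x)) - 1 - 3 * x / 2\<bar> \<le> 26 * x\<^sup>2"
proof -
  define y where "y = sqrt (1 - x)"
  have y2: "y\<^sup>2 = 1 - x" "y \<ge> 0" using assms by (auto simp: y_def)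
  have y: "1/2 \<le> y" "y \<le> 3/2"
  proof -
    have "(1/2)\<^sup>2 \<le> y\<^sup>2" "y\<^sup>2 \<le> (3/2)\<^sup>2"
      unfolding y2 using assms by (simp_all add: power2_eq_square abs_le_iff)
    then show "1/2 \<le> y" "y \<le> 3/2" using y2(2) by (auto elim: power2_le_imp_le)
  qed
  have x: "x = 1 - y\<^sup>2" using y2 by simp
  have bound: "\<bar>A\<bar> \<le> B * r" if "A = B * q" "0 \<le> B" "0 \<le> q" "q \<le> r" for A B q r :: real
    using that mult_left_mono[of q r B] by simp
  have x2: "x\<^sup>2 = (1 - y)\<^sup>2 * (1 + y)\<^sup>2" unfolding x by (simp add: power2_eq_square algebra_simps)
  have "1 / y - 1 - x / 2 = (1 - y)\<^sup>2 * ((y + 2) / (2 * y))"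
    using y unfolding x by (simp add: field_simps power2_eq_square)
  moreover have "(y + 2) / (2 * y) \<le> 26 * (1 + y)\<^sup>2"
  proof -
    have "(y + 2) / (2 * y) \<le> (y + 2) / 1" using y by (intro divide_left_mono) auto
    also have "\<dots> \<le> 26 * (1 + y)\<^sup>2" using y by (simp add: power2_eq_square algebra_simps)
    finally show ?thesis .
  qed
  ultimately have "\<bar>1 / y - 1 - x / 2\<bar> \<le> (1 - y)\<^sup>2 * (26 * (1 + y)\<^sup>2)"
    using y by (intro bound) simp_all
  then show "\<bar>1 / sqrt (1 - x) - 1 - x / 2\<bar> \<le> 26 * x\<^sup>2"
    unfolding x2 y_def[symmetric] by (simp add: mult_ac)
  have "1 / (y\<^sup>2 * y) - 1 - 3 * x / 2 = (1 - y)\<^sup>2 * ((3 * y ^ 3 + 6 * y\<^sup>2 + 4 * y + 2) / (2 * y ^ 3))"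
    using y unfolding x by (simp add: field_simps power2_eq_square power3_eq_cube)
  moreover have "(3 * y ^ 3 + 6 * y\<^sup>2 + 4 * y + 2) / (2 * y ^ 3) \<le> 26 * (1 + y)\<^sup>2"
  proof -
    \<comment> \<open>For y between 1/2 and 3/2 the denominator is at least 1/4 and
      \<open>3 * y + 2\<close> is at most 13/2; the constant is 26 = 4 * 13/2.\<close>
    have "(1/2) ^ 3 \<le> y ^ 3" using y by (intro power_mono) auto
    then have "(3 * y ^ 3 + 6 * y\<^sup>2 + 4 * y + 2) / (2 * y ^ 3) \<le> (3 * y ^ 3 + 6 * y\<^sup>2 + 4 * y + 2) / (1/4)"
      using y by (intro divide_left_mono add_nonneg_nonneg mult_pos_pos) (auto simp: power3_eq_cube)
    also have "\<dots> \<le> 4 * ((1 + y)\<^sup>2 * (3 * y + 2))"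
      using y by (simp add: power2_eq_square power3_eq_cube algebra_simps)
    also have "\<dots> \<le> 4 * ((1 + y)\<^sup>2 * (13/2))"
      using y by (intro mult_left_mono) auto
    finally show ?thesis by simp
  qed
  ultimately have "\<bar>1 / (y\<^sup>2 * y) - 1 - 3 * x / 2\<bar> \<le> (1 - y)\<^sup>2 * (26 * (1 + y)\<^sup>2)"
    using y by (intro bound) simp_all
  then show "\<bar>1 / ((1 - x) * sqrt (1 - x)) - 1 - 3 * x / 2\<bar> \<le> 26 * x\<^sup>2"
    unfolding x2 y_def[symmetric] y2(1)[symmetric] by (simp add: mult_ac abs_of_nonneg[OF y2(2)])
qed


text \<open>Seen from \<open>(1, 0)\<close>, the core is the unit circle in the plane of the last
  two coordinates, and \<open>ring S\<close> is a circle in the plane of the first two that opens up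
  to the first axis as S tends to 0. Each velocity contributes 2 pi; divided by 4 pi and combined
  with the factor 1 / (2 sqrt 2) of \<open>gauss_kernel_hopf\<close>, this gives the constant in
  front.\<close>

lemma gauss_linking_core_ring:
  assumes S: "0 < S" "S < 1"
  defines "C \<equiv> sqrt (1 - S\<^sup>2)"
  shows "gauss_linking core (ring S) = pi / (2 * sqrt 2) *
    (C\<^sup>2 * integral {0..1} (\<lambda>s. 1 / ((1 - S * cos (2 * pi * s)) * sqrt (1 - S * cos (2 * pi * s)))) *
        integral {0..1} (\<lambda>t. 1 / sqrt (1 - C * cos (2 * pi * t)))
      - C * integral {0..1} (\<lambda>s. 1 / sqrt (1 - S * cos (2 * pi * s))) *
        integral {0..1} (\<lambda>t. cos (2 * pi * t) / sqrt (1 - C * cos (2 * pi * t))))"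
proof -
  define D where "D = (\<lambda>t. 1 - C * cos (2 * pi * t))"
  define E where "E = (\<lambda>s. 1 - S * cos (2 * pi * s))"
  have "S\<^sup>2 < 1" using S by (simp add: power_less_one_iff)
  then have C: "C\<^sup>2 + S\<^sup>2 = 1" "0 < C" "C < 1"
    using S by (auto simp: C_def real_sqrt_less_iff intro!: real_less_lsqrt)
  have pos: "1 - c * cos x > 0" if "0 < c" "c < 1" for c x :: real
  proof -
    have "c * cos x \<le> c * 1" using that by (intro mult_left_mono) auto
    then show ?thesis using that by linarith
  qed
  have D: "D t > 0" for t unfolding D_def by (rule pos) fact+
  have E: "E s > 0" for s unfolding E_def by (rule pos) fact+
  define a where "a = (\<lambda>s. vector [0, cos (2 * pi * s), - sin (2 * pi * s)] :: real^3)"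
  define b where "b = (\<lambda>t. vector [C * sin (2 * pi * t) / D t, S / D t, 0] :: real^3)"
  have a: "stereo (1, 0) \<circ> core = a"
    by (simp add: fun_eq_iff a_def core_def stereo_at_1)
  have b: "stereo (1, 0) \<circ> ring S = b"
    by (simp add: fun_eq_iff b_def ring_def stereo_at_1 C_def[symmetric] D_def vector_3_axis scaleR_add_right)
  have a': "vector_derivative a (at s) = (2 * pi) *\<^sub>R vector [0, - sin (2 * pi * s), - cos (2 * pi * s)]" for s
  proof (rule vector_derivative_at)
    have "(a has_vector_derivative vector [0, - sin (2 * pi * s) * (2 * pi), - (cos (2 * pi * s) * (2 * pi))]) (at s)"
      unfolding a_def by (rule has_vector_derivative_vector_3) (auto intro!: derivative_eq_intros)
    then show "(a has_vector_derivative (2 * pi) *\<^sub>R vector [0, - sin (2 * pi * s), - cos (2 * pi * s)]) (at s)"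
      by (simp add: vector_3_axis algebra_simps)
  qed
  have b': "vector_derivative b (at t) = (2 * pi) *\<^sub>R vector [(C * cos (2 * pi * t) - C\<^sup>2) / (D t)\<^sup>2, - (S * C * sin (2 * pi * t)) / (D t)\<^sup>2, 0]" for t
  proof (rule vector_derivative_at)
    have dD: "(D has_real_derivative C * sin (2 * pi * t) * (2 * pi)) (at t)"
      unfolding D_def by (auto intro!: derivative_eq_intros)
    have "((\<lambda>t. C * sin (2 * pi * t) / D t) has_real_derivative
        ((C * (cos (2 * pi * t) * (2 * pi))) * D t - C * sin (2 * pi * t) * (C * sin (2 * pi * t) * (2 * pi))) / (D t * D t)) (at t)"
      using D[of t] by (auto intro!: derivative_eq_intros dD)
    moreover have "(C * (cos (2 * pi * t) * (2 * pi))) * D t - C * sin (2 * pi * t) * (C * sin (2 * pi * t) * (2 * pi))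
        = 2 * pi * (C * cos (2 * pi * t) - C\<^sup>2)"
    proof -
      have "(C * (c * (2 * pi))) * (1 - C * c) - C * u * (C * u * (2 * pi)) = 2 * pi * (C * c - C\<^sup>2 * (c\<^sup>2 + u\<^sup>2))" for c u :: real
        by (simp add: power2_eq_square algebra_simps)
      from this[of "cos (2 * pi * t)" "sin (2 * pi * t)"] show ?thesis by (simp add: D_def)
    qed
    moreover have "((\<lambda>t. S / D t) has_real_derivative
        (0 * D t - S * (C * sin (2 * pi * t) * (2 * pi))) / (D t * D t)) (at t)"
      using D[of t] by (auto intro!: derivative_eq_intros dD)
    ultimately have "(b has_vector_derivative vector [2 * pi * (C * cos (2 * pi * t) - C\<^sup>2) / (D t * D t),
        (0 * D t - S * (C * sin (2 * pi * t) * (2 * pi))) / (D t * D t), 0]) (at t)"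
      unfolding b_def by (intro has_vector_derivative_vector_3) auto
    then show "(b has_vector_derivative (2 * pi) *\<^sub>R vector [(C * cos (2 * pi * t) - C\<^sup>2) / (D t)\<^sup>2, - (S * C * sin (2 * pi * t)) / (D t)\<^sup>2, 0]) (at t)"
    proof (rule has_vector_derivative_eq_rhs)
      show "(vector [2 * pi * (C * cos (2 * pi * t) - C\<^sup>2) / (D t * D t),
          (0 * D t - S * (C * sin (2 * pi * t) * (2 * pi))) / (D t * D t), 0] :: real^3) =
        (2 * pi) *\<^sub>R vector [(C * cos (2 * pi * t) - C\<^sup>2) / (D t)\<^sup>2, - (S * C * sin (2 * pi * t)) / (D t)\<^sup>2, 0]"
        by (simp add: vec_eq_iff forall_3 power2_eq_square mult_ac)
    qed
  qed
  have scale: "gauss_kernel d (c *\<^sub>R u) (c *\<^sub>R v) = c\<^sup>2 * gauss_kernel d u v" for d u v c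
    by (simp add: gauss_kernel_def cross_mult_left cross_mult_right power2_eq_square)
  have kernel: "gauss_kernel (a s - b t) (vector_derivative a (at s)) (vector_derivative b (at t))
      = 4 * pi\<^sup>2 / (2 * sqrt 2) * (C\<^sup>2 / (E s * sqrt (E s)) * (1 / sqrt (D t)) - C / sqrt (E s) * (cos (2 * pi * t) / sqrt (D t)))" for s t
  proof -
    have "gauss_kernel (a s - b t) (vector [0, - sin (2 * pi * s), - cos (2 * pi * s)])
        (vector [(C * cos (2 * pi * t) - C\<^sup>2) / (D t)\<^sup>2, - (S * C * sin (2 * pi * t)) / (D t)\<^sup>2, 0])
      = 1 / (2 * sqrt 2) * (C\<^sup>2 / (E s * sqrt (E s)) * (1 / sqrt (D t)) - C / sqrt (E s) * (cos (2 * pi * t) / sqrt (D t)))"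
      unfolding a_def b_def D_def E_def
      by (rule gauss_kernel_hopf[OF C(1)]) (use D[of t] E[of s] in \<open>simp_all add: D_def E_def\<close>)
    then show ?thesis
      unfolding a' b' scale by (simp add: power2_eq_square)
  qed
  have contD: "continuous_on {0..1} (\<lambda>t. 1 / sqrt (D t))" "continuous_on {0..1} (\<lambda>t. cos (2 * pi * t) / sqrt (D t))"
    and contE: "continuous_on {0..1} (\<lambda>s. 1 / (E s * sqrt (E s)))" "continuous_on {0..1} (\<lambda>s. 1 / sqrt (E s))"
    using D E unfolding D_def E_def by (auto intro!: continuous_intros simp: less_imp_neq[symmetric] order_less_imp_not_eq2)
  define Q1 Q2 P3 P1 where "Q1 = integral {0..1} (\<lambda>t. 1 / sqrt (D t))" and "Q2 = integral {0..1} (\<lambda>t. cos (2 * pi * t) / sqrt (D t))"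
    and "P3 = integral {0..1} (\<lambda>s. 1 / (E s * sqrt (E s)))" and "P1 = integral {0..1} (\<lambda>s. 1 / sqrt (E s))"
  have Q: "((\<lambda>t. 1 / sqrt (D t)) has_integral Q1) {0..1}" "((\<lambda>t. cos (2 * pi * t) / sqrt (D t)) has_integral Q2) {0..1}"
    and P: "((\<lambda>s. 1 / (E s * sqrt (E s))) has_integral P3) {0..1}" "((\<lambda>s. 1 / sqrt (E s)) has_integral P1) {0..1}"
    unfolding Q1_def Q2_def P3_def P1_def using contD contE
    by (auto intro!: integrable_integral integrable_continuous_interval)
  have "integral {0..1} (\<lambda>t. gauss_kernel (a s - b t) (vector_derivative a (at s)) (vector_derivative b (at t)))
      = 4 * pi\<^sup>2 / (2 * sqrt 2) * (C\<^sup>2 / (E s * sqrt (E s)) * Q1 - C / sqrt (E s) * Q2)" for s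
    unfolding kernel by (intro integral_unique has_integral_mult_right has_integral_diff Q)
  then have inner: "(\<lambda>s. integral {0..1} (\<lambda>t. gauss_kernel (a s - b t) (vector_derivative a (at s)) (vector_derivative b (at t))))
      = (\<lambda>s. 4 * pi\<^sup>2 / (2 * sqrt 2) * ((C\<^sup>2 * Q1) * (1 / (E s * sqrt (E s))) - (C * Q2) * (1 / sqrt (E s))))"
    by (simp add: fun_eq_iff)
  have "integral {0..1} (\<lambda>s. integral {0..1} (\<lambda>t. gauss_kernel (a s - b t) (vector_derivative a (at s)) (vector_derivative b (at t))))
      = 4 * pi\<^sup>2 / (2 * sqrt 2) * ((C\<^sup>2 * Q1) * P3 - (C * Q2) * P1)"
    unfolding inner by (intro integral_unique has_integral_mult_right has_integral_diff P)
  then have "gauss_integral a b = pi / (2 * sqrt 2) * (C\<^sup>2 * P3 * Q1 - C * P1 * Q2)"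
    unfolding gauss_integral_kernel by (simp add: power2_eq_square field_simps)
  moreover have "gauss_linking core (ring S) = gauss_integral (stereo (1, 0) \<circ> core) (stereo (1, 0) \<circ> ring S)"
  proof (rule gauss_linking_stereo)
    show "C1_loop core" by (rule C1_loop_core)
    show "C1_loop (ring S)" using S by (intro C1_loop_ring) auto
    show "apart core (ring S)"
      by (rule apartI) (use C in \<open>auto simp: core_def ring_def C_def\<close>)
    have "(1, 0) \<noteq> core s" "(1, 0) \<noteq> ring S s" for s using S by (auto simp: core_def ring_def)
    moreover have "(1, 0) \<in> S3" by (simp add: norm_Pair)
    ultimately show "(1, 0) \<in> S3 - (core ` {0..1} \<union> ring S ` {0..1})" by blast
  qed
  ultimately show ?thesis
    unfolding a b Q1_def Q2_def P1_def P3_def D_def E_def by simp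
qed


section \<open>The Hopf integrals in the limit of a straight line\<close>

lemma has_integral_cos_period: "((\<lambda>s. cos (2 * pi * s)) has_integral 0) {0..1}"
proof -
  have "((\<lambda>s. cos (2 * pi * s)) has_integral sin (2 * pi * 1) / (2 * pi) - sin (2 * pi * 0) / (2 * pi)) {0..1}"
    by (rule fundamental_theorem_of_calculus)
      (auto intro!: derivative_eq_intros simp: has_real_derivative_iff_has_vector_derivative[symmetric])
  then show ?thesis by simp
qed

lemma has_integral_sqrt_one_minus_cos:
  "((\<lambda>t. sqrt (1 - cos (2 * pi * t))) has_integral 2 * sqrt 2 / pi) {0..1}"
proof -
  have "sqrt (1 - cos (2 * pi * t)) = sqrt 2 * sin (pi * t)" if "t \<in> {0..1}" for t
  proof -
    have "1 - cos (2 * pi * t) = 2 * (sin (pi * t))\<^sup>2"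
      using cos_double_sin[of "pi * t"] by (simp add: mult_ac)
    moreover have "0 \<le> sin (pi * t)"
      using that by (intro sin_ge_zero) (auto intro: mult_left_le)
    ultimately show ?thesis by (simp add: real_sqrt_mult)
  qed
  moreover have "((\<lambda>t. sqrt 2 * sin (pi * t)) has_integral - sqrt 2 * cos (pi * 1) / pi - (- sqrt 2 * cos (pi * 0) / pi)) {0..1}"
    by (rule fundamental_theorem_of_calculus)
      (auto intro!: derivative_eq_intros simp: has_real_derivative_iff_has_vector_derivative[symmetric])
  ultimately show ?thesis
    by (subst has_integral_cong) simp_all
qed

lemma integral_near_1:
  fixes f :: "real \<Rightarrow> real"
  assumes f: "continuous_on {0..1} f"
    and near: "\<And>s. s \<in> {0..1} \<Longrightarrow> \<bar>f s - 1 - c * cos (2 * pi * s)\<bar> \<le> e"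
  shows "\<bar>integral {0..1} f - 1\<bar> \<le> e"
proof -
  have "((\<lambda>s. f s - 1 - c * cos (2 * pi * s)) has_integral integral {0..1} f - 1 - c * 0) {0..1}"
    by (intro has_integral_diff has_integral_mult_right has_integral_cos_period integrable_integral
        integrable_continuous_interval f) (use has_integral_const_real[of 1 0 "1::real"] in simp)
  moreover have "0 \<le> e" using near[of 0] by simp
  ultimately show ?thesis
    using has_integral_bound[of e "\<lambda>s. f s - 1 - c * cos (2 * pi * s)" "integral {0..1} f - 1" 0 "1::real"] near by simp
qed

text \<open>As S tends to 0, Q1 grows without bound, but in Q1 - Q2 the factor 1 - cos cancels the
  singularity. The remaining multiple of Q1 has the coefficient C P3 - P1, which has to be of order
  S^2 in order to beat the crude bound Q1 \<le> 2 / S.\<close>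

lemma hopf_integral_bound:
  assumes S: "0 < S" "S \<le> 1/2"
  defines "C \<equiv> sqrt (1 - S\<^sup>2)"
  defines "P3 \<equiv> integral {0..1} (\<lambda>s. 1 / ((1 - S * cos (2 * pi * s)) * sqrt (1 - S * cos (2 * pi * s))))"
    and "P1 \<equiv> integral {0..1} (\<lambda>s. 1 / sqrt (1 - S * cos (2 * pi * s)))"
    and "Q1 \<equiv> integral {0..1} (\<lambda>t. 1 / sqrt (1 - C * cos (2 * pi * t)))"
    and "Q2 \<equiv> integral {0..1} (\<lambda>t. cos (2 * pi * t) / sqrt (1 - C * cos (2 * pi * t)))"
  defines "K \<equiv> 2 * sqrt 2 / pi"
  shows "\<bar>P1 - 1\<bar> \<le> 26 * S\<^sup>2" "\<bar>(C * P3 - P1) * Q1\<bar> \<le> 106 * S"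
    "K - S \<le> Q1 - Q2" "Q1 - Q2 \<le> K / sqrt C"
proof -
  have S2: "S\<^sup>2 \<le> 1/4" using power_mono[of S "1/2" 2] S by (simp add: power2_eq_square)
  have C2: "C\<^sup>2 = 1 - S\<^sup>2" using S2 by (simp add: C_def)
  have C: "0 < C" "C < 1"
    using S S2 by (auto simp: C_def intro!: real_less_lsqrt)
  have C1: "S\<^sup>2 / 2 \<le> 1 - C" "1 - C \<le> S\<^sup>2"
  proof -
    have "S\<^sup>2 = (1 - C) * (1 + C)" using C2 by (simp add: algebra_simps power2_eq_square)
    moreover have "(1 - C) * (1 + C) \<le> (1 - C) * 2" "(1 - C) * 1 \<le> (1 - C) * (1 + C)"
      by (rule mult_left_mono; use C in simp)+
    ultimately show "S\<^sup>2 / 2 \<le> 1 - C" "1 - C \<le> S\<^sup>2" by auto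
  qed
  have Sc: "\<bar>S * cos x\<bar> \<le> S" for x
    using S mult_left_mono[of "\<bar>cos x\<bar>" 1 S] by (simp add: abs_mult)
  have Sc': "\<bar>S * cos x\<bar> \<le> 1/2" "1 - S * cos x > 0" "(S * cos x)\<^sup>2 \<le> S\<^sup>2" for x
    using Sc[of x] S abs_le_square_iff[of "S * cos x" S] by auto
  show P1: "\<bar>P1 - 1\<bar> \<le> 26 * S\<^sup>2"
    unfolding P1_def
  proof (rule integral_near_1)
    show "continuous_on {0..1} (\<lambda>s. 1 / sqrt (1 - S * cos (2 * pi * s)))"
      using Sc'(2) by (intro continuous_intros) (simp add: less_imp_neq[symmetric])
    show "\<bar>1 / sqrt (1 - S * cos (2 * pi * s)) - 1 - S / 2 * cos (2 * pi * s)\<bar> \<le> 26 * S\<^sup>2" for s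
      using inverse_sqrt_expansion(1)[OF Sc'(1), of "2 * pi * s"] Sc'(3)[of "2 * pi * s"] by simp
  qed
  have P3: "\<bar>P3 - 1\<bar> \<le> 26 * S\<^sup>2"
    unfolding P3_def
  proof (rule integral_near_1)
    show "continuous_on {0..1} (\<lambda>s. 1 / ((1 - S * cos (2 * pi * s)) * sqrt (1 - S * cos (2 * pi * s))))"
      using Sc'(2) by (intro continuous_intros) (simp add: less_imp_neq[symmetric])
    show "\<bar>1 / ((1 - S * cos (2 * pi * s)) * sqrt (1 - S * cos (2 * pi * s))) - 1 - (3 * S / 2) * cos (2 * pi * s)\<bar> \<le> 26 * S\<^sup>2" for s
      using inverse_sqrt_expansion(2)[OF Sc'(1), of "2 * pi * s"] Sc'(3)[of "2 * pi * s"] by simp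
  qed
  have D1: "1 - C \<le> 1 - C * cos x" and D2: "C * (1 - cos x) \<le> 1 - C * cos x"
    and D3: "1 - C * cos x \<le> (1 - cos x) + (1 - C)" for x
  proof -
    have "C * cos x \<le> C * 1" "(1 - C) * cos x \<le> (1 - C) * 1" using C by (auto intro!: mult_left_mono)
    then show "1 - C \<le> 1 - C * cos x" "1 - C * cos x \<le> (1 - cos x) + (1 - C)" by (auto simp: algebra_simps)
    show "C * (1 - cos x) \<le> 1 - C * cos x" using C by (simp add: algebra_simps)
  qed
  have D0: "1 - C * cos x > 0" for x using D1[of x] C by linarith
  have cQ: "continuous_on {0..1} (\<lambda>t. 1 / sqrt (1 - C * cos (2 * pi * t)))"
    "continuous_on {0..1} (\<lambda>t. cos (2 * pi * t) / sqrt (1 - C * cos (2 * pi * t)))"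
    using D0 by (intro continuous_intros; simp add: less_imp_neq[symmetric])+
  have Q: "((\<lambda>t. 1 / sqrt (1 - C * cos (2 * pi * t))) has_integral Q1) {0..1}"
    "((\<lambda>t. cos (2 * pi * t) / sqrt (1 - C * cos (2 * pi * t))) has_integral Q2) {0..1}"
    unfolding Q1_def Q2_def by (intro integrable_integral integrable_continuous_interval cQ)+
  have "0 \<le> Q1"
    using has_integral_nonneg[OF Q(1)] D0 by (auto simp: less_imp_le)
  moreover have "Q1 \<le> 2 / S"
  proof -
    have "((\<lambda>_. 2 / S) has_integral 2 / S) {0..1::real}"
      using has_integral_const_real[of "2 / S" 0 "1::real"] by simp
    from has_integral_le[OF Q(1) this] show ?thesis
    proof -
      have "1 / sqrt (1 - C * cos x) \<le> 2 / S" for x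
      proof -
        have "(S / 2)\<^sup>2 \<le> S\<^sup>2 / 2" by (simp add: power_divide)
        then have "(S / 2)\<^sup>2 \<le> 1 - C * cos x" using C1(1) D1[of x] by linarith
        then have "S / 2 \<le> sqrt (1 - C * cos x)" by (rule real_le_rsqrt)
        then have "1 / sqrt (1 - C * cos x) \<le> 1 / (S / 2)" using S D0[of x] by (intro divide_left_mono mult_pos_pos) auto
        then show ?thesis by simp
      qed
      then show ?thesis using \<open>(\<And>x. x \<in> {0..1} \<Longrightarrow> _) \<Longrightarrow> Q1 \<le> 2 / S\<close> by blast
    qed
  qed
  \<comment> \<open>The constant is 26 from each of P3 and P1 and 1 from 1 - C; the bound on Q1
    doubles it.\<close>
  moreover have "\<bar>C * P3 - P1\<bar> \<le> 53 * S\<^sup>2"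
  proof -
    have "C * P3 - P1 = C * (P3 - 1) - (P1 - 1) - (1 - C)" by (simp add: algebra_simps)
    moreover have "\<bar>C * (P3 - 1)\<bar> \<le> 1 * (26 * S\<^sup>2)"
      unfolding abs_mult using C P3 by (intro mult_mono) auto
    ultimately show ?thesis using P1 C1 C by linarith
  qed
  ultimately have "\<bar>C * P3 - P1\<bar> * Q1 \<le> (53 * S\<^sup>2) * (2 / S)"
    by (intro mult_mono) auto
  then show "\<bar>(C * P3 - P1) * Q1\<bar> \<le> 106 * S"
    using S \<open>0 \<le> Q1\<close> by (simp add: abs_mult power2_eq_square)
  have diff: "((\<lambda>t. (1 - cos (2 * pi * t)) / sqrt (1 - C * cos (2 * pi * t))) has_integral Q1 - Q2) {0..1}"
    using has_integral_diff[OF Q] by (simp add: diff_divide_distrib)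
  have K: "((\<lambda>t. sqrt (1 - cos (2 * pi * t))) has_integral K) {0..1}"
    unfolding K_def by (rule has_integral_sqrt_one_minus_cos)
  show "K - S \<le> Q1 - Q2"
  proof (rule has_integral_le[OF _ diff])
    have "((\<lambda>_. S) has_integral S) {0..1::real}"
      using has_integral_const_real[of S 0 "1::real"] by simp
    from has_integral_diff[OF K this]
    show "((\<lambda>t. sqrt (1 - cos (2 * pi * t)) - S) has_integral K - S) {0..1}" .
    fix t :: real
    define x e where "x = 1 - cos (2 * pi * t)" and "e = 1 - C"
    define d where "d = 1 - C * cos (2 * pi * t)"
    have x: "0 \<le> x" "0 < e" "0 < d" "d \<le> x + e"
      using C D0[of "2 * pi * t"] D3[of "2 * pi * t"] unfolding x_def e_def d_def by auto
    have "sqrt e \<le> S" using C1(2) S by (simp add: e_def real_le_lsqrt)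
    \<comment> \<open>Since d \<le> x + e, sqrt d is at most sqrt x + sqrt e, whose product with
      sqrt x - sqrt e is x - e. For x \<le> e the left side is not positive.\<close>
    moreover have "sqrt x - sqrt e \<le> x / sqrt d"
    proof (cases "x \<le> e")
      case True
      then have "sqrt x - sqrt e \<le> 0" by simp
      also have "0 \<le> x / sqrt d" using x by simp
      finally show ?thesis .
    next
      case False
      have "(sqrt x - sqrt e) * sqrt d \<le> (sqrt x - sqrt e) * sqrt (x + e)"
        using False x by (intro mult_left_mono) auto
      also have "sqrt (x + e) \<le> sqrt x + sqrt e" using x by (intro sqrt_add_le_add_sqrt) auto
      then have "(sqrt x - sqrt e) * sqrt (x + e) \<le> (sqrt x - sqrt e) * (sqrt x + sqrt e)"
        using False by (intro mult_left_mono) auto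
      also have "\<dots> = x - e" using x by (simp add: algebra_simps)
      finally have "(sqrt x - sqrt e) * sqrt d \<le> x" using x by linarith
      then show ?thesis using x by (simp add: pos_le_divide_eq)
    qed
    ultimately show "sqrt (1 - cos (2 * pi * t)) - S \<le> (1 - cos (2 * pi * t)) / sqrt (1 - C * cos (2 * pi * t))"
      unfolding x_def d_def by linarith
  qed
  show "Q1 - Q2 \<le> K / sqrt C"
  proof (rule has_integral_le[OF diff])
    show "((\<lambda>t. sqrt (1 - cos (2 * pi * t)) / sqrt C) has_integral K / sqrt C) {0..1}"
      using has_integral_mult_left[OF K, of "1 / sqrt C"] by simp
    fix t :: real
    define x where "x = 1 - cos (2 * pi * t)"
    have x: "0 \<le> x" by (simp add: x_def)
    have "sqrt (C * x) \<le> sqrt (1 - C * cos (2 * pi * t))" using D2[of "2 * pi * t"] by (simp add: x_def)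
    then have "x / sqrt (1 - C * cos (2 * pi * t)) \<le> sqrt x / sqrt C"
    proof (cases "x = 0")
      case False
      then have "x / sqrt (1 - C * cos (2 * pi * t)) \<le> x / sqrt (C * x)"
        using x C D0 \<open>sqrt (C * x) \<le> _\<close> by (intro divide_left_mono) auto
      also have "\<dots> = sqrt x / sqrt C"
        using x C False by (simp add: real_sqrt_mult field_simps)
      finally show ?thesis .
    qed simp
    then show "(1 - cos (2 * pi * t)) / sqrt (1 - C * cos (2 * pi * t)) \<le> sqrt (1 - cos (2 * pi * t)) / sqrt C"
      by (simp add: x_def)
  qed
qed

text \<open>The centre \<open>(1, 0)\<close> lies on \<open>ring 0\<close>, so the integral is
  evaluated on \<open>ring S\<close> with S > 0, a loop homotopic to \<open>ring 0\<close> off the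
  core. Its value does not depend on S and therefore equals its limit at 0.\<close>

lemma lk_core_ring: "lk core (ring 0) = 1"
proof -
  define g where "g = lk core (ring 0)"
  have g: "gauss_linking core (ring S) = g" if S: "0 < S" "S < 1" for S
  proof -
    have r: "0 \<le> x * S \<and> x * S < 1" if "x \<in> {0..1}" for x
    proof -
      have "x * S \<le> 1 * S" by (rule mult_right_mono) (use S that in auto)
      then have "x * S < 1" using S by linarith
      then show ?thesis using S that by auto
    qed
    have "lk core (ring (0 * S)) = lk core (ring (1 * S))"
    proof (rule lk_homotopic[where A = "\<lambda>x. core" and B = "\<lambda>x. ring (x * S)"])
      show "continuous_on ({0..1} \<times> {0..1}) (\<lambda>(x, s). core s)"
        unfolding core_def case_prod_beta by (intro continuous_intros)
      show "continuous_on ({0..1} \<times> {0..1}) (\<lambda>(x, s). ring (x * S) s)"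
        unfolding ring_def case_prod_beta by (intro continuous_intros)
      show "core s \<noteq> ring (x * S) t" if "x \<in> {0..1}" for x s t
      proof -
        have "(x * S)\<^sup>2 < 1" using r[OF that] by (simp add: power_less_one_iff)
        then show ?thesis by (auto simp: core_def ring_def)
      qed
      show "core s \<in> S3" if "s \<in> {0..1}" for s
        using C1_loop_core that by (simp add: C1_loop_def)
      show "ring (x * S) s \<in> S3" if "x \<in> {0..1}" "s \<in> {0..1}" for x s
        using C1_loop_ring[of "x * S"] r[OF that(1)] that(2) by (simp add: C1_loop_def)
    qed (auto simp: core_def ring_def)
    moreover have "apart core (ring S)"
    proof (rule apartI)
      have "S\<^sup>2 < 1" using S by (simp add: power_less_one_iff)
      then show "core s \<noteq> ring S t" for s t by (auto simp: core_def ring_def)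
    qed
    ultimately show ?thesis
      using S by (simp add: g_def lk_C1_loop C1_loop_core C1_loop_ring)
  qed
  define C where "C = (\<lambda>S::real. sqrt (1 - S\<^sup>2))"
  define P3 where "P3 = (\<lambda>S::real. integral {0..1} (\<lambda>s. 1 / ((1 - S * cos (2 * pi * s)) * sqrt (1 - S * cos (2 * pi * s)))))"
  define P1 where "P1 = (\<lambda>S::real. integral {0..1} (\<lambda>s. 1 / sqrt (1 - S * cos (2 * pi * s))))"
  define Q1 where "Q1 = (\<lambda>S::real. integral {0..1} (\<lambda>t. 1 / sqrt (1 - C S * cos (2 * pi * t))))"
  define Q2 where "Q2 = (\<lambda>S::real. integral {0..1} (\<lambda>t. cos (2 * pi * t) / sqrt (1 - C S * cos (2 * pi * t))))"
  define K where "K = 2 * sqrt 2 / pi"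
  have ev: "\<forall>\<^sub>F S in at_right 0. 0 < S \<and> S \<le> (1/2::real)"
    unfolding eventually_at_right_field by (intro exI[of _ "1/2"]) auto
  have bounds: "\<bar>P1 S - 1\<bar> \<le> 26 * S\<^sup>2" "\<bar>(C S * P3 S - P1 S) * Q1 S\<bar> \<le> 106 * S"
    "K - S \<le> Q1 S - Q2 S" "Q1 S - Q2 S \<le> K / sqrt (C S)" if "0 < S \<and> S \<le> 1/2" for S
    unfolding C_def P1_def P3_def Q1_def Q2_def K_def
    by (rule hopf_integral_bound; use that in simp)+
  have C: "(C \<longlongrightarrow> 1) (at_right 0)"
    unfolding C_def by (auto intro!: tendsto_eq_intros)
  have P1: "(P1 \<longlongrightarrow> 1) (at_right 0)"
  proof (rule LIM_zero_cancel, rule Lim_null_comparison)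
    show "\<forall>\<^sub>F S in at_right 0. norm (P1 S - 1) \<le> 26 * S\<^sup>2"
      using ev by eventually_elim (use bounds(1) in auto)
    show "((\<lambda>S::real. 26 * S\<^sup>2) \<longlongrightarrow> 0) (at_right 0)" by (auto intro!: tendsto_eq_intros)
  qed
  have R: "((\<lambda>S. (C S * P3 S - P1 S) * Q1 S) \<longlongrightarrow> 0) (at_right 0)"
  proof (rule Lim_null_comparison)
    show "\<forall>\<^sub>F S in at_right 0. norm ((C S * P3 S - P1 S) * Q1 S) \<le> 106 * S"
      using ev by eventually_elim (use bounds(2) in auto)
    show "((\<lambda>S::real. 106 * S) \<longlongrightarrow> 0) (at_right 0)" by (auto intro!: tendsto_eq_intros)
  qed
  have Q: "((\<lambda>S. Q1 S - Q2 S) \<longlongrightarrow> K) (at_right 0)"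
  proof (rule tendsto_sandwich)
    show "\<forall>\<^sub>F S in at_right 0. K - S \<le> Q1 S - Q2 S"
      using ev by eventually_elim (use bounds(3) in auto)
    show "\<forall>\<^sub>F S in at_right 0. Q1 S - Q2 S \<le> K / sqrt (C S)"
      using ev by eventually_elim (use bounds(4) in auto)
    show "((\<lambda>S. K - S) \<longlongrightarrow> K) (at_right 0)" by (auto intro!: tendsto_eq_intros)
    show "((\<lambda>S. K / sqrt (C S)) \<longlongrightarrow> K) (at_right 0)"
      using C by (auto intro!: tendsto_eq_intros)
  qed
  \<comment> \<open>The product C P1 Q1 is added and subtracted, so that Q1 occurs only in Q1 - Q2
    and with a small coefficient. The limit is \<open>pi / (2 * sqrt 2) * K\<close>, which is
    1.\<close>
  have "((\<lambda>S. pi / (2 * sqrt 2) * (C S * P1 S * (Q1 S - Q2 S) + C S * ((C S * P3 S - P1 S) * Q1 S)))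
      \<longlongrightarrow> pi / (2 * sqrt 2) * (1 * 1 * K + 1 * 0)) (at_right 0)"
    by (intro tendsto_intros C P1 Q R)
  moreover have "\<forall>\<^sub>F S in at_right 0. pi / (2 * sqrt 2) * (C S * P1 S * (Q1 S - Q2 S) + C S * ((C S * P3 S - P1 S) * Q1 S)) = g"
    using ev
  proof eventually_elim
    case (elim S)
    have "g = pi / (2 * sqrt 2) * ((C S)\<^sup>2 * P3 S * Q1 S - C S * P1 S * Q2 S)"
      unfolding C_def P3_def P1_def Q1_def Q2_def
      by (rule trans[OF g[symmetric] gauss_linking_core_ring]) (use elim in auto)
    also have "(C S)\<^sup>2 * P3 S * Q1 S - C S * P1 S * Q2 S =
        C S * P1 S * (Q1 S - Q2 S) + C S * ((C S * P3 S - P1 S) * Q1 S)"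
      by (simp add: algebra_simps power2_eq_square)
    finally show ?case by simp
  qed
  ultimately have "((\<lambda>S. g) \<longlongrightarrow> pi / (2 * sqrt 2) * (1 * 1 * K + 1 * 0)) (at_right (0::real))"
    by (rule Lim_transform_eventually)
  then have "g = pi / (2 * sqrt 2) * (1 * 1 * K + 1 * 0)"
    by (simp add: tendsto_const_iff)
  then show ?thesis by (simp add: g_def K_def)
qed

section \<open>Curves in the solid torus\<close>

lemma periodic_of_int:
  fixes a :: "real \<Rightarrow> 'a"
  assumes "\<And>s. a (s + 1) = a s"
  shows "a (s + of_int n) = a s"
proof (induction n rule: int_induct[where k = 0])
  case (step1 i)
  then show ?case using assms[of "s + of_int i"] by (simp add: algebra_simps)
next
  case (step2 i)
  then show ?case using assms[of "s + of_int (i - 1)"] by (simp add: algebra_simps)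
qed simp

lemma additive_of_int:
  fixes D :: "int \<Rightarrow> real"
  assumes "\<And>m. D (m + 1) = D m + d"
  shows "D m = D 0 + of_int m * d"
proof (induction m rule: int_induct[where k = 0])
  case (step1 i)
  then show ?case using assms[of i] by (simp add: algebra_simps)
next
  case (step2 i)
  then show ?case using assms[of "i - 1"] by (simp add: algebra_simps)
qed simp

text \<open>Periodic on the whole line, in contrast to \<open>loop\<close>, so that a change of
  parameter may leave the unit interval.\<close>

definition closed_curve :: "(real \<Rightarrow> complex \<times> complex) \<Rightarrow> bool"
  where "closed_curve a \<longleftrightarrow> continuous_on UNIV a \<and> (\<forall>s. a s \<in> S3) \<and> (\<forall>s. a (s + 1) = a s)"

lemma closed_curve_loop: "closed_curve a \<Longrightarrow> loop a"
  unfolding closed_curve_def loop_def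
  by (metis add_0 continuous_on_subset subset_UNIV)

lemma continuous_on_snd_comp:
  "continuous_on T f \<Longrightarrow> continuous_on (S \<times> T) (\<lambda>z. f (snd z))"
  by (rule continuous_on_compose_intro[of T f]) (auto intro: continuous_intros)

text \<open>The two changes of parameter have the same degree d, hence so do the functions
  interpolating between them, and the intermediate loops close up. They avoid b because all of a
  does.\<close>

lemma lk_reparam:
  assumes a: "closed_curve a" and b: "loop b" and ne: "\<And>s t. t \<in> {0..1} \<Longrightarrow> a s \<noteq> b t"
    and \<phi>: "continuous_on {0..1} \<phi>" "\<phi> 1 = \<phi> 0 + of_int d"
    and \<psi>: "continuous_on {0..1} \<psi>" "\<psi> 1 = \<psi> 0 + of_int d"
  shows "lk (\<lambda>s. a (\<phi> s)) b = lk (\<lambda>s. a (\<psi> s)) b"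
proof -
  have ca: "continuous_on UNIV a" and per: "\<And>s. a (s + 1) = a s" and S3: "\<And>s. a s \<in> S3"
    using a by (auto simp: closed_curve_def)
  define A where "A = (\<lambda>x s. a ((1 - x) * \<phi> s + x * \<psi> s))"
  have "lk (A 0) b = lk (A 1) b"
  proof (rule lk_homotopic[where A = A and B = "\<lambda>x. b"])
    show "continuous_on ({0..1} \<times> {0..1}) (\<lambda>(x, s). A x s)"
      unfolding A_def case_prod_beta
      by (rule continuous_on_compose_intro[OF ca]) (intro continuous_intros continuous_on_snd_comp \<phi> \<psi>, rule UNIV_I)
    show "continuous_on ({0..1} \<times> {0..1}) (\<lambda>(x::real, s). b s)"
      unfolding case_prod_beta using b by (intro continuous_on_snd_comp) (simp add: loop_def)
    show "A x 0 = A x 1" for x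
    proof -
      have "(1 - x) * \<phi> 1 + x * \<psi> 1 = (1 - x) * \<phi> 0 + x * \<psi> 0 + of_int d"
        unfolding \<phi>(2) \<psi>(2) by (simp add: algebra_simps)
      then show ?thesis by (simp add: A_def periodic_of_int[of a, OF per])
    qed
    show "A x s \<noteq> b t" if "t \<in> {0..1}" for x s t unfolding A_def using ne[OF that] .
    show "A x s \<in> S3" for x s unfolding A_def by (rule S3)
    show "b s \<in> S3" if "s \<in> {0..1}" for s using b that by (simp add: loop_def)
    show "b 0 = b 1" using b by (simp add: loop_def)
  qed
  then show ?thesis by (simp add: A_def)
qed

lemma closed_curve_comp_loop:
  assumes "closed_curve a" "continuous_on {0..1} \<phi>" "\<phi> 1 = \<phi> 0 + of_int d"
  shows "loop (\<lambda>s. a (\<phi> s))"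
  using assms periodic_of_int[of a "\<phi> 0" d] continuous_on_compose_intro[of UNIV a "{0..1}" \<phi>]
  by (simp add: closed_curve_def loop_def)

lemma lk_comp_left:
  assumes a: "closed_curve a" and b: "loop b" and ne: "\<And>s t. t \<in> {0..1} \<Longrightarrow> a s \<noteq> b t"
    and \<phi>: "continuous_on {0..1} \<phi>" "\<phi> 1 = \<phi> 0 + of_int d"
  shows "lk (\<lambda>s. a (\<phi> s)) b = of_int d * lk a b"
proof -
  have per: "\<And>s. a (s + 1) = a s" using a by (auto simp: closed_curve_def)
  define D where "D = (\<lambda>m::int. lk (\<lambda>s. a (of_int m * s)) b)"
  have step: "D (m + 1) = D m + lk a b" for m
  proof -
    \<comment> \<open>One turn on the first half, m turns on the second: by periodicity of a this is
      the join of two loops, and its degree is m + 1.\<close>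
    define \<theta> where "\<theta> = (\<lambda>s::real. min (2 * s) 1 + of_int m * max (2 * s - 1) 0)"
    have "((\<lambda>s. a (of_int 1 * s)) +++ (\<lambda>s. a (of_int m * s))) s = a (\<theta> s)" for s
    proof (cases "s \<le> 1/2")
      case True then show ?thesis by (simp add: \<theta>_def joinpaths_def)
    next
      case False
      then have "\<theta> s = of_int m * (2 * s - 1) + 1" by (simp add: \<theta>_def)
      then show ?thesis using False per by (simp add: joinpaths_def)
    qed
    then have j: "(\<lambda>s. a (of_int 1 * s)) +++ (\<lambda>s. a (of_int m * s)) = (\<lambda>s. a (\<theta> s))" by blast
    have "D (m + 1) = lk (\<lambda>s. a (\<theta> s)) b"
      unfolding D_def
      by (rule lk_reparam[OF a b ne, where d = "m + 1"]) (auto simp: \<theta>_def intro!: continuous_intros)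
    also have "\<dots> = lk (\<lambda>s. a (of_int 1 * s)) b + lk (\<lambda>s. a (of_int m * s)) b"
      unfolding j[symmetric]
    proof (rule lk_join)
      show "loop (\<lambda>s. a (of_int 1 * s))"
        by (rule closed_curve_comp_loop[OF a, where d = 1]) (auto intro!: continuous_intros)
      show "loop (\<lambda>s. a (of_int m * s))"
        by (rule closed_curve_comp_loop[OF a, where d = m]) (auto intro!: continuous_intros)
      show "apart (\<lambda>s. a (of_int 1 * s)) b" "apart (\<lambda>s. a (of_int m * s)) b"
        by (rule apartI, rule ne, assumption)+
    qed (use b in auto)
    finally show ?thesis by (simp add: D_def)
  qed
  \<comment> \<open>Because \<open>D 1\<close> is \<open>lk a b\<close> itself.\<close>
  have "D 0 = 0" using step[of 0] by (simp add: D_def)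
  then have "D d = of_int d * lk a b" using additive_of_int[of D, OF step, of d] by simp
  moreover have "lk (\<lambda>s. a (\<phi> s)) b = D d"
    unfolding D_def
    by (rule lk_reparam[OF a b ne \<phi>]) (auto intro!: continuous_intros)
  ultimately show ?thesis by simp
qed

lemma lk_comp:
  assumes a: "closed_curve a" and b: "closed_curve b" and ne: "\<And>s t. a s \<noteq> b t"
    and \<phi>: "continuous_on {0..1} \<phi>" "\<phi> 1 = \<phi> 0 + of_int d"
    and \<psi>: "continuous_on {0..1} \<psi>" "\<psi> 1 = \<psi> 0 + of_int e"
  shows "lk (\<lambda>s. a (\<phi> s)) (\<lambda>s. b (\<psi> s)) = of_int (d * e) * lk a b"
proof -
  have b\<psi>: "loop (\<lambda>s. b (\<psi> s))" by (rule closed_curve_comp_loop[OF b \<psi>])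
  have la: "loop a" and lb: "loop b" using a b by (auto intro: closed_curve_loop)
  have "lk (\<lambda>s. a (\<phi> s)) (\<lambda>s. b (\<psi> s)) = of_int d * lk a (\<lambda>s. b (\<psi> s))"
    by (rule lk_comp_left[OF a b\<psi> ne \<phi>])
  also have "lk a (\<lambda>s. b (\<psi> s)) = lk (\<lambda>s. b (\<psi> s)) a"
    by (rule lk_commute[OF la b\<psi>]) (rule apartI, rule ne)
  also have "\<dots> = of_int e * lk b a"
    by (rule lk_comp_left[OF b la ne[symmetric] \<psi>])
  also have "lk b a = lk a b"
    by (rule lk_commute[OF lb la]) (rule apartI, rule ne[symmetric])
  finally show ?thesis by simp
qed

section \<open>Heights and fibres in the solid torus\<close>

lemma continuous_on_torus_embed [continuous_intros]:
  assumes "continuous_on X f" "continuous_on X g"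
  shows "continuous_on X (\<lambda>x. torus_embed (f x) (g x))"
proof -
  have "sqrt (1 + (cmod (f x))\<^sup>2) \<noteq> 0" for x
    using torus_embed_pos[of "f x"] by (metis divide_eq_0_iff less_irrefl)
  then show ?thesis
    unfolding torus_embed_def by (intro continuous_intros assms) auto
qed

lemma torus_embed_add_int: "torus_embed x (s + of_int n) = torus_embed x s"
  by (simp add: torus_embed_eq_iff)

lemma torus_embed_eqI: "s - t = of_int n \<Longrightarrow> torus_embed x s = torus_embed x t"
  by (simp add: torus_embed_eq_iff)

lemma torus_embed_neI:
  assumes "x = y \<Longrightarrow> \<exists>m::int. of_int m < s - t \<and> s - t < of_int m + 1"
  shows "torus_embed x s \<noteq> torus_embed y t"
proof
  assume "torus_embed x s = torus_embed y t"
  then have xy: "x = y" "s - t \<in> \<int>" by (auto simp: torus_embed_eq_iff)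
  then obtain n :: int where n: "s - t = of_int n" by (auto elim: Ints_cases)
  from assms xy obtain m :: int where "of_int m < s - t" "s - t < of_int m + 1" by auto
  with n have "(of_int m :: real) < of_int n" "(of_int n :: real) < of_int (m + 1)" by auto
  then have "m < n" "n < m + 1" by (simp_all only: of_int_less_iff)
  then show False by linarith
qed

lemma loop_torus_embed:
  assumes "continuous_on {0..1} c" "continuous_on {0..1} H" "c 0 = c 1" "H 1 = H 0 + of_int n"
  shows "loop (\<lambda>s. torus_embed (c s) (H s))"
  unfolding loop_def
  using assms torus_embed_in_S3 torus_embed_add_int by (auto intro!: continuous_intros simp del: mem_sphere)

text \<open>The projections are kept and the heights interpolated. A collision is possible only over
  a common point of the projections, and there the height difference stays in one open interval
  between consecutive integers.\<close>

lemma lk_heights: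
  assumes c: "continuous_on {0..1} c" "c 0 = c 1" and d: "continuous_on {0..1} d" "d 0 = d 1"
    and H: "continuous_on {0..1} H" "H 1 = H 0 + of_int n" and H': "continuous_on {0..1} H'" "H' 1 = H' 0 + of_int n"
    and K: "continuous_on {0..1} K" "K 1 = K 0 + of_int m" and K': "continuous_on {0..1} K'" "K' 1 = K' 0 + of_int m"
    and meet: "\<And>s t. s \<in> {0..1} \<Longrightarrow> t \<in> {0..1} \<Longrightarrow> c s = d t \<Longrightarrow>
      \<exists>l::int. of_int l < H s - K t \<and> H s - K t < of_int l + 1 \<and> of_int l < H' s - K' t \<and> H' s - K' t < of_int l + 1"
  shows "lk (\<lambda>s. torus_embed (c s) (H s)) (\<lambda>t. torus_embed (d t) (K t)) =
    lk (\<lambda>s. torus_embed (c s) (H' s)) (\<lambda>t. torus_embed (d t) (K' t))"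
proof -
  define A where "A = (\<lambda>x s. torus_embed (c s) ((1 - x) * H s + x * H' s))"
  define B where "B = (\<lambda>x s. torus_embed (d s) ((1 - x) * K s + x * K' s))"
  have "lk (A 0) (B 0) = lk (A 1) (B 1)"
  proof (rule lk_homotopic)
    show "continuous_on ({0..1} \<times> {0..1}) (\<lambda>(x, s). A x s)" "continuous_on ({0..1} \<times> {0..1}) (\<lambda>(x, s). B x s)"
      unfolding A_def B_def case_prod_beta
      by (intro continuous_on_torus_embed continuous_intros continuous_on_snd_comp c d H H' K K')+
    show "A x s \<in> S3" "B x s \<in> S3" for x s unfolding A_def B_def by (rule torus_embed_in_S3)+
    show "A x 0 = A x 1" for x
      unfolding A_def c(2) by (rule torus_embed_eqI[where n = "- n"]) (simp add: H H' algebra_simps)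
    show "B x 0 = B x 1" for x
      unfolding B_def d(2) by (rule torus_embed_eqI[where n = "- m"]) (simp add: K K' algebra_simps)
    fix x s t :: real assume x: "x \<in> {0..1}" and s: "s \<in> {0..1}" and t: "t \<in> {0..1}"
    show "A x s \<noteq> B x t"
      unfolding A_def B_def
    proof (rule torus_embed_neI)
      assume "c s = d t"
      then obtain l :: int where l: "of_int l < H s - K t" "H s - K t < of_int l + 1"
        "of_int l < H' s - K' t" "H' s - K' t < of_int l + 1" using meet[OF s t] by blast
      have e: "((1 - x) * H s + x * H' s) - ((1 - x) * K t + x * K' t) = (1 - x) * (H s - K t) + x * (H' s - K' t)"
        by (simp add: algebra_simps)
      have "of_int l < (1 - x) * (H s - K t) + x * (H' s - K' t)"
        using convex_bound_lt[of "- (H s - K t)" "- of_int l" "- (H' s - K' t)" "1 - x" x] l x by (simp add: algebra_simps)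
      moreover have "(1 - x) * (H s - K t) + x * (H' s - K' t) < of_int l + 1"
        using convex_bound_lt[of "H s - K t" "of_int l + 1" "H' s - K' t" "1 - x" x] l x by simp
      ultimately show "\<exists>l::int. of_int l < ((1 - x) * H s + x * H' s) - ((1 - x) * K t + x * K' t) \<and>
          ((1 - x) * H s + x * H' s) - ((1 - x) * K t + x * K' t) < of_int l + 1"
        unfolding e by blast
    qed
  qed
  then show ?thesis by (simp add: A_def B_def)
qed

text \<open>The second curve winds m times around x and n times along the fibre. As
  \<open>torus_embed\<close> multiplies the point of the disc by \<open>cis (2 * pi * s)\<close>,
  each passage along the fibre adds a turn of the first coordinate, which makes m + n turns around
  the core.\<close>

lemma lk_fibre_exp:
  assumes l: "continuous_on {0..1} l" "l 1 = l 0 + of_int m * (2 * of_real pi * \<i>)"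
    and K: "continuous_on {0..1} K" "K 1 = K 0 + of_int n"
  shows "lk (\<lambda>s. torus_embed x s) (\<lambda>t. torus_embed (x + exp (l t)) (K t)) = of_int (m + n)"
proof -
  \<comment> \<open>B1 straightens logarithm and height to constant speed; A and B2 then move the
    fibre to the centre of the disc together with the curve around it.\<close>
  define l' where "l' = (\<lambda>t::real. of_real t * (of_int m * (2 * of_real pi * \<i>)))"
  define A where "A = (\<lambda>y s. torus_embed ((1 - complex_of_real y) * x) s)"
  define B1 where "B1 = (\<lambda>y t. torus_embed (x + exp ((1 - of_real y) * l t + of_real y * l' t)) ((1 - y) * K t + y * (of_int n * t)))"
  define B2 where "B2 = (\<lambda>y t. torus_embed ((1 - of_real y) * x + exp (l' t)) (of_int n * t))"
  \<comment> \<open>The modulus of the second coordinate: 1 / sqrt 2 on the boundary torus, 0 on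
    \<open>ring 0\<close>. Thus B3 pushes the curve out of the solid torus, away from the core, onto
    \<open>ring 0\<close> traversed m + n times.\<close>
  define r where "r = (\<lambda>y::real. (1 - y) / sqrt 2)"
  define B3 where "B3 = (\<lambda>y t. (of_real (sqrt (1 - (r y)\<^sup>2)) * cis (2 * pi * of_int (m + n) * t), of_real (r y) * cis (2 * pi * of_int n * t)))"
  have r: "0 \<le> r y" "(r y)\<^sup>2 < 1" if "y \<in> {0..1}" for y
  proof -
    have "(1 - y)\<^sup>2 \<le> 1" using that by (simp add: power_le_one)
    then show "0 \<le> r y" "(r y)\<^sup>2 < 1" using that by (auto simp: r_def power_divide)
  qed
  have expne: "x \<noteq> x + exp z" for x z :: complex by simp
  have closed: "torus_embed y (of_int n * 0) = torus_embed y (of_int n * 1)" for y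
    by (rule torus_embed_eqI[where n = "- n"]) simp
  have exp_l': "exp (l' 1) = exp (l' 0)"
    unfolding exp_eq l'_def by (auto intro!: exI[of _ m])
  have 1: "lk (A 0) (B1 0) = lk (A 0) (B1 1)"
  proof (rule lk_homotopic[where A = "\<lambda>y. A 0" and B = B1])
    show "continuous_on ({0..1} \<times> {0..1}) (\<lambda>(y::real, s). A 0 s)"
      unfolding A_def case_prod_beta by (intro continuous_on_torus_embed continuous_intros)
    show "continuous_on ({0..1} \<times> {0..1}) (\<lambda>(y, t). B1 y t)"
      unfolding B1_def l'_def case_prod_beta
      by (intro continuous_on_torus_embed continuous_intros continuous_on_snd_comp l K)
    show "A 0 s \<in> S3" "B1 y s \<in> S3" for y s unfolding A_def B1_def by (rule torus_embed_in_S3)+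
    show "A 0 0 = A 0 1" unfolding A_def by (rule torus_embed_eqI[where n = "- 1"]) simp
    show "A 0 s \<noteq> B1 y t" for y s t unfolding A_def B1_def torus_embed_eq_iff using expne by auto
    show "B1 y 0 = B1 y 1" for y
    proof -
      have "exp ((1 - of_real y) * l 0 + of_real y * l' 0) = exp ((1 - of_real y) * l 1 + of_real y * l' 1)"
        unfolding exp_eq l(2) l'_def by (intro exI[of _ "- m"]) (simp add: algebra_simps)
      then show ?thesis
        unfolding B1_def by (simp del: exp_zero) (rule torus_embed_eqI[where n = "- n"], simp add: K algebra_simps)
    qed
  qed
  have 2: "lk (A 0) (B2 0) = lk (A 1) (B2 1)"
  proof (rule lk_homotopic)
    show "continuous_on ({0..1} \<times> {0..1}) (\<lambda>(y::real, s). A y s)"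
      unfolding A_def case_prod_beta by (intro continuous_on_torus_embed continuous_intros)
    show "continuous_on ({0..1} \<times> {0..1}) (\<lambda>(y, t). B2 y t)"
      unfolding B2_def l'_def case_prod_beta by (intro continuous_on_torus_embed continuous_intros)
    show "A y s \<in> S3" "B2 y s \<in> S3" for y s unfolding A_def B2_def by (rule torus_embed_in_S3)+
    show "A y 0 = A y 1" for y unfolding A_def by (rule torus_embed_eqI[where n = "- 1"]) simp
    show "A y s \<noteq> B2 y t" for y s t unfolding A_def B2_def torus_embed_eq_iff using expne by auto
    show "B2 y 0 = B2 y 1" for y unfolding B2_def exp_l' by (rule closed)
  qed
  have A1: "A 1 = core"
    by (simp add: A_def core_def torus_embed_def fun_eq_iff)
  have 3: "lk core (B3 0) = lk core (B3 1)"
  proof (rule lk_homotopic[where A = "\<lambda>y. core" and B = B3])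
    show "continuous_on ({0..1} \<times> {0..1}) (\<lambda>(y::real, s). core s)"
      unfolding core_def case_prod_beta by (intro continuous_intros)
    show "continuous_on ({0..1} \<times> {0..1}) (\<lambda>(y, t). B3 y t)"
      unfolding B3_def r_def case_prod_beta by (intro continuous_intros) auto
    show "core s \<in> S3" if "s \<in> {0..1}" for s using C1_loop_core that by (simp add: C1_loop_def)
    show "B3 y s \<in> S3" if "y \<in> {0..1}" for y s
      using r[OF that] by (simp add: B3_def norm_Pair norm_mult)
    show "core s \<noteq> B3 y t" if "y \<in> {0..1}" for y s t
      using r[OF that] by (auto simp: core_def B3_def)
    have "cis (2 * pi * of_int k) = 1" for k :: int by (rule cis_multiple_2pi) simp
    then show "B3 y 0 = B3 y 1" for y by (simp add: B3_def del: of_int_add)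
  qed (simp add: core_def)
  have B23: "B2 1 = B3 0"
  proof
    fix t
    have e: "exp (l' t) = cis (2 * pi * of_int m * t)"
      by (simp add: l'_def cis_conv_exp mult_ac)
    have "2 * pi * of_int m * t + 2 * pi * (of_int n * t) = 2 * pi * of_int (m + n) * t"
      by (simp add: algebra_simps)
    then have c: "cis (2 * pi * of_int m * t) * cis (2 * pi * (of_int n * t)) = cis (2 * pi * of_int (m + n) * t)"
      by (simp add: cis_mult)
    have r0: "r 0 = 1 / sqrt 2" "sqrt (1 - (r 0)\<^sup>2) = 1 / sqrt 2"
      by (simp_all add: r_def power_divide real_sqrt_divide)
    have "B2 1 t = torus_embed (cis (2 * pi * of_int m * t)) (of_int n * t)" by (simp add: B2_def e)
    also have "\<dots> = (1 / sqrt 2) *\<^sub>R (cis (2 * pi * of_int (m + n) * t), cis (2 * pi * (of_int n * t)))"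
      by (simp only: torus_embed_def c norm_cis) simp
    also have "\<dots> = B3 0 t"
      by (simp only: B3_def r0(2)) (simp add: r0(1) scaleR_conv_of_real mult.assoc)
    finally show "B2 1 t = B3 0 t" .
  qed
  have B31: "B3 1 = (\<lambda>t. ring 0 (of_int (m + n) * t))"
    by (simp add: B3_def ring_def r_def fun_eq_iff mult.assoc)
  have ring: "closed_curve (ring 0)"
    unfolding closed_curve_def
  proof (intro conjI allI)
    show "continuous_on UNIV (ring 0)" unfolding ring_def by (intro continuous_intros)
    show "ring 0 s \<in> S3" for s by (simp add: ring_def norm_Pair)
    show "ring 0 (s + 1) = ring 0 s" for s
      by (simp add: ring_def distrib_left flip: cis_mult)
  qed
  have core: "loop core" by (intro C1_loop_imp_loop C1_loop_core)
  have ne: "ring 0 s \<noteq> core t" for s t by (auto simp: ring_def core_def)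
  have lr: "loop (\<lambda>t. ring 0 (of_int (m + n) * t))"
    by (rule closed_curve_comp_loop[OF ring, where d = "m + n"]) (auto intro!: continuous_intros)
  have "lk core (\<lambda>t. ring 0 (of_int (m + n) * t)) = lk (\<lambda>t. ring 0 (of_int (m + n) * t)) core"
    by (rule lk_commute[OF core lr]) (rule apartI, rule ne[symmetric])
  also have "\<dots> = of_int (m + n) * lk (ring 0) core"
    by (rule lk_comp_left[OF ring core ne, where d = "m + n"]) (auto intro!: continuous_intros)
  also have "lk (ring 0) core = lk core (ring 0)"
    by (rule lk_commute[OF closed_curve_loop[OF ring] core]) (rule apartI, rule ne)
  finally have "lk core (B3 1) = of_int (m + n)" unfolding B31 lk_core_ring by simp
  moreover have "A 0 = (\<lambda>s. torus_embed x s)" "B1 0 = (\<lambda>t. torus_embed (x + exp (l t)) (K t))" "B1 1 = B2 0"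
    by (simp_all add: A_def B1_def B2_def fun_eq_iff)
  ultimately show ?thesis using 1 2 3 A1 B23 by simp
qed


lemma lk_fibre_integer:
  assumes c: "continuous_on {0..1} c" "c 0 = c 1" and ne: "\<And>t. t \<in> {0..1} \<Longrightarrow> c t \<noteq> x"
    and K: "continuous_on {0..1} K" "K 1 = K 0 + of_int n"
  obtains N :: int where "lk (\<lambda>s. torus_embed x s) (\<lambda>t. torus_embed (c t) (K t)) = of_int N"
proof -
  have "continuous_on {0..1} (\<lambda>t. c t - x)" by (intro continuous_intros c)
  then obtain l where l: "continuous_on {0..1} l" "\<And>t. t \<in> {0..1} \<Longrightarrow> c t - x = exp (l t)"
    using continuous_logarithm_on_contractible[of "{0..1}" "\<lambda>t. c t - x"] ne
    by (auto intro: convex_imp_contractible)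
  have "exp (l 1) = exp (l 0)" using l(2)[of 0] l(2)[of 1] c(2) by simp
  then obtain m :: int where "l 1 = l 0 + of_int (2 * m) * (of_real pi * \<i>)"
    by (auto simp: exp_eq)
  then have m: "l 1 = l 0 + of_int m * (2 * of_real pi * \<i>)" by simp
  have "c t = x + exp (l t)" if "t \<in> {0..1}" for t
    using l(2)[OF that] by (simp add: algebra_simps)
  then have "lk (\<lambda>s. torus_embed x s) (\<lambda>t. torus_embed (c t) (K t)) =
      lk (\<lambda>s. torus_embed x s) (\<lambda>t. torus_embed (x + exp (l t)) (K t))"
    by (intro lk_cong) auto
  also have "\<dots> = of_int (m + n)" by (rule lk_fibre_exp[OF l(1) m K])
  finally show thesis by (rule that)
qed

text \<open>Seen from a, the extra turns are made for s between 0 and w, where c avoids the other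
  projection and heights are free; afterwards the height is merely shifted by an integer. The fibres
  are split off one at a time, as loops based at the starting point.\<close>

lemma lk_insert_fibres:
  fixes c d :: "real \<Rightarrow> complex" and h K :: "real \<Rightarrow> real"
  assumes c: "continuous_on UNIV c" "\<And>s. c (s + 1) = c s"
    and h: "continuous_on UNIV h" "\<And>s. h (s + 1) = h s + of_int n"
    and d: "continuous_on {0..1} d" "d 0 = d 1" and K: "continuous_on {0..1} K" "K 1 = K 0 + of_int n'"
    and w: "0 < w" "w < 1" and free: "\<And>s t. s \<in> {a..a + w} \<Longrightarrow> t \<in> {0..1} \<Longrightarrow> c s \<noteq> d t"
    and ne: "\<And>s t. t \<in> {0..1} \<Longrightarrow> c s = d t \<Longrightarrow> h s - K t \<notin> \<int>"
  shows "lk (\<lambda>s. torus_embed (c (a + s)) (h (a + s) + of_int m * min 1 (s / w))) (\<lambda>t. torus_embed (d t) (K t)) =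
    lk (\<lambda>s. torus_embed (c (a + s)) (h (a + s))) (\<lambda>t. torus_embed (d t) (K t)) +
    of_int m * lk (\<lambda>s. torus_embed (c a) s) (\<lambda>t. torus_embed (d t) (K t))"
proof -
  define b where "b = (\<lambda>t. torus_embed (d t) (K t))"
  have b: "loop b" unfolding b_def by (rule loop_torus_embed[OF d(1) K(1) d(2) K(2)])
  define \<rho> where "\<rho> = (\<lambda>s::real. min 1 (s / w))"
  have \<rho>: "\<rho> 0 = 0" "\<rho> 1 = 1" "\<And>s. s > w \<Longrightarrow> \<rho> s = 1" "continuous_on X \<rho>" for X
    using w by (auto simp: \<rho>_def intro!: continuous_intros)
  define A where "A = (\<lambda>(m::int) s. torus_embed (c (a + s)) (h (a + s) + of_int m * \<rho> s))"
  have int: "u + of_int k - v \<notin> \<int>" if "u - v \<notin> \<int>" for u v :: real and k :: int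
  proof
    assume "u + of_int k - v \<in> \<int>"
    from Ints_diff[OF this Ints_of_int[of k]] show False using that by (simp add: algebra_simps)
  qed
  \<comment> \<open>Up to w the projections differ; after w the shift is an integer and preserves
    the condition \<open>ne\<close>.\<close>
  have off: "torus_embed (c (a + s)) (h (a + s) + y) \<noteq> b t"
    if "t \<in> {0..1}" "s \<in> {0..1}" "s > w \<Longrightarrow> y = of_int k" for s y t k
  proof (cases "s > w")
    case True
    then show ?thesis
      using int[OF ne[OF that(1), of "a + s"]] that(3) by (auto simp: b_def torus_embed_eq_iff)
  next
    case False
    then show ?thesis
      using free[of "a + s" t] that(1,2) by (auto simp: b_def torus_embed_eq_iff)
  qed
  have A_off: "A m s \<noteq> b t" if "t \<in> {0..1}" "s \<in> {0..1}" for m s t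
    unfolding A_def by (rule off[OF that, where k = m]) (simp add: \<rho>)
  have c1: "c (a + 1) = c (a + 0)" and h1: "h (a + 1) = h (a + 0) + of_int n"
    using c(2) h(2) by simp_all
  have A01: "A m 0 = A m 1" for m
    unfolding A_def c1 by (rule torus_embed_eqI[where n = "- n - m"]) (simp add: h1 \<rho>)
  note ci = continuous_on_compose_intro[OF c(1)] continuous_on_compose_intro[OF h(1)] continuous_on_compose_intro[OF \<rho>(4)]
  have Ac: "continuous_on UNIV (A m)" for m
    unfolding A_def by (intro continuous_on_torus_embed continuous_intros ci[where S = UNIV] UNIV_I \<rho>)
  have A_loop: "loop (A m)" for m
    unfolding loop_def
    by (intro conjI ballI A01 continuous_on_subset[OF Ac subset_UNIV]) (unfold A_def, rule torus_embed_in_S3)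
  define F where "F = (\<lambda>s. torus_embed (c a) s)"
  have Fc: "closed_curve F"
    unfolding closed_curve_def F_def
    by (intro conjI allI continuous_intros torus_embed_in_S3 torus_embed_eqI[where n = 1]) simp
  have F_off: "F s \<noteq> b t" if "t \<in> {0..1}" for s t
    using free[of a t] that w by (auto simp: F_def b_def torus_embed_eq_iff)
  have F': "loop (\<lambda>s. F (h a + s))"
    by (rule closed_curve_comp_loop[OF Fc, where d = 1]) (auto intro!: continuous_intros)
  have "lk (A (m + 1)) b = lk (A m) b + lk F b" for m
  proof -
    \<comment> \<open>The curve waits at its starting point during the first half of the parameter
      interval.\<close>
    define u where "u = (\<lambda>s::real. max 0 (2 * s - 1))"
    have u: "u 0 = 0" "u 1 = 1" "continuous_on X u" and u01: "s \<in> {0..1} \<Longrightarrow> u s \<in> {0..1}" for X s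
      by (auto simp: u_def intro!: continuous_intros)
    define A' where "A' = (\<lambda>x s. A (m + 1) ((1 - x) * s + x * u s))"
    have "lk (A' 0) b = lk (A' 1) b"
    proof (rule lk_homotopic[where A = A' and B = "\<lambda>x. b"])
      show "continuous_on ({0..1} \<times> {0..1}) (\<lambda>(x, s). A' x s)"
        unfolding A'_def case_prod_beta
        by (rule continuous_on_compose_intro[OF Ac]) (intro continuous_intros continuous_on_snd_comp u, rule UNIV_I)
      show "continuous_on ({0..1} \<times> {0..1}) (\<lambda>(x::real, s). b s)"
        unfolding case_prod_beta using b by (intro continuous_on_snd_comp) (simp add: loop_def)
      show "A' x s \<in> S3" for x s unfolding A'_def A_def by (rule torus_embed_in_S3)
      show "b s \<in> S3" for s unfolding b_def by (rule torus_embed_in_S3)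
      show "A' x 0 = A' x 1" for x by (simp add: A'_def u A01)
      show "b 0 = b 1" using b by (simp add: loop_def)
      show "A' x s \<noteq> b t" if x: "x \<in> {0..1}" and s: "s \<in> {0..1}" and t: "t \<in> {0..1}" for x s t
        unfolding A'_def
      proof (rule A_off[OF t])
        have "convex {0..1::real}" by simp
        from convexD[OF this s u01[OF s], of "1 - x" x] x
        show "(1 - x) * s + x * u s \<in> {0..1}" by simp
      qed
    qed
    then have 1: "lk (A (m + 1)) b = lk (\<lambda>s. A (m + 1) (u s)) b" by (simp add: A'_def)
    \<comment> \<open>y0 makes all m + 1 turns along the strand. y1 makes one of them during the
      wait, where it traverses the fibre over \<open>c a\<close>. Both are finished as soon as
      \<open>u s > w\<close>.\<close>
    define y0 y1 where "y0 = (\<lambda>s. of_int (m + 1) * \<rho> (u s))" and "y1 = (\<lambda>s. min (2 * s) 1 + of_int m * \<rho> (u s))"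
    have y: "continuous_on {0..1} y0" "continuous_on {0..1} y1" "y0 0 = 0" "y1 0 = 0" "y0 1 = of_int (m + 1)" "y1 1 = of_int (m + 1)"
      by (auto simp: y0_def y1_def \<rho> u intro!: continuous_intros continuous_on_compose_intro[OF \<rho>(4)[of UNIV]] u)
    define A'' where "A'' = (\<lambda>x s. torus_embed (c (a + u s)) (h (a + u s) + ((1 - x) * y0 s + x * y1 s)))"
    have "lk (A'' 0) b = lk (A'' 1) b"
    proof (rule lk_homotopic[where A = A'' and B = "\<lambda>x. b"])
      have "continuous_on {0..1} (\<lambda>s. c (a + u s))" "continuous_on {0..1} (\<lambda>s. h (a + u s))"
        by (auto intro!: ci(1,2) continuous_intros u)
      then show "continuous_on ({0..1} \<times> {0..1}) (\<lambda>(x, s). A'' x s)"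
        unfolding A''_def case_prod_beta
        by (intro continuous_on_torus_embed continuous_intros continuous_on_snd_comp y)
          (simp_all add: continuous_on_snd_comp[where f = "\<lambda>s. c (a + u s)"] continuous_on_snd_comp[where f = "\<lambda>s. h (a + u s)"])
      show "continuous_on ({0..1} \<times> {0..1}) (\<lambda>(x::real, s). b s)"
        unfolding case_prod_beta using b by (intro continuous_on_snd_comp) (simp add: loop_def)
      show "A'' x s \<in> S3" for x s unfolding A''_def by (rule torus_embed_in_S3)
      show "b s \<in> S3" for s unfolding b_def by (rule torus_embed_in_S3)
      show "A'' x 0 = A'' x 1" for x
        unfolding A''_def u c1 by (rule torus_embed_eqI[where n = "- n - m - 1"], unfold h1 y) (simp add: algebra_simps)
      show "b 0 = b 1" using b by (simp add: loop_def)
      show "A'' x s \<noteq> b t" if x: "x \<in> {0..1}" and s: "s \<in> {0..1}" and t: "t \<in> {0..1}" for x s t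
        unfolding A''_def
      proof (rule off[OF t u01[OF s], where k = "m + 1"])
        assume "u s > w"
        then have "\<rho> (u s) = 1" "s > 1/2" using w \<rho>(3) by (auto simp: u_def)
        then have "y0 s = of_int (m + 1)" "y1 s = of_int (m + 1)" by (auto simp: y0_def y1_def)
        then show "(1 - x) * y0 s + x * y1 s = of_int (m + 1)" by (simp add: algebra_simps)
      qed
    qed
    moreover have "A'' 0 = (\<lambda>s. A (m + 1) (u s))" by (simp add: A''_def A_def y0_def)
    moreover have "A'' 1 = (\<lambda>s. F (h a + s)) +++ A m"
    proof
      fix s :: real
      show "A'' 1 s = ((\<lambda>s. F (h a + s)) +++ A m) s"
      proof (cases "s \<le> 1/2")
        case True
        then show ?thesis by (simp add: A''_def joinpaths_def u_def y1_def F_def \<rho>)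
      next
        case False
        then show ?thesis
          using torus_embed_add_int[of "c (a + (2 * s - 1))" "h (a + (2 * s - 1)) + of_int m * \<rho> (2 * s - 1)" 1]
          by (simp add: A''_def joinpaths_def u_def y1_def A_def algebra_simps)
      qed
    qed
    ultimately have 2: "lk (\<lambda>s. A (m + 1) (u s)) b = lk ((\<lambda>s. F (h a + s)) +++ A m) b" by simp
    have "lk ((\<lambda>s. F (h a + s)) +++ A m) b = lk (\<lambda>s. F (h a + s)) b + lk (A m) b"
    proof (rule lk_join[OF F' A_loop b])
      show "F (h a + 0) = A m 0" by (simp add: F_def A_def \<rho>)
      show "apart (\<lambda>s. F (h a + s)) b" by (rule apartI) (rule F_off)
      show "apart (A m) b" by (rule apartI) (rule A_off)
    qed
    moreover have "lk (\<lambda>s. F (h a + s)) b = of_int 1 * lk F b"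
      by (rule lk_comp_left[OF Fc b F_off]) (auto intro!: continuous_intros)
    ultimately show ?thesis using 1 2 by simp
  qed
  from additive_of_int[of "\<lambda>m. lk (A m) b", OF this, of m] show ?thesis
    by (simp add: A_def \<rho>_def b_def F_def)
qed

section \<open>Heights over an arrow diagram\<close>

text \<open>These four rules give the summands of \<open>turns\<close> just beside a parameter: the
  floor is continuous from the right, the ceiling from the left.\<close>

lemma eventually_floor_at_right: "\<forall>\<^sub>F y in at_right x. \<lfloor>y - v\<rfloor> = \<lfloor>x - v :: real\<rfloor>"
proof (rule eventually_at_rightI[of x "of_int \<lfloor>x - v\<rfloor> + 1 + v"])
  show "x < of_int \<lfloor>x - v\<rfloor> + 1 + v" by linarith
  show "\<lfloor>y - v\<rfloor> = \<lfloor>x - v\<rfloor>" if "y \<in> {x<..<of_int \<lfloor>x - v\<rfloor> + 1 + v}" for y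
    using that by (simp add: floor_eq_iff) linarith
qed

lemma eventually_floor_at_left: "\<forall>\<^sub>F y in at_left x. \<lfloor>y - v\<rfloor> = \<lceil>x - v :: real\<rceil> - 1"
proof (rule eventually_at_leftI[of "of_int \<lceil>x - v\<rceil> - 1 + v"])
  show "of_int \<lceil>x - v\<rceil> - 1 + v < x" by linarith
  show "\<lfloor>y - v\<rfloor> = \<lceil>x - v\<rceil> - 1" if "y \<in> {of_int \<lceil>x - v\<rceil> - 1 + v<..<x}" for y
    using that by (simp add: floor_eq_iff) linarith
qed

lemma eventually_ceiling_at_right: "\<forall>\<^sub>F y in at_right x. \<lceil>y - v\<rceil> = \<lfloor>x - v :: real\<rfloor> + 1"
proof (rule eventually_at_rightI[of x "of_int \<lfloor>x - v\<rfloor> + 1 + v"])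
  show "x < of_int \<lfloor>x - v\<rfloor> + 1 + v" by linarith
  show "\<lceil>y - v\<rceil> = \<lfloor>x - v\<rfloor> + 1" if "y \<in> {x<..<of_int \<lfloor>x - v\<rfloor> + 1 + v}" for y
    using that by (simp add: ceiling_eq_iff) linarith
qed

lemma eventually_ceiling_at_left: "\<forall>\<^sub>F y in at_left x. \<lceil>y - v\<rceil> = \<lceil>x - v :: real\<rceil>"
proof (rule eventually_at_leftI[of "of_int \<lceil>x - v\<rceil> - 1 + v"])
  show "of_int \<lceil>x - v\<rceil> - 1 + v < x" by linarith
  show "\<lceil>y - v\<rceil> = \<lceil>x - v\<rceil>" if "y \<in> {of_int \<lceil>x - v\<rceil> - 1 + v<..<x}" for y
    using that by (simp add: ceiling_eq_iff) linarith
qed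

definition fwd :: "arrow_diagram \<Rightarrow> nat \<Rightarrow> real set" where "fwd D i = {v. (i, v) \<in> forward D}"

definition bwd :: "arrow_diagram \<Rightarrow> nat \<Rightarrow> real set" where "bwd D i = {v. (i, v) \<in> backward D}"

text \<open>
  Up to an additive constant, the signed number of arrows passed on the \<open>i\<close>-th curve up to the
  parameter \<open>s\<close>; a forward arrow counts at its own parameter, a backward arrow only after it.
\<close>

definition turns :: "arrow_diagram \<Rightarrow> nat \<Rightarrow> real \<Rightarrow> int"
  where "turns D i s = (\<Sum>v\<in>fwd D i. \<lfloor>s - v\<rfloor>) - (\<Sum>v\<in>bwd D i. \<lceil>s - v\<rceil>)"

definition total_turns :: "arrow_diagram \<Rightarrow> nat \<Rightarrow> int"
  where "total_turns D i = int (card (fwd D i)) - int (card (bwd D i))"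

lemma finite_fwd_bwd:
  assumes "is_arrow_diagram D"
  shows "finite (fwd D i)" "finite (bwd D i)" "fwd D i \<subseteq> {0..<1}" "bwd D i \<subseteq> {0..<1}"
proof -
  have fin: "finite (arrows D)" and sub: "arrows D \<subseteq> places D"
    using assms by (auto simp: is_arrow_diagram_def)
  have "fwd D i \<subseteq> snd ` arrows D" "bwd D i \<subseteq> snd ` arrows D"
    by (force simp: fwd_def bwd_def arrows_def)+
  then show "finite (fwd D i)" "finite (bwd D i)" using fin by (auto intro: finite_subset)
  show "fwd D i \<subseteq> {0..<1}" "bwd D i \<subseteq> {0..<1}"
    using sub by (auto simp: fwd_def bwd_def arrows_def places_def)
qed

lemma turns_add_1:
  assumes "is_arrow_diagram D"
  shows "turns D i (s + 1) = turns D i s + total_turns D i"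
proof -
  have "\<lfloor>s + 1 - v\<rfloor> = \<lfloor>s - v\<rfloor> + 1" "\<lceil>s + 1 - v\<rceil> = \<lceil>s - v\<rceil> + 1" for v
    by linarith+
  then show ?thesis
    using finite_fwd_bwd[OF assms] by (simp add: turns_def total_turns_def sum.distrib)
qed

text \<open>Ceiling and floor of s - v differ by 1 unless s - v is an integer, which for v in the
  half-open unit interval means v = \<open>frac s\<close>. So the one-sided values of
  \<open>turns\<close> differ from its value only at an arrow.\<close>

lemma sum_ceiling_minus_floor:
  assumes "finite F" "F \<subseteq> {0..<1}"
  shows "(\<Sum>v\<in>F. \<lceil>s - v\<rceil> - \<lfloor>s - v\<rfloor>) = int (card F) - (if frac s \<in> F then 1 else 0)"
proof -
  have "\<lceil>s - v\<rceil> - \<lfloor>s - v\<rfloor> = 1 - (if v = frac s then 1 else 0)" if "v \<in> F" for v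
  proof -
    have v: "0 \<le> v" "v < 1" using that assms(2) by auto
    have "s - v \<in> \<int> \<longleftrightarrow> v = frac s"
    proof
      assume "s - v \<in> \<int>"
      then show "v = frac s" using v by (metis Ints_cases add_diff_cancel_left' diff_add_cancel frac_unique_iff minus_diff_eq uminus_add_conv_diff add.commute)
    next
      assume "v = frac s"
      then show "s - v \<in> \<int>" by (simp add: frac_def)
    qed
    moreover have "\<lceil>s - v\<rceil> - \<lfloor>s - v\<rfloor> = (if s - v \<in> \<int> then 0 else 1)"
      by (auto simp: ceiling_altdef elim: Ints_cases) (metis Ints_of_int)
    ultimately show ?thesis by simp
  qed
  then have "(\<Sum>v\<in>F. \<lceil>s - v\<rceil> - \<lfloor>s - v\<rfloor>) = (\<Sum>v\<in>F. 1 - (if v = frac s then 1 else 0))"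
    by (intro sum.cong) auto
  then show ?thesis using assms(1) by (simp add: sum_subtractf)
qed

lemma turns_at_right:
  assumes D: "is_arrow_diagram D"
  shows "\<forall>\<^sub>F y in at_right s. turns D i y = turns D i s - (if frac s \<in> bwd D i then 1 else 0)"
proof -
  have "\<forall>\<^sub>F y in at_right s. \<forall>v\<in>fwd D i. \<lfloor>y - v\<rfloor> = \<lfloor>s - v\<rfloor>"
    using finite_fwd_bwd(1)[OF D] eventually_floor_at_right by (auto simp: eventually_ball_finite_distrib)
  moreover have "\<forall>\<^sub>F y in at_right s. \<forall>v\<in>bwd D i. \<lceil>y - v\<rceil> = \<lfloor>s - v\<rfloor> + 1"
    using finite_fwd_bwd(2)[OF D] eventually_ceiling_at_right by (auto simp: eventually_ball_finite_distrib)
  ultimately show ?thesis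
  proof eventually_elim
    case (elim y)
    then have "turns D i y = (\<Sum>v\<in>fwd D i. \<lfloor>s - v\<rfloor>) - (\<Sum>v\<in>bwd D i. \<lfloor>s - v\<rfloor> + 1)"
      by (simp add: turns_def)
    also have "(\<Sum>v\<in>bwd D i. \<lfloor>s - v\<rfloor> + 1) = (\<Sum>v\<in>bwd D i. \<lceil>s - v\<rceil>) + (if frac s \<in> bwd D i then 1 else 0)"
      using sum_ceiling_minus_floor[OF finite_fwd_bwd(2,4)[OF D, of i], of s] by (simp add: sum_subtractf sum.distrib)
    finally show ?case by (simp add: turns_def)
  qed
qed

lemma turns_at_left:
  assumes D: "is_arrow_diagram D"
  shows "\<forall>\<^sub>F y in at_left s. turns D i y = turns D i s - (if frac s \<in> fwd D i then 1 else 0)"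
proof -
  have "\<forall>\<^sub>F y in at_left s. \<forall>v\<in>fwd D i. \<lfloor>y - v\<rfloor> = \<lceil>s - v\<rceil> - 1"
    using finite_fwd_bwd(1)[OF D] eventually_floor_at_left by (auto simp: eventually_ball_finite_distrib)
  moreover have "\<forall>\<^sub>F y in at_left s. \<forall>v\<in>bwd D i. \<lceil>y - v\<rceil> = \<lceil>s - v\<rceil>"
    using finite_fwd_bwd(2)[OF D] eventually_ceiling_at_left by (auto simp: eventually_ball_finite_distrib)
  ultimately show ?thesis
  proof eventually_elim
    case (elim y)
    then have "turns D i y = (\<Sum>v\<in>fwd D i. \<lceil>s - v\<rceil> - 1) - (\<Sum>v\<in>bwd D i. \<lceil>s - v\<rceil>)"
      by (simp add: turns_def)
    also have "(\<Sum>v\<in>fwd D i. \<lceil>s - v\<rceil> - 1) = (\<Sum>v\<in>fwd D i. \<lfloor>s - v\<rfloor>) - (if frac s \<in> fwd D i then 1 else 0)"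
      using sum_ceiling_minus_floor[OF finite_fwd_bwd(1,3)[OF D, of i], of s] by (simp add: sum_subtractf)
    finally show ?case by (simp add: turns_def)
  qed
qed

text \<open>\<open>\<lfloor>h s\<rfloor> - turns D i s\<close> is locally constant. Away from the
  arrows h is not an integer; at a forward arrow the floor is one less to the left, at a backward
  arrow one less to the right. This is the source of the asymmetric convention in
  \<open>turns\<close>.\<close>

lemma floor_eq_turns:
  fixes h :: "real \<Rightarrow> real"
  assumes D: "is_arrow_diagram D" and h: "continuous_on UNIV h"
    and int: "\<And>s. h s \<in> \<int> \<longleftrightarrow> (i, frac s) \<in> arrows D"
    and fw: "\<And>s. (i, frac s) \<in> forward D \<Longrightarrow> (\<forall>\<^sub>F t in at_left s. h t < h s) \<and> (\<forall>\<^sub>F t in at_right s. h s < h t)"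
    and bw: "\<And>s. (i, frac s) \<in> backward D \<Longrightarrow> (\<forall>\<^sub>F t in at_left s. h s < h t) \<and> (\<forall>\<^sub>F t in at_right s. h t < h s)"
  obtains m where "\<And>s. \<lfloor>h s\<rfloor> = turns D i s + m"
proof -
  have "\<lfloor>h s\<rfloor> - turns D i s = \<lfloor>h 0\<rfloor> - turns D i 0" for s
  proof (rule connected_local_const[where A = UNIV and f = "\<lambda>s. \<lfloor>h s\<rfloor> - turns D i s"])
    show "\<forall>s\<in>UNIV. \<forall>\<^sub>F t in at s. \<lfloor>h s\<rfloor> - turns D i s = \<lfloor>h t\<rfloor> - turns D i t"
    proof
      fix s
      have lim: "(h \<longlongrightarrow> h s) (at s)" using h by (simp add: continuous_on_def)
      have right: "\<forall>\<^sub>F t in at_right s. turns D i t = turns D i s - (if (i, frac s) \<in> backward D then 1 else 0)"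
        using turns_at_right[OF D, where s = s and i = i] by (simp add: bwd_def)
      have left: "\<forall>\<^sub>F t in at_left s. turns D i t = turns D i s - (if (i, frac s) \<in> forward D then 1 else 0)"
        using turns_at_left[OF D, where s = s and i = i] by (simp add: fwd_def)
      have disj: "\<not> ((i, frac s) \<in> forward D \<and> (i, frac s) \<in> backward D)"
        using D by (auto simp: is_arrow_diagram_def)
      have up: "\<forall>\<^sub>F t in at s. h t < of_int \<lfloor>h s\<rfloor> + 1"
        by (rule order_tendstoD(2)[OF lim]) linarith
      consider "h s \<notin> \<int>" | "(i, frac s) \<in> forward D" "h s \<in> \<int>" | "(i, frac s) \<in> backward D" "h s \<in> \<int>"
        using int[of s] by (auto simp: arrows_def)
      then have "(\<forall>\<^sub>F t in at_left s. \<lfloor>h s\<rfloor> - turns D i s = \<lfloor>h t\<rfloor> - turns D i t) \<and>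
        (\<forall>\<^sub>F t in at_right s. \<lfloor>h s\<rfloor> - turns D i s = \<lfloor>h t\<rfloor> - turns D i t)"
      proof cases
        case 1
        then have na: "(i, frac s) \<notin> forward D" "(i, frac s) \<notin> backward D" using int[of s] by (auto simp: arrows_def)
        have "of_int \<lfloor>h s\<rfloor> \<noteq> h s" using 1 by (metis Ints_of_int)
        then have "\<forall>\<^sub>F t in at s. of_int \<lfloor>h s\<rfloor> < h t"
          by (intro order_tendstoD(1)[OF lim]) linarith
        with up have "\<forall>\<^sub>F t in at s. \<lfloor>h t\<rfloor> = \<lfloor>h s\<rfloor>"
          by eventually_elim (simp add: floor_eq_iff)
        then have "\<forall>\<^sub>F t in at_left s. \<lfloor>h t\<rfloor> = \<lfloor>h s\<rfloor>" "\<forall>\<^sub>F t in at_right s. \<lfloor>h t\<rfloor> = \<lfloor>h s\<rfloor>"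
          by (auto simp: eventually_at_split)
        with left right show ?thesis using na by (auto elim: eventually_elim2)
      next
        case 2
        then obtain n where n: "h s = of_int n" by (auto elim: Ints_cases)
        have "\<forall>\<^sub>F t in at s. of_int n - 1 < h t" by (rule order_tendstoD(1)[OF lim]) (simp add: n)
        then have "\<forall>\<^sub>F t in at_left s. of_int n - 1 < h t" by (simp add: eventually_at_split)
        with left conjunct1[OF fw[OF 2(1)]] have "\<forall>\<^sub>F t in at_left s. \<lfloor>h s\<rfloor> - turns D i s = \<lfloor>h t\<rfloor> - turns D i t"
        proof eventually_elim
          case (elim t)
          then have "\<lfloor>h t\<rfloor> = n - 1" by (simp add: n floor_eq_iff)
          then show ?case using elim 2 by (simp add: n)
        qed
        moreover have "\<forall>\<^sub>F t in at_right s. h t < of_int n + 1" using up by (simp add: eventually_at_split n)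
        with right conjunct2[OF fw[OF 2(1)]] have "\<forall>\<^sub>F t in at_right s. \<lfloor>h s\<rfloor> - turns D i s = \<lfloor>h t\<rfloor> - turns D i t"
        proof eventually_elim
          case (elim t)
          then have "\<lfloor>h t\<rfloor> = n" by (simp add: n floor_eq_iff)
          then show ?case using elim 2 disj by (simp add: n)
        qed
        ultimately show ?thesis ..
      next
        case 3
        then obtain n where n: "h s = of_int n" by (auto elim: Ints_cases)
        have "\<forall>\<^sub>F t in at s. of_int n - 1 < h t" by (rule order_tendstoD(1)[OF lim]) (simp add: n)
        then have "\<forall>\<^sub>F t in at_right s. of_int n - 1 < h t" by (simp add: eventually_at_split)
        with right conjunct2[OF bw[OF 3(1)]] have "\<forall>\<^sub>F t in at_right s. \<lfloor>h s\<rfloor> - turns D i s = \<lfloor>h t\<rfloor> - turns D i t"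
        proof eventually_elim
          case (elim t)
          then have "\<lfloor>h t\<rfloor> = n - 1" by (simp add: n floor_eq_iff)
          then show ?case using elim 3 by (simp add: n)
        qed
        moreover have "\<forall>\<^sub>F t in at_left s. h t < of_int n + 1" using up by (simp add: eventually_at_split n)
        with left conjunct1[OF bw[OF 3(1)]] have "\<forall>\<^sub>F t in at_left s. \<lfloor>h s\<rfloor> - turns D i s = \<lfloor>h t\<rfloor> - turns D i t"
        proof eventually_elim
          case (elim t)
          then have "\<lfloor>h t\<rfloor> = n" by (simp add: n floor_eq_iff)
          then show ?case using elim 3 disj by (simp add: n)
        qed
        ultimately show ?thesis by blast
      qed
      then show "\<forall>\<^sub>F t in at s. \<lfloor>h s\<rfloor> - turns D i s = \<lfloor>h t\<rfloor> - turns D i t"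
        by (simp add: eventually_at_split)
    qed
  qed auto
  then have "\<lfloor>h s\<rfloor> = turns D i s + (\<lfloor>h 0\<rfloor> - turns D i 0)" for s
    by (metis add.commute diff_add_cancel)
  then show thesis by (rule that)
qed


text \<open>
  Only the crossings of the two components matter here, so that after a \<open>k\<close>-move suitable heights
  are found by adding a staircase function. The diagrams in a sequence of moves need not be given
  together with a link that they represent.
\<close>

definition heights_on :: "arrow_diagram \<Rightarrow> nat \<Rightarrow> nat \<Rightarrow> (real \<Rightarrow> real) \<Rightarrow> bool"
  where "heights_on D i j H \<longleftrightarrow> continuous_on UNIV H \<and> (\<forall>s. H (s + 1) = H s + of_int (total_turns D i)) \<and>
    (\<exists>m. \<forall>s t. (curves D ! i) s = (curves D ! j) t \<longrightarrow> \<lfloor>H s\<rfloor> = turns D i s + m)"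

definition heights :: "arrow_diagram \<Rightarrow> nat \<Rightarrow> nat \<Rightarrow> (real \<Rightarrow> real) \<Rightarrow> (real \<Rightarrow> real) \<Rightarrow> bool"
  where "heights D i j H K \<longleftrightarrow> heights_on D i j H \<and> heights_on D j i K \<and>
    (\<forall>s t. ((i, frac s), (j, frac t)) \<in> over D \<longrightarrow> frac (K t) < frac (H s)) \<and>
    (\<forall>s t. ((j, frac t), (i, frac s)) \<in> over D \<longrightarrow> frac (H s) < frac (K t))"

definition lift :: "arrow_diagram \<Rightarrow> nat \<Rightarrow> (real \<Rightarrow> real) \<Rightarrow> real \<Rightarrow> complex \<times> complex"
  where "lift D i H = (\<lambda>s. torus_embed ((curves D ! i) s) (H s))"

lemma curves_props:
  assumes "is_arrow_diagram D" "i < length (curves D)"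
  shows "continuous_on UNIV (curves D ! i)" "(curves D ! i) (s + 1) = (curves D ! i) s"
    "(curves D ! i) (frac s) = (curves D ! i) s"
proof -
  have r: "regular_closed_curve (curves D ! i)"
    using assms by (auto simp: is_arrow_diagram_def)
  then obtain F where F: "F 0 = curves D ! i" "\<And>n s. (F n has_vector_derivative F (Suc n) s) (at s)"
    by (auto simp: regular_closed_curve_def smooth_curve_def)
  show "continuous_on UNIV (curves D ! i)"
    unfolding F(1)[symmetric] continuous_on_eq_continuous_at[OF open_UNIV]
    using F(2)[of 0] by (blast intro: has_vector_derivative_continuous)
  show per: "(curves D ! i) (s + 1) = (curves D ! i) s" for s
    using r by (simp add: regular_closed_curve_def)
  show "(curves D ! i) (frac s) = (curves D ! i) s"
    using periodic_of_int[of "curves D ! i", OF per, of "frac s" "\<lfloor>s\<rfloor>"] by (simp add: frac_def)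
qed

lemma crossing_if_eq:
  assumes D: "is_arrow_diagram D" "i < length (curves D)" "j < length (curves D)" "i \<noteq> j"
    and eq: "(curves D ! i) s = (curves D ! j) t"
  shows "crossing D (i, frac s) (j, frac t)"
  using assms curves_props(3)[OF D(1,2), of s] curves_props(3)[OF D(1,3), of t]
  by (simp add: crossing_def places_def location_def frac_lt_1)

lemma over_cases:
  assumes D: "is_arrow_diagram D" "i < length (curves D)" "j < length (curves D)" "i \<noteq> j"
    and eq: "(curves D ! i) s = (curves D ! j) t"
  shows "((i, frac s), (j, frac t)) \<in> over D \<or> ((j, frac t), (i, frac s)) \<in> over D"
  using crossing_if_eq[OF assms] D(1) unfolding is_arrow_diagram_def by blast

lemma heights_commute: "heights D i j H K \<Longrightarrow> heights D j i K H"
  by (simp add: heights_def)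

lemma closed_curve_lift:
  assumes "is_arrow_diagram D" "i < length (curves D)" "heights_on D i j H"
  shows "closed_curve (lift D i H)"
  unfolding closed_curve_def lift_def
proof (intro conjI allI)
  show "continuous_on UNIV (\<lambda>s. torus_embed ((curves D ! i) s) (H s))"
    using curves_props(1)[OF assms(1,2)] assms(3) by (intro continuous_on_torus_embed) (auto simp: heights_on_def)
  show "torus_embed ((curves D ! i) s) (H s) \<in> S3" for s by (rule torus_embed_in_S3)
  show "torus_embed ((curves D ! i) (s + 1)) (H (s + 1)) = torus_embed ((curves D ! i) s) (H s)" for s
    unfolding curves_props(2)[OF assms(1,2)]
    using assms(3) by (intro torus_embed_eqI[where n = "total_turns D i"]) (simp add: heights_on_def)
qed

text \<open>The fractional parts differ by less than 1, with the sign fixed by the over-strand. So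
  the interval between integers that contains \<open>H s - K t\<close> depends only on the floors
  and the crossing information.\<close>

lemma heights_diff:
  assumes D: "is_arrow_diagram D" "i < length (curves D)" "j < length (curves D)" "i \<noteq> j"
    and H: "heights D i j H K" and eq: "(curves D ! i) s = (curves D ! j) t"
  shows "((i, frac s), (j, frac t)) \<in> over D \<Longrightarrow> of_int (\<lfloor>H s\<rfloor> - \<lfloor>K t\<rfloor>) < H s - K t \<and> H s - K t < of_int (\<lfloor>H s\<rfloor> - \<lfloor>K t\<rfloor>) + 1"
    and "((i, frac s), (j, frac t)) \<notin> over D \<Longrightarrow> of_int (\<lfloor>H s\<rfloor> - \<lfloor>K t\<rfloor> - 1) < H s - K t \<and> H s - K t < of_int (\<lfloor>H s\<rfloor> - \<lfloor>K t\<rfloor> - 1) + 1"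
proof -
  have f: "frac (H s) = H s - of_int \<lfloor>H s\<rfloor>" "frac (K t) = K t - of_int \<lfloor>K t\<rfloor>" by (simp_all add: frac_def)
  have b: "0 \<le> frac (H s)" "frac (H s) < 1" "0 \<le> frac (K t)" "frac (K t) < 1" by (simp_all add: frac_lt_1)
  show "of_int (\<lfloor>H s\<rfloor> - \<lfloor>K t\<rfloor>) < H s - K t \<and> H s - K t < of_int (\<lfloor>H s\<rfloor> - \<lfloor>K t\<rfloor>) + 1"
    if "((i, frac s), (j, frac t)) \<in> over D"
  proof -
    have "frac (K t) < frac (H s)" using H that by (simp add: heights_def)
    then show ?thesis using f b unfolding of_int_diff of_int_1 by linarith
  qed
  show "of_int (\<lfloor>H s\<rfloor> - \<lfloor>K t\<rfloor> - 1) < H s - K t \<and> H s - K t < of_int (\<lfloor>H s\<rfloor> - \<lfloor>K t\<rfloor> - 1) + 1"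
    if "((i, frac s), (j, frac t)) \<notin> over D"
  proof -
    have "frac (H s) < frac (K t)" using over_cases[OF D eq] H that by (simp add: heights_def)
    then show ?thesis using f b unfolding of_int_diff of_int_1 by linarith
  qed
qed

lemma heights_not_int:
  assumes D: "is_arrow_diagram D" "i < length (curves D)" "j < length (curves D)" "i \<noteq> j"
    and H: "heights D i j H K" and eq: "(curves D ! i) s = (curves D ! j) t"
  shows "H s - K t \<notin> \<int>"
proof
  assume "H s - K t \<in> \<int>"
  then obtain n :: int where n: "H s - K t = of_int n" by (auto elim: Ints_cases)
  have "\<exists>l::int. of_int l < (of_int n :: real) \<and> (of_int n :: real) < of_int (l + 1)"
    using heights_diff[OF D H eq] unfolding n by (metis of_int_1 of_int_add)
  then obtain l :: int where "l < n" "n < l + 1" by (simp only: of_int_less_iff) blast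
  then show False by linarith
qed

lemma lifts_ne:
  assumes D: "is_arrow_diagram D" "i < length (curves D)" "j < length (curves D)" "i \<noteq> j"
    and H: "heights D i j H K"
  shows "lift D i H s \<noteq> lift D j K t"
  using heights_not_int[OF assms, of s t] by (auto simp: lift_def torus_embed_eq_iff)

text \<open>By \<open>heights_on\<close> the floors over common points agree up to additive
  constants. Integer shifts, invisible in the sphere, remove the constants, and
  \<open>heights_diff\<close> puts both height differences into the same interval.\<close>

lemma lk_lift_unique:
  assumes D: "is_arrow_diagram D" "i < length (curves D)" "j < length (curves D)" "i \<noteq> j"
    and H: "heights D i j H K" and H': "heights D i j H' K'"
  shows "lk (lift D i H) (lift D j K) = lk (lift D i H') (lift D j K')"
proof -
  have on: "heights_on D i j H" "heights_on D j i K" "heights_on D i j H'" "heights_on D j i K'"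
    using H H' by (auto simp: heights_def)
  obtain m where m: "\<And>s t. (curves D ! i) s = (curves D ! j) t \<Longrightarrow> \<lfloor>H s\<rfloor> = turns D i s + m"
    using on(1) by (auto simp: heights_on_def)
  obtain m' where m': "\<And>s t. (curves D ! i) s = (curves D ! j) t \<Longrightarrow> \<lfloor>H' s\<rfloor> = turns D i s + m'"
    using on(3) by (auto simp: heights_on_def)
  obtain l where l: "\<And>s t. (curves D ! j) s = (curves D ! i) t \<Longrightarrow> \<lfloor>K s\<rfloor> = turns D j s + l"
    using on(2) by (auto simp: heights_on_def)
  obtain l' where l': "\<And>s t. (curves D ! j) s = (curves D ! i) t \<Longrightarrow> \<lfloor>K' s\<rfloor> = turns D j s + l'"
    using on(4) by (auto simp: heights_on_def)
  have cont: "continuous_on {0..1} (curves D ! i)" "continuous_on {0..1} (curves D ! j)"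
    "continuous_on {0..1} H" "continuous_on {0..1} H'" "continuous_on {0..1} K" "continuous_on {0..1} K'"
    using on curves_props(1)[OF D(1,2)] curves_props(1)[OF D(1,3)]
    by (auto simp: heights_on_def intro: continuous_on_subset)
  have per: "H 1 = H 0 + of_int (total_turns D i)" "H' 1 = H' 0 + of_int (total_turns D i)"
    "K 1 = K 0 + of_int (total_turns D j)" "K' 1 = K' 0 + of_int (total_turns D j)"
    using on unfolding heights_on_def by (metis add_0)+
  have c01: "(curves D ! i) 0 = (curves D ! i) 1" "(curves D ! j) 0 = (curves D ! j) 1"
    using curves_props(2)[OF D(1,2), of 0] curves_props(2)[OF D(1,3), of 0] by simp_all
  have "lk (\<lambda>s. torus_embed ((curves D ! i) s) (H s)) (\<lambda>t. torus_embed ((curves D ! j) t) (K t)) =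
      lk (\<lambda>s. torus_embed ((curves D ! i) s) (H' s + of_int (m - m'))) (\<lambda>t. torus_embed ((curves D ! j) t) (K' t + of_int (l - l')))"
  proof (rule lk_heights[where n = "total_turns D i" and m = "total_turns D j"])
    fix s t assume eq: "(curves D ! i) s = (curves D ! j) t"
    have fl: "\<lfloor>H s\<rfloor> = \<lfloor>H' s\<rfloor> + (m - m')" "\<lfloor>K t\<rfloor> = \<lfloor>K' t\<rfloor> + (l - l')"
      using m[OF eq] m'[OF eq] l[OF eq[symmetric]] l'[OF eq[symmetric]] by simp_all
    show "\<exists>q::int. of_int q < H s - K t \<and> H s - K t < of_int q + 1 \<and>
        of_int q < H' s + of_int (m - m') - (K' t + of_int (l - l')) \<and> H' s + of_int (m - m') - (K' t + of_int (l - l')) < of_int q + 1"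
    proof (cases "((i, frac s), (j, frac t)) \<in> over D")
      case True
      then show ?thesis
        using heights_diff(1)[OF D H eq True] heights_diff(1)[OF D H' eq True]
        by (intro exI[of _ "\<lfloor>H s\<rfloor> - \<lfloor>K t\<rfloor>"]) (simp add: fl)
    next
      case False
      then show ?thesis
        using heights_diff(2)[OF D H eq False] heights_diff(2)[OF D H' eq False]
        by (intro exI[of _ "\<lfloor>H s\<rfloor> - \<lfloor>K t\<rfloor> - 1"]) (simp add: fl)
    qed
  qed (use cont per c01 in \<open>auto intro!: continuous_intros\<close>)
  then show ?thesis by (simp only: lift_def torus_embed_add_int)
qed

text \<open>The lift in \<open>represents\<close> changes by some integer over a period because the
  component closes up. Comparing floors with \<open>turns_add_1\<close> identifies this integer as
  \<open>total_turns\<close>.\<close>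

lemma represents_heights:
  assumes R: "represents D L" and ij: "i < length L" "j < length L" "i \<noteq> j"
  obtains H K where "heights D i j H K" "L ! i = lift D i H" "L ! j = lift D j K"
proof -
  have D: "is_arrow_diagram D" and len: "length L = length (curves D)" and L: "is_link L"
    using R by (auto simp: represents_def)
  obtain h where h: "\<And>i. i < length L \<Longrightarrow> continuous_on UNIV (h i)"
      "\<And>i s. i < length L \<Longrightarrow> (L ! i) s = torus_embed ((curves D ! i) s) (h i s)"
      "\<And>i s. i < length L \<Longrightarrow> h i s \<in> \<int> \<longleftrightarrow> (i, frac s) \<in> arrows D"
      "\<And>i s. i < length L \<Longrightarrow> (i, frac s) \<in> forward D \<Longrightarrow>
          (\<forall>\<^sub>F t in at_left s. h i t < h i s) \<and> (\<forall>\<^sub>F t in at_right s. h i s < h i t)"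
      "\<And>i s. i < length L \<Longrightarrow> (i, frac s) \<in> backward D \<Longrightarrow>
          (\<forall>\<^sub>F t in at_left s. h i s < h i t) \<and> (\<forall>\<^sub>F t in at_right s. h i t < h i s)"
      and over: "\<And>i s j t. ((i, s), (j, t)) \<in> over D \<Longrightarrow> frac (h j t) < frac (h i s)"
    using R unfolding represents_def by blast
  have Lper: "(L ! i) (s + 1) = (L ! i) s" if "i < length L" for i s
    using L that by (auto simp: is_link_def regular_closed_curve_def)
  \<comment> \<open>\<open>over\<close> refers to places with parameters in the half-open unit
    interval, \<open>heights\<close> to all parameters.\<close>
  have fracs: "frac (h i (frac s)) = frac (h i s)" if i: "i < length L" for i s
  proof -
    have "(L ! i) (frac s) = (L ! i) s"
      using periodic_of_int[of "L ! i", OF Lper[OF i], of "frac s" "\<lfloor>s\<rfloor>"] by (simp add: frac_def)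
    then have "h i (frac s) - h i s \<in> \<int>" by (simp add: h(2)[OF i] torus_embed_eq_iff)
    then obtain n :: int where "h i (frac s) = h i s + of_int n" by (auto elim!: Ints_cases simp: algebra_simps)
    then show ?thesis by (simp add: frac_def)
  qed
  have on: "heights_on D i j (h i)" if i: "i < length L" for i j
  proof -
    obtain m where m: "\<And>s. \<lfloor>h i s\<rfloor> = turns D i s + m"
      using floor_eq_turns[OF D h(1,3,4,5)[OF i]] by blast
    have "h i (s + 1) = h i s + of_int (total_turns D i)" for s
    proof -
      have "h i (s + 1) - h i s \<in> \<int>"
        using Lper[OF i, of s] by (simp add: h(2)[OF i] torus_embed_eq_iff)
      then obtain n :: int where n: "h i (s + 1) = h i s + of_int n" by (auto elim!: Ints_cases simp: algebra_simps)
      then have "\<lfloor>h i (s + 1)\<rfloor> = \<lfloor>h i s\<rfloor> + n" by simp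
      then have "n = total_turns D i" using m[of s] m[of "s + 1"] turns_add_1[OF D, of i s] by simp
      then show ?thesis using n by simp
    qed
    then show ?thesis using h(1)[OF i] m by (auto simp: heights_on_def)
  qed
  have "heights D i j (h i) (h j)"
    unfolding heights_def using on ij over fracs by metis
  moreover have "L ! i = lift D i (h i)" "L ! j = lift D j (h j)"
    using h(2) ij by (auto simp: lift_def fun_eq_iff)
  ultimately show thesis by (rule that)
qed


lemma continuous_on_staircase:
  fixes w :: real
  assumes "0 < w" "w < 1"
  shows "continuous_on UNIV (\<lambda>x. of_int \<lfloor>x\<rfloor> + min 1 (frac x / w))"
  unfolding continuous_on_def
proof
  fix x :: real
  let ?g = "\<lambda>x. of_int \<lfloor>x\<rfloor> + min 1 (frac x / w)"
  have "(?g \<longlongrightarrow> ?g x) (at_right x)"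
  proof (rule Lim_transform_eventually)
    show "((\<lambda>y. of_int \<lfloor>x\<rfloor> + min 1 ((y - of_int \<lfloor>x\<rfloor>) / w)) \<longlongrightarrow> ?g x) (at_right x)"
      using assms by (auto intro!: tendsto_eq_intros simp: frac_def)
    show "\<forall>\<^sub>F y in at_right x. of_int \<lfloor>x\<rfloor> + min 1 ((y - of_int \<lfloor>x\<rfloor>) / w) = ?g y"
      using eventually_floor_at_right[of 0 x] by eventually_elim (simp add: frac_def)
  qed
  moreover have "(?g \<longlongrightarrow> ?g x) (at_left x)"
  proof (rule Lim_transform_eventually)
    \<comment> \<open>The floor immediately to the left of x. At an integer x the ramp of the
      preceding step has already reached 1.\<close>
    define k where "k = \<lceil>x\<rceil> - 1"
    have "of_int k + min 1 ((x - of_int k) / w) = ?g x"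
    proof (cases "x \<in> \<int>")
      case True
      then obtain n :: int where "x = of_int n" by (auto elim: Ints_cases)
      then show ?thesis using assms by (simp add: k_def min_absorb1)
    next
      case False
      then have "k = \<lfloor>x\<rfloor>" by (auto simp: k_def ceiling_altdef) (metis Ints_of_int)
      then show ?thesis by (simp add: frac_def)
    qed
    then show "((\<lambda>y. of_int k + min 1 ((y - of_int k) / w)) \<longlongrightarrow> ?g x) (at_left x)"
      using assms by (auto intro!: tendsto_eq_intros)
    show "\<forall>\<^sub>F y in at_left x. of_int k + min 1 ((y - of_int k) / w) = ?g y"
      using eventually_floor_at_left[of 0 x] by eventually_elim (simp add: frac_def k_def)
  qed
  ultimately show "(?g \<longlongrightarrow> ?g x) (at x within UNIV)"
    by (simp add: filterlim_at_split)
qed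

text \<open>\<open>H'\<close> adds to H a staircase that gains e at each passage of the strand and
  is constant elsewhere. Over points shared with the other curve it is an integer, so the
  over-strands persist and only the count of turns changes. N is the linking number of the fibre
  over \<open>c a\<close> with the other component.\<close>

lemma lk_lift_move:
  assumes D: "is_arrow_diagram D" "i < length (curves D)" "j < length (curves D)" "i \<noteq> j"
    and D': "is_arrow_diagram D'" "curves D' = curves D" "over D' = over D"
    and H: "heights D i j H K"
    and j: "turns D' j = turns D j" "total_turns D' j = total_turns D j"
    and i: "total_turns D' i = total_turns D i + e"
    and ab: "a \<le> b" "b < a + 1" and free: "\<And>s t. s \<in> {a..b} \<Longrightarrow> (curves D ! i) s \<noteq> (curves D ! j) t"
    and turn: "\<And>s. (\<And>u. u \<in> {a..b} \<Longrightarrow> s - u \<notin> \<int>) \<Longrightarrow> turns D' i s = turns D i s + e * \<lfloor>s - a\<rfloor> + z"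
  obtains H' N where "heights D' i j H' K" "lk (lift D' i H') (lift D' j K) = lk (lift D i H) (lift D j K) + of_int (e * N)"
proof -
  define c d where "c = curves D ! i" and "d = curves D ! j"
  have c: "continuous_on UNIV c" "\<And>s. c (s + 1) = c s" and d: "continuous_on UNIV d" "\<And>s. d (s + 1) = d s"
    and d_frac: "\<And>s. d (frac s) = d s"
    using curves_props[OF D(1,2)] curves_props[OF D(1,3)] by (auto simp: c_def d_def)
  have on: "heights_on D i j H" "heights_on D j i K" using H by (auto simp: heights_def)
  have Hc: "continuous_on UNIV H" "\<And>s. H (s + 1) = H s + of_int (total_turns D i)"
    and Kc: "continuous_on UNIV K" "\<And>s. K (s + 1) = K s + of_int (total_turns D j)"
    using on by (auto simp: heights_on_def)
  have range_d: "range d = d ` {0..1}"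
  proof -
    have "d t \<in> d ` {0..1}" for t
      using d_frac[of t, symmetric] by (auto simp: frac_lt_1 less_imp_le)
    then show ?thesis by auto
  qed
  have "compact (d ` {0..1})"
    using d(1) by (intro compact_continuous_image) (auto intro: continuous_on_subset)
  then have "open (- range d)" unfolding range_d by (auto intro: compact_imp_closed)
  then have "open (c -` (- range d))" using c(1) by (intro open_vimage) auto
  moreover have "b \<in> c -` (- range d)" using free[of b] ab by (auto simp: c_def d_def)
  ultimately obtain \<epsilon> where \<epsilon>0: "\<epsilon> > 0" "\<forall>s. dist s b < \<epsilon> \<longrightarrow> s \<in> c -` (- range d)"
    unfolding open_dist by blast
  then have \<epsilon>: "\<epsilon> > 0" "\<And>s. dist s b < \<epsilon> \<Longrightarrow> c s \<notin> range d" by auto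
  \<comment> \<open>The strand may be a single point, but a ramp needs positive length. Compactness
    of the other curve leaves the room \<epsilon> beyond b, and taking at most half of the gap to
    \<open>a + 1\<close> keeps w below 1.\<close>
  define w where "w = b - a + min (\<epsilon> / 2) ((a + 1 - b) / 2)"
  have w: "0 < w" "w < 1" "a + w - b < \<epsilon>" "b < a + w"
    using ab \<epsilon>(1) by (auto simp: w_def min_def field_simps)
  have free': "c s \<notin> range d" if "s \<in> {a..a + w}" for s
  proof (cases "s \<le> b")
    case True
    then show ?thesis using free[of s] that by (auto simp: c_def d_def)
  next
    case False
    then show ?thesis using that w by (intro \<epsilon>(2)) (auto simp: dist_real_def)
  qed
  define g where "g = (\<lambda>x. of_int \<lfloor>x\<rfloor> + min 1 (frac x / w))"
  have g1: "g (x + 1) = g x + 1" for x by (simp add: g_def frac_def)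
  define H' where "H' = (\<lambda>s. H s + of_int e * g (s - a))"
  have far: "frac (s - a) > w" if "c s \<in> range d" for s
  proof (rule ccontr)
    assume "\<not> w < frac (s - a)"
    then have "s + of_int (- \<lfloor>s - a\<rfloor>) \<in> {a..a + w}"
      by (simp add: frac_def) linarith
    then have "c (s + of_int (- \<lfloor>s - a\<rfloor>)) \<notin> range d" by (rule free')
    then show False using that periodic_of_int[of c, OF c(2)] by metis
  qed
  \<comment> \<open>Over common points the ramp of the current step is finished, hence the summand
    1; it reappears as e in the constant \<open>m + e - z\<close> below.\<close>
  have H'_meet: "H' s = H s + of_int (e * (\<lfloor>s - a\<rfloor> + 1))" if "c s \<in> range d" for s
    using far[OF that] w(1) by (simp add: H'_def g_def)
  have turn_meet: "turns D' i s = turns D i s + e * \<lfloor>s - a\<rfloor> + z" if "c s \<in> range d" for s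
  proof (rule turn)
    fix u assume u: "u \<in> {a..b}"
    show "s - u \<notin> \<int>"
    proof
      assume "s - u \<in> \<int>"
      then obtain n :: int where n: "s = u + of_int n" by (auto elim!: Ints_cases simp: algebra_simps)
      then have "c s = c u" using periodic_of_int[of c, OF c(2)] by metis
      moreover have "c u \<notin> range d" using free[of u] u by (auto simp: c_def d_def)
      ultimately show False using that by simp
    qed
  qed
  have H'_on: "heights_on D' i j H'"
    unfolding heights_on_def
  proof (intro conjI allI)
    have "continuous_on UNIV (\<lambda>s. g (s - a))"
      unfolding g_def
      by (rule continuous_on_compose_intro[OF continuous_on_staircase[OF w(1,2)]]) (auto intro: continuous_intros)
    then show "continuous_on UNIV H'" unfolding H'_def by (intro continuous_intros Hc(1))
    have shift: "s + 1 - a = (s - a) + 1" for s by simp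
    show "H' (s + 1) = H' s + of_int (total_turns D' i)" for s
      unfolding H'_def Hc(2) shift g1 i by (simp add: distrib_left)
    obtain m where m: "\<And>s t. c s = d t \<Longrightarrow> \<lfloor>H s\<rfloor> = turns D i s + m"
      using on(1) by (auto simp: heights_on_def c_def d_def)
    have "\<lfloor>H' s\<rfloor> = turns D' i s + (m + e - z)" if "c s = d t" for s t
    proof -
      have "c s \<in> range d" using that by simp
      then have "\<lfloor>H' s\<rfloor> = \<lfloor>H s\<rfloor> + e * (\<lfloor>s - a\<rfloor> + 1)" unfolding H'_meet[OF \<open>c s \<in> range d\<close>] by (simp only: floor_add_int)
      then show ?thesis unfolding m[OF that] turn_meet[OF \<open>c s \<in> range d\<close>] by (simp add: algebra_simps)
    qed
    then show "\<exists>m. \<forall>s t. (curves D' ! i) s = (curves D' ! j) t \<longrightarrow> \<lfloor>H' s\<rfloor> = turns D' i s + m"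
      unfolding D'(2) c_def[symmetric] d_def[symmetric] by blast
  qed
  have K_on: "heights_on D' j i K"
    using on(2) unfolding heights_on_def D'(2) j .
  have meet: "c s \<in> range d" if "((i, frac s), (j, frac t)) \<in> over D \<or> ((j, frac t), (i, frac s)) \<in> over D" for s t
  proof -
    have "crossing D (i, frac s) (j, frac t) \<or> crossing D (j, frac t) (i, frac s)"
      using that D(1) unfolding is_arrow_diagram_def by blast
    then have "c (frac s) = d (frac t)" by (auto simp: crossing_def location_def c_def d_def)
    moreover have "c (frac s) = c s" using curves_props(3)[OF D(1,2)] by (simp add: c_def)
    ultimately show ?thesis by (metis rangeI)
  qed
  have frac_H': "frac (H' s) = frac (H s)" if "c s \<in> range d" for s
    unfolding H'_meet[OF that] frac_def by (simp only: floor_add_int[symmetric] of_int_add)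
  have heights': "heights D' i j H' K"
    using H H'_on K_on meet frac_H' unfolding heights_def D'(3) by metis
  obtain N where N: "lk (\<lambda>s. torus_embed (c a) s) (\<lambda>t. torus_embed (d t) (K t)) = of_int N"
  proof (rule lk_fibre_integer)
    show "continuous_on {0..1} d" "continuous_on {0..1} K"
      using d(1) Kc(1) by (auto intro: continuous_on_subset)
    show "d 0 = d 1" using d(2)[of 0] by simp
    show "d t \<noteq> c a" for t using free'[of a] w by (metis atLeastAtMost_iff le_add_same_cancel1 less_imp_le order_refl rangeI)
    show "K 1 = K 0 + of_int (total_turns D j)" using Kc(2)[of 0] by simp
  qed
  have cc: "closed_curve (lift D i H)" "closed_curve (lift D' i H')" "closed_curve (lift D j K)"
    using closed_curve_lift[OF D(1,2) on(1)] closed_curve_lift[OF D'(1) _ H'_on] closed_curve_lift[OF D(1,3) on(2)] D(2) D'(2)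
    by simp_all
  have liftK: "lift D' j K = lift D j K" by (simp add: lift_def D'(2))
  note lK = closed_curve_loop[OF cc(3)]
  \<comment> \<open>The parameter is shifted to start at a, the foot of the ramp, as
    \<open>lk_insert_fibres\<close> expects.\<close>
  have "lk (lift D' i H') (lift D j K) = lk (\<lambda>s. lift D' i H' (a + s)) (lift D j K)"
  proof (rule lk_reparam[where \<phi> = "\<lambda>s. s" and d = 1, OF cc(2) lK])
    show "lift D' i H' s \<noteq> lift D j K t" for s t
      using lifts_ne[OF D'(1) _ _ D(4) heights'] D(2,3) D'(2) liftK by metis
  qed (auto intro!: continuous_intros)
  also have "\<dots> = lk (\<lambda>s. torus_embed (c (a + s)) (H (a + s) + of_int e * min 1 (s / w))) (\<lambda>t. torus_embed (d t) (K t))"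
  proof (rule lk_cong)
    fix s :: real assume s: "s \<in> {0..1}"
    have "g s = min 1 (s / w)"
    proof (cases "s = 1")
      case True
      then show ?thesis using w by (simp add: g_def)
    next
      case False
      then have "\<lfloor>s\<rfloor> = 0" using s by (simp add: floor_eq_iff)
      then show ?thesis by (simp add: g_def frac_def)
    qed
    then show "lift D' i H' (a + s) = torus_embed (c (a + s)) (H (a + s) + of_int e * min 1 (s / w))"
      by (simp add: lift_def D'(2) c_def H'_def)
  qed (simp add: lift_def d_def)
  also have "\<dots> = lk (\<lambda>s. torus_embed (c (a + s)) (H (a + s))) (\<lambda>t. torus_embed (d t) (K t)) +
    of_int e * lk (\<lambda>s. torus_embed (c a) s) (\<lambda>t. torus_embed (d t) (K t))"
  proof (rule lk_insert_fibres[OF c Hc _ _ _ _ w(1,2)])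
    show "continuous_on {0..1} d" "continuous_on {0..1} K"
      using d(1) Kc(1) by (auto intro: continuous_on_subset)
    show "d 0 = d 1" "K 1 = K 0 + of_int (total_turns D j)" using d(2)[of 0] Kc(2)[of 0] by simp_all
    show "c s \<noteq> d t" if "s \<in> {a..a + w}" for s t using free'[OF that] by (metis rangeI)
    show "H s - K t \<notin> \<int>" if "c s = d t" for s t
      using heights_not_int[OF D H] that by (simp add: c_def d_def)
  qed
  also have "lk (\<lambda>s. torus_embed (c (a + s)) (H (a + s))) (\<lambda>t. torus_embed (d t) (K t)) = lk (\<lambda>s. lift D i H (a + s)) (lift D j K)"
    by (simp add: lift_def c_def d_def)
  also have "\<dots> = lk (lift D i H) (lift D j K)"
    by (rule lk_reparam[where \<psi> = "\<lambda>s. s" and d = 1, OF cc(1) lK lifts_ne[OF D H]]) (auto intro!: continuous_intros)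
  finally have "lk (lift D' i H') (lift D' j K) = lk (lift D i H) (lift D j K) + of_int (e * N)"
    unfolding liftK N by simp
  with heights' show thesis by (rule that)
qed

section \<open>Moves and isotopies\<close>

text \<open>A k-move as seen by \<open>turns\<close>. The relation is symmetric, removal negating e
  and z, and forward and backward arrows differ in the sign of e. Parameters congruent to the strand
  are excluded because there \<open>turns\<close> depends on the exact positions of the
  arrows.\<close>

definition arrow_change :: "nat \<Rightarrow> arrow_diagram \<Rightarrow> arrow_diagram \<Rightarrow> bool"
  where "arrow_change k D D' \<longleftrightarrow> is_arrow_diagram D \<and> is_arrow_diagram D' \<and> curves D' = curves D \<and> over D' = over D \<and>
    (\<exists>i a b e z. a \<le> b \<and> b < a + 1 \<and> (\<forall>s\<in>{a..b}. \<forall>q. \<not> crossing D (i, frac s) q) \<and> int k dvd e \<and>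
      total_turns D' i = total_turns D i + e \<and>
      (\<forall>s. (\<forall>u\<in>{a..b}. s - u \<notin> \<int>) \<longrightarrow> turns D' i s = turns D i s + e * \<lfloor>s - a\<rfloor> + z) \<and>
      (\<forall>j. j \<noteq> i \<longrightarrow> turns D' j = turns D j \<and> total_turns D' j = total_turns D j))"

lemma arrow_changeI:
  assumes "is_arrow_diagram D" "is_arrow_diagram D'" "curves D' = curves D" "over D' = over D"
    and "a \<le> b" "b < a + 1" "\<forall>s\<in>{a..b}. \<forall>q. \<not> crossing D (i, frac s) q" "int k dvd e"
      "total_turns D' i = total_turns D i + e"
      "\<forall>s. (\<forall>u\<in>{a..b}. s - u \<notin> \<int>) \<longrightarrow> turns D' i s = turns D i s + e * \<lfloor>s - a\<rfloor> + z"
      "\<forall>j. j \<noteq> i \<longrightarrow> turns D' j = turns D j \<and> total_turns D' j = total_turns D j"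
  shows "arrow_change k D D'"
  unfolding arrow_change_def using assms by blast

lemma arrow_change_sym:
  assumes "arrow_change k D D'"
  shows "arrow_change k D' D"
proof -
  obtain i a b e z where D: "is_arrow_diagram D" "is_arrow_diagram D'" "curves D' = curves D" "over D' = over D"
    and ab: "a \<le> b" "b < a + 1" "\<forall>s\<in>{a..b}. \<forall>q. \<not> crossing D (i, frac s) q" "int k dvd e"
      "total_turns D' i = total_turns D i + e"
      "\<forall>s. (\<forall>u\<in>{a..b}. s - u \<notin> \<int>) \<longrightarrow> turns D' i s = turns D i s + e * \<lfloor>s - a\<rfloor> + z"
      "\<forall>j. j \<noteq> i \<longrightarrow> turns D' j = turns D j \<and> total_turns D' j = total_turns D j"
    using assms unfolding arrow_change_def by blast
  have cr: "crossing D' = crossing D"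
    by (simp add: fun_eq_iff crossing_def places_def location_def D(3))
  show ?thesis
  proof (rule arrow_changeI)
    show "\<forall>s\<in>{a..b}. \<forall>q. \<not> crossing D' (i, frac s) q" unfolding cr by (rule ab(3))
    show "\<forall>s. (\<forall>u\<in>{a..b}. s - u \<notin> \<int>) \<longrightarrow> turns D i s = turns D' i s + - e * \<lfloor>s - a\<rfloor> + - z"
      using ab(6) by simp
  qed (use D ab in auto)
qed

text \<open>Since b < a + 1, reduction modulo 1 keeps the k new arrows distinct. At a parameter not
  congruent to any on the strand, all of them have been passed equally often, namely as often as
  a.\<close>

lemma adds_arrows_change:
  assumes "adds_arrows k D D'"
  shows "arrow_change k D D'"
proof -
  obtain i a b S where D: "is_arrow_diagram D" "is_arrow_diagram D'"
    and ab: "a \<le> b" "b < a + 1" "S \<subseteq> {a..b}" "finite S" "card S = k"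
    and free: "\<forall>s\<in>{a..b}. \<forall>q. \<not> crossing D (i, frac s) q" and new: "\<forall>s\<in>S. (i, frac s) \<notin> arrows D"
    and D': "D' = D\<lparr>forward := forward D \<union> (\<lambda>s. (i, frac s)) ` S\<rparr> \<or> D' = D\<lparr>backward := backward D \<union> (\<lambda>s. (i, frac s)) ` S\<rparr>"
    using assms unfolding adds_arrows_def Let_def by blast
  define A where "A = frac ` S"
  have inj: "inj_on frac S"
  proof (rule inj_onI)
    fix u v assume uv: "u \<in> S" "v \<in> S" "frac u = frac v"
    then have "u - v = of_int (\<lfloor>u\<rfloor> - \<lfloor>v\<rfloor>)" by (simp add: frac_def)
    moreover have "u \<in> {a..b}" "v \<in> {a..b}" using uv ab(3) by blast+
    then have "\<bar>u - v\<bar> < 1" using ab(2) by auto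
    ultimately have "\<lfloor>u\<rfloor> - \<lfloor>v\<rfloor> = 0" by linarith
    then show "u = v" using \<open>u - v = _\<close> by simp
  qed
  have A: "finite A" "card A = k" using ab inj by (auto simp: A_def card_image)
  have disj: "A \<inter> fwd D i = {}" "A \<inter> bwd D i = {}"
    using new by (auto simp: A_def fwd_def bwd_def arrows_def)
  note fin = finite_fwd_bwd(1,2)[OF D(1)]
  have sub: "\<lfloor>s - frac u\<rfloor> = \<lfloor>s - u\<rfloor> + \<lfloor>u\<rfloor>" "\<lceil>s - frac u\<rceil> = \<lceil>s - u\<rceil> + \<lfloor>u\<rfloor>" for s u
  proof -
    have e: "s - frac u = (s - u) + of_int \<lfloor>u\<rfloor>" by (simp add: frac_def)
    show "\<lfloor>s - frac u\<rfloor> = \<lfloor>s - u\<rfloor> + \<lfloor>u\<rfloor>" unfolding e by (simp only: floor_add_int)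
    show "\<lceil>s - frac u\<rceil> = \<lceil>s - u\<rceil> + \<lfloor>u\<rfloor>" unfolding e by (rule ceiling_add_of_int)
  qed
  \<comment> \<open>Otherwise an integer would separate s - u from s - a, and s would be congruent
    to a parameter of the strand.\<close>
  have gap: "\<lfloor>s - u\<rfloor> = \<lfloor>s - a\<rfloor>" "\<lceil>s - u\<rceil> = \<lfloor>s - a\<rfloor> + 1"
    if s: "\<forall>u\<in>{a..b}. s - u \<notin> \<int>" and u: "u \<in> S" for s u
  proof -
    have u': "a \<le> u" "u \<le> b" using u ab(3) by auto
    have "\<not> s - u < of_int \<lfloor>s - a\<rfloor>"
    proof
      assume "s - u < of_int \<lfloor>s - a\<rfloor>"
      then have "s - of_int \<lfloor>s - a\<rfloor> \<in> {a..b}" using u' by (auto simp: le_diff_eq) linarith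
      then have "s - (s - of_int \<lfloor>s - a\<rfloor>) \<notin> \<int>" using s by blast
      then show False by simp
    qed
    then show 1: "\<lfloor>s - u\<rfloor> = \<lfloor>s - a\<rfloor>" using u' by (simp add: floor_eq_iff) linarith
    have "s - u \<notin> \<int>" using s u' by simp
    then show "\<lceil>s - u\<rceil> = \<lfloor>s - a\<rfloor> + 1" unfolding 1[symmetric] by (auto simp: ceiling_altdef) (metis Ints_of_int)
  qed
  have sumf: "(\<Sum>v\<in>A. \<lfloor>s - v\<rfloor>) = int k * \<lfloor>s - a\<rfloor> + (\<Sum>u\<in>S. \<lfloor>u\<rfloor>)"
    and sumc: "(\<Sum>v\<in>A. \<lceil>s - v\<rceil>) = int k * \<lfloor>s - a\<rfloor> + int k + (\<Sum>u\<in>S. \<lfloor>u\<rfloor>)"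
    if s: "\<forall>u\<in>{a..b}. s - u \<notin> \<int>" for s
    unfolding A_def sum.reindex[OF inj] o_def sub
    using gap[OF s] by (simp_all add: sum.distrib ab(5) algebra_simps)
  have eq: "curves D' = curves D" "over D' = over D" using D' by auto
  have other: "turns D' j = turns D j \<and> total_turns D' j = total_turns D j" if "j \<noteq> i" for j
  proof -
    have "fwd D' j = fwd D j" "bwd D' j = bwd D j" using D' that by (auto simp: fwd_def bwd_def)
    then show ?thesis by (simp add: turns_def total_turns_def fun_eq_iff)
  qed
  from D' show ?thesis
  proof
    assume "D' = D\<lparr>forward := forward D \<union> (\<lambda>s. (i, frac s)) ` S\<rparr>"
    then have f: "fwd D' i = fwd D i \<union> A" "bwd D' i = bwd D i" by (auto simp: fwd_def bwd_def A_def)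
    have "turns D' i s = turns D i s + (\<Sum>v\<in>A. \<lfloor>s - v\<rfloor>)" for s
      using fin A disj by (simp add: turns_def f sum.union_disjoint Int_commute)
    moreover have "total_turns D' i = total_turns D i + int k"
      using fin A disj by (simp add: total_turns_def f card_Un_disjoint Int_commute)
    ultimately show ?thesis
      using other sumf
      by (intro arrow_changeI[OF D eq ab(1,2) free, where e = "int k" and z = "\<Sum>u\<in>S. \<lfloor>u\<rfloor>"]) simp_all
  next
    assume "D' = D\<lparr>backward := backward D \<union> (\<lambda>s. (i, frac s)) ` S\<rparr>"
    then have f: "bwd D' i = bwd D i \<union> A" "fwd D' i = fwd D i" by (auto simp: fwd_def bwd_def A_def)
    have "turns D' i s = turns D i s - (\<Sum>v\<in>A. \<lceil>s - v\<rceil>)" for s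
      using fin A disj by (simp add: turns_def f sum.union_disjoint Int_commute)
    moreover have "total_turns D' i = total_turns D i + - int k"
      using fin A disj by (simp add: total_turns_def f card_Un_disjoint Int_commute)
    \<comment> \<open>Each of the k backward arrows counts with a ceiling, one more than the floor;
      this is the extra \<open>- int k\<close> in z.\<close>
    ultimately show ?thesis
      using other sumc
      by (intro arrow_changeI[OF D eq ab(1,2) free, where e = "- int k" and z = "- int k - (\<Sum>u\<in>S. \<lfloor>u\<rfloor>)"]) simp_all
  qed
qed

lemma k_move_change: "k_move k D D' \<Longrightarrow> arrow_change k D D'"
  unfolding k_move_def using adds_arrows_change arrow_change_sym by blast

text \<open>A relation rather than a function: the existence of heights is carried along the moves,
  and uniqueness of the value comes from \<open>lk_lift_unique\<close>.\<close>

definition diagram_lk :: "arrow_diagram \<Rightarrow> nat \<Rightarrow> nat \<Rightarrow> real \<Rightarrow> bool"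
  where "diagram_lk D i j x \<longleftrightarrow> (\<exists>H K. heights D i j H K \<and> x = lk (lift D i H) (lift D j K))"

lemma lk_lift_commute:
  assumes D: "is_arrow_diagram D" "i < length (curves D)" "j < length (curves D)" "i \<noteq> j" "heights D i j H K"
  shows "lk (lift D i H) (lift D j K) = lk (lift D j K) (lift D i H)"
proof (rule lk_commute)
  have "heights_on D i j H" "heights_on D j i K" using D(5) by (auto simp: heights_def)
  then show "loop (lift D i H)" "loop (lift D j K)"
    using closed_curve_loop[OF closed_curve_lift[OF D(1,2)]] closed_curve_loop[OF closed_curve_lift[OF D(1,3)]] by blast+
  show "apart (lift D i H) (lift D j K)" by (rule apartI) (rule lifts_ne[OF D])
qed

text \<open>The arrows may lie on i, on j or on a third curve. \<open>lk_lift_move\<close> alters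
  the first entry, so the case of j goes through the symmetry of \<open>lk\<close>; for a third
  curve the old heights remain valid.\<close>

lemma diagram_lk_change:
  assumes ch: "arrow_change k D D'" and ij: "i < length (curves D)" "j < length (curves D)" "i \<noteq> j"
    and x: "diagram_lk D i j x"
  obtains N where "diagram_lk D' i j (x + of_int (int k * N))"
proof -
  obtain p a b e z where D: "is_arrow_diagram D" and D': "is_arrow_diagram D'" "curves D' = curves D" "over D' = over D"
    and ab: "a \<le> b" "b < a + 1" and free: "\<forall>s\<in>{a..b}. \<forall>q. \<not> crossing D (p, frac s) q" and e: "int k dvd e"
      "total_turns D' p = total_turns D p + e"
      and turn: "\<forall>s. (\<forall>u\<in>{a..b}. s - u \<notin> \<int>) \<longrightarrow> turns D' p s = turns D p s + e * \<lfloor>s - a\<rfloor> + z"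
      and other: "\<forall>j. j \<noteq> p \<longrightarrow> turns D' j = turns D j \<and> total_turns D' j = total_turns D j"
    using ch unfolding arrow_change_def by blast
  obtain H K where H: "heights D i j H K" "x = lk (lift D i H) (lift D j K)"
    using x by (auto simp: diagram_lk_def)
  have move: "\<exists>H' N. heights D' p q H' K' \<and> lk (lift D' p H') (lift D' q K') = lk (lift D p P) (lift D q K') + of_int (int k * N)"
    if pq: "p < length (curves D)" "q < length (curves D)" "p \<noteq> q" "heights D p q P K'" for q P K'
  proof -
    obtain H' N where "heights D' p q H' K'" "lk (lift D' p H') (lift D' q K') = lk (lift D p P) (lift D q K') + of_int (e * N)"
    proof (rule lk_lift_move[OF D pq(1-3) D' pq(4) _ _ e(2) ab])
      show "turns D' q = turns D q" "total_turns D' q = total_turns D q" using other pq(3) by auto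
      show "(curves D ! p) s \<noteq> (curves D ! q) t" if "s \<in> {a..b}" for s t
        using crossing_if_eq[OF D pq(1-3), of s t] free that by blast
      show "turns D' p s = turns D p s + e * \<lfloor>s - a\<rfloor> + z" if "\<And>u. u \<in> {a..b} \<Longrightarrow> s - u \<notin> \<int>" for s
        using turn that by blast
    qed
    moreover obtain f where "e = int k * f" using e(1) by (elim dvdE)
    ultimately show ?thesis by (metis mult.assoc)
  qed
  consider "p = i" | "p = j" | "p \<noteq> i" "p \<noteq> j" by blast
  then show thesis
  proof cases
    case 1
    then obtain H' N where "heights D' i j H' K" "lk (lift D' i H') (lift D' j K) = x + of_int (int k * N)"
      using move[of j H K] ij H by blast
    then have "diagram_lk D' i j (x + of_int (int k * N))" unfolding diagram_lk_def by metis
    then show thesis by (rule that)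
  next
    case 2
    then obtain H' N where h: "heights D' j i H' H" "lk (lift D' j H') (lift D' i H) = lk (lift D j K) (lift D i H) + of_int (int k * N)"
      using move[of i K H] ij heights_commute[OF H(1)] by blast
    have "lk (lift D' i H) (lift D' j H') = x + of_int (int k * N)"
      using h(2) lk_lift_commute[OF D ij H(1)] lk_lift_commute[OF D'(1) _ _ ij(3) heights_commute[OF h(1)]] ij D'(2) H(2) by simp
    with heights_commute[OF h(1)] have "diagram_lk D' i j (x + of_int (int k * N))"
      unfolding diagram_lk_def by metis
    then show thesis by (rule that)
  next
    case 3
    then have "heights D' i j H K"
      using H(1) other D'(2,3) by (simp add: heights_def heights_on_def)
    moreover have "lift D' i H = lift D i H" "lift D' j K = lift D j K" by (simp_all add: lift_def D'(2))
    ultimately have "diagram_lk D' i j (x + of_int (int k * 0))"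
      using H(2) unfolding diagram_lk_def by (intro exI[of _ H] exI[of _ K]) simp
    then show thesis by (rule that)
  qed
qed


section \<open>Linking numbers of links along a chain of moves\<close>

lemma link_component:
  assumes "is_link L" "i < length L"
  shows "closed_curve (L ! i)" "C1_loop (L ! i)" "range (L ! i) = (L ! i) ` {0..1}"
proof -
  have r: "regular_closed_curve (L ! i)" and S3: "range (L ! i) \<subseteq> S3"
    using assms by (auto simp: is_link_def)
  then obtain F where F: "F 0 = L ! i" "\<And>n s. (F n has_vector_derivative F (Suc n) s) (at s)"
    by (auto simp: regular_closed_curve_def smooth_curve_def)
  have per: "(L ! i) (s + 1) = (L ! i) s" for s using r by (simp add: regular_closed_curve_def)
  have in_S3: "(L ! i) s \<in> S3" for s using S3 by blast
  have cont: "continuous_on UNIV (F n)" for n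
    unfolding continuous_on_eq_continuous_at[OF open_UNIV]
    using F(2)[of n] by (blast intro: has_vector_derivative_continuous)
  show "closed_curve (L ! i)"
    unfolding closed_curve_def using cont[of 0] F(1) in_S3 per by simp
  have "L ! i C1_differentiable_on {0..1}"
    unfolding C1_differentiable_on_def
    using F cont[of 1] by (intro exI[of _ "F 1"]) (metis One_nat_def continuous_on_subset subset_UNIV)
  then show "C1_loop (L ! i)"
    unfolding C1_loop_def using in_S3 per[of 0] by simp
  have "(L ! i) t \<in> (L ! i) ` {0..1}" for t
  proof -
    have "(L ! i) t = (L ! i) (frac t)"
      using periodic_of_int[of "L ! i", OF per, of "frac t" "\<lfloor>t\<rfloor>"] by (simp add: frac_def)
    then show ?thesis by (intro image_eqI[of _ _ "frac t"]) (simp_all add: frac_lt_1 less_imp_le)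
  qed
  then show "range (L ! i) = (L ! i) ` {0..1}" by blast
qed

lemma link_components_ne:
  assumes "is_link L" "i < length L" "j < length L" "i \<noteq> j"
  shows "(L ! i) s \<noteq> (L ! j) t"
  using assms by (auto simp: is_link_def)

lemma linking_number_lk:
  assumes L: "is_link L" "i < length L" "j < length L" "i \<noteq> j"
  shows "linking_number (L ! i) (L ! j) = round (lk (L ! i) (L ! j))"
proof -
  have "lk (L ! i) (L ! j) = gauss_linking (L ! i) (L ! j)"
    by (rule lk_C1_loop[OF link_component(2)[OF L(1,2)] link_component(2)[OF L(1,3)]])
      (rule apartI, rule link_components_ne[OF L])
  then show ?thesis
    by (simp add: linking_number_def gauss_linking_def link_component(3)[OF L(1,2)] link_component(3)[OF L(1,3)] Let_def)
qed

text \<open>Each stage of the isotopy is injective and keeps the two components disjoint, so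
  homotopy invariance applies. At the end only changes of parameter of degree 1 remain.\<close>

lemma isotopic_lk:
  assumes iso: "isotopic L L'" and ij: "i < length L" "j < length L" "i \<noteq> j"
  shows "lk (L ! i) (L ! j) = lk (L' ! i) (L' ! j)"
proof -
  obtain f where L: "is_link L" "is_link L'" "length L = length L'"
    and hom: "homotopic_with_canon (\<lambda>h. \<exists>g. homeomorphism S3 S3 h g) S3 S3 id f"
    and same: "\<And>i. i < length L \<Longrightarrow> same_oriented_curve (f \<circ> L ! i) (L' ! i)"
    using iso by (auto simp: isotopic_def)
  obtain h where h: "continuous_map (prod_topology (top_of_set {0..1::real}) (top_of_set S3)) (top_of_set S3) h"
      "\<And>x. h (0, x) = x" "\<And>x. h (1, x) = f x"
      and homeo: "\<And>t. t \<in> {0..1} \<Longrightarrow> \<exists>g. homeomorphism S3 S3 (\<lambda>x. h (t, x)) g"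
    using hom unfolding homotopic_with_def by auto
  have hc: "continuous_on ({0..1} \<times> S3) h" and hS: "\<And>t x. t \<in> {0..1} \<Longrightarrow> x \<in> S3 \<Longrightarrow> h (t, x) \<in> S3"
    using h(1) by (auto simp flip: subtopology_Times euclidean_product_topology simp: subtopology_Times continuous_map_iff_continuous2 image_subset_iff_funcset Pi_iff)
  have in_S3: "(L ! p) s \<in> S3" if "p < length L" for p s
    using link_component(1)[OF L(1) that] by (simp add: closed_curve_def)
  have "lk (\<lambda>s. h (0, (L ! i) s)) (\<lambda>s. h (0, (L ! j) s)) = lk (\<lambda>s. h (1, (L ! i) s)) (\<lambda>s. h (1, (L ! j) s))"
  proof (rule lk_homotopic)
    have cont: "continuous_on ({0..1} \<times> {0..1}) (\<lambda>(x, s). h (x, (L ! p) s))" if "p < length L" for p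
    proof -
      have "continuous_on {0..1} (L ! p)"
        using link_component(1)[OF L(1) that] unfolding closed_curve_def by (auto intro: continuous_on_subset)
      then show ?thesis
        unfolding case_prod_beta
        by (intro continuous_on_compose_intro[OF hc] continuous_intros continuous_on_snd_comp)
          (use in_S3[OF that] in \<open>auto simp del: mem_sphere_0\<close>)
    qed
    show "continuous_on ({0..1} \<times> {0..1}) (\<lambda>(x, s). h (x, (L ! i) s))"
      "continuous_on ({0..1} \<times> {0..1}) (\<lambda>(x, s). h (x, (L ! j) s))" by (rule cont, fact)+
    fix x s t :: real assume x: "x \<in> {0..1}"
    show "h (x, (L ! i) s) \<in> S3" "h (x, (L ! j) s) \<in> S3" using hS[OF x in_S3] ij by blast+
    have "(L ! p) 0 = (L ! p) 1" if "p < length L" for p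
      using link_component(2)[OF L(1) that] by (simp add: C1_loop_def)
    then show "h (x, (L ! i) 0) = h (x, (L ! i) 1)" "h (x, (L ! j) 0) = h (x, (L ! j) 1)" using ij by simp_all
    obtain g where "homeomorphism S3 S3 (\<lambda>x'. h (x, x')) g" using homeo[OF x] by blast
    then have "g (h (x, (L ! i) s)) = (L ! i) s" "g (h (x, (L ! j) t)) = (L ! j) t"
      using in_S3 ij by (auto simp: homeomorphism_def simp del: mem_sphere_0)
    then show "h (x, (L ! i) s) \<noteq> h (x, (L ! j) t)" using link_components_ne[OF L(1) ij, of s t] by metis
  qed
  then have 1: "lk (L ! i) (L ! j) = lk (f \<circ> L ! i) (f \<circ> L ! j)" by (simp add: h o_def)
  obtain \<phi> where \<phi>: "continuous_on UNIV \<phi>" "\<And>s. \<phi> (s + 1) = \<phi> s + 1" "f \<circ> L ! i = (\<lambda>s. (L' ! i) (\<phi> s))"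
    using same[OF ij(1)] by (auto simp: same_oriented_curve_def fun_eq_iff)
  obtain \<psi> where \<psi>: "continuous_on UNIV \<psi>" "\<And>s. \<psi> (s + 1) = \<psi> s + 1" "f \<circ> L ! j = (\<lambda>s. (L' ! j) (\<psi> s))"
    using same[OF ij(2)] by (auto simp: same_oriented_curve_def fun_eq_iff)
  have "lk (\<lambda>s. (L' ! i) (\<phi> s)) (\<lambda>s. (L' ! j) (\<psi> s)) = of_int (1 * 1) * lk (L' ! i) (L' ! j)"
  proof (rule lk_comp)
    show "closed_curve (L' ! i)" "closed_curve (L' ! j)" using link_component(1)[OF L(2)] ij L(3) by simp_all
    show "(L' ! i) s \<noteq> (L' ! j) t" for s t by (rule link_components_ne[OF L(2)]) (use ij L(3) in simp_all)
    show "continuous_on {0..1} \<phi>" "continuous_on {0..1} \<psi>" using \<phi>(1) \<psi>(1) by (auto intro: continuous_on_subset)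
    show "\<phi> 1 = \<phi> 0 + of_int 1" "\<psi> 1 = \<psi> 0 + of_int 1" using \<phi>(2)[of 0] \<psi>(2)[of 0] by simp_all
  qed
  then show ?thesis unfolding 1 \<phi>(3) \<psi>(3) by simp
qed

lemma arrow_diagram_of_lk:
  assumes A: "arrow_diagram_of D L" and ij: "i < length L" "j < length L" "i \<noteq> j"
  shows "is_arrow_diagram D" "length (curves D) = length L" "is_link L"
    and "diagram_lk D i j x \<longleftrightarrow> x = lk (L ! i) (L ! j)"
proof -
  obtain L0 where R: "represents D L0" and iso: "isotopic L0 L" using A by (auto simp: arrow_diagram_of_def)
  show D: "is_arrow_diagram D" and len: "length (curves D) = length L" and "is_link L"
    using R iso by (auto simp: represents_def isotopic_def)
  have len0: "length L0 = length L" using iso by (simp add: isotopic_def)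
  have lens: "i < length (curves D)" "j < length (curves D)" using ij len by simp_all
  obtain H K where H: "heights D i j H K" "L0 ! i = lift D i H" "L0 ! j = lift D j K"
    using represents_heights[OF R] ij len0 by metis
  have lk: "lk (lift D i H) (lift D j K) = lk (L ! i) (L ! j)"
    using isotopic_lk[OF iso, of i j] ij len0 unfolding H(2,3) by simp
  show "diagram_lk D i j x \<longleftrightarrow> x = lk (L ! i) (L ! j)"
    unfolding diagram_lk_def using lk_lift_unique[OF D lens ij(3) _ H(1)] lk H(1) by metis
qed

text \<open>Along the chain \<open>diagram_lk\<close> collects multiples of k. A
  \<open>same_link\<close> step preserves the value, since a link belonging to both diagrams
  determines it for each.\<close>

lemma k_equivalent_lk:
  assumes "k_equivalent k L L'" and ij: "i < length L" "j < length L" "i \<noteq> j"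
  obtains N where "length L' = length L" "is_link L" "is_link L'" "lk (L' ! i) (L' ! j) = lk (L ! i) (L ! j) + of_int (int k * N)"
proof -
  obtain D D' where D: "arrow_diagram_of D L" and D': "arrow_diagram_of D' L'"
    and chain: "(\<lambda>D1 D2. k_move k D1 D2 \<or> same_link D1 D2)\<^sup>*\<^sup>* D D'"
    using assms(1) by (auto simp: k_equivalent_def)
  from chain have "length (curves D') = length L \<and> (\<exists>N. diagram_lk D' i j (lk (L ! i) (L ! j) + of_int (int k * N)))"
  proof induction
    case base
    have "diagram_lk D i j (lk (L ! i) (L ! j) + of_int (int k * 0))"
      using arrow_diagram_of_lk(4)[OF D ij] by simp
    then show ?case using arrow_diagram_of_lk(2)[OF D ij] by metis
  next
    case (step D1 D2)
    then obtain N where len: "length (curves D1) = length L"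
      and N: "diagram_lk D1 i j (lk (L ! i) (L ! j) + of_int (int k * N))" by blast
    from step(2) show ?case
    proof
      assume "k_move k D1 D2"
      then have ch: "arrow_change k D1 D2" by (rule k_move_change)
      obtain N' where "diagram_lk D2 i j (lk (L ! i) (L ! j) + of_int (int k * N) + of_int (int k * N'))"
        using diagram_lk_change[OF ch _ _ ij(3) N] ij len by metis
      then have "diagram_lk D2 i j (lk (L ! i) (L ! j) + of_int (int k * (N + N')))"
        by (simp add: algebra_simps)
      moreover have "curves D2 = curves D1" using ch by (auto simp: arrow_change_def)
      ultimately show ?case using len by metis
    next
      assume "same_link D1 D2"
      then obtain M where M: "arrow_diagram_of D1 M" "arrow_diagram_of D2 M" by (auto simp: same_link_def)
      have "length (curves D1) = length M" using M(1) by (auto simp: arrow_diagram_of_def represents_def isotopic_def)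
      then have ijM: "i < length M" "j < length M" using ij len by simp_all
      have "diagram_lk D2 i j (lk (L ! i) (L ! j) + of_int (int k * N))"
        using N arrow_diagram_of_lk(4)[OF M(1) ijM ij(3)] arrow_diagram_of_lk(4)[OF M(2) ijM ij(3)] by simp
      then show ?case
        using arrow_diagram_of_lk(2)[OF M(1) ijM ij(3)] arrow_diagram_of_lk(2)[OF M(2) ijM ij(3)] len by metis
    qed
  qed
  then obtain N where len: "length (curves D') = length L"
    and N: "diagram_lk D' i j (lk (L ! i) (L ! j) + of_int (int k * N))" by blast
  have len': "length L' = length L" using D' len by (auto simp: arrow_diagram_of_def represents_def isotopic_def)
  show thesis
  proof (rule that[OF len'])
    show "is_link L" using arrow_diagram_of_lk(3)[OF D ij] .
    show "is_link L'" using arrow_diagram_of_lk(3)[OF D'] ij len' by simp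
    show "lk (L' ! i) (L' ! j) = lk (L ! i) (L ! j) + of_int (int k * N)"
      using arrow_diagram_of_lk(4)[OF D'] ij len' N by simp
  qed
qed

section \<open>Renumbered links and trivial links\<close>

text \<open>A component of L is connected and covered by the finitely many disjoint closed curves of
  M, hence lies in a single one.\<close>

lemma component_matching:
  assumes L: "is_link L" and M: "is_link M" and eq: "link_set L = link_set M" and i: "i < length L"
  obtains j where "j < length M" "range (L ! i) \<subseteq> range (M ! j)"
proof -
  have sub: "range (L ! i) \<subseteq> (\<Union>j<length M. range (M ! j))"
  proof
    fix x assume "x \<in> range (L ! i)"
    then have "x \<in> link_set L" unfolding link_set_def by (rule UN_I[OF nth_mem[OF i]])
    then have "x \<in> link_set M" by (simp only: eq)
    then obtain c where c: "c \<in> set M" "x \<in> range c" unfolding link_set_def by (rule UN_E)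
    then obtain j where "j < length M" "c = M ! j" by (metis in_set_conv_nth)
    with c(2) show "x \<in> (\<Union>j<length M. range (M ! j))" by (intro UN_I[of j]) simp_all
  qed
  then obtain j where j: "j < length M" "(L ! i) 0 \<in> range (M ! j)" by blast
  have closed: "closed (range (M ! p))" if "p < length M" for p
    unfolding link_component(3)[OF M that]
    by (intro compact_imp_closed loop_compact closed_curve_loop link_component(1)[OF M that])
  define V where "V = (\<Union>p\<in>{..<length M} - {j}. range (M ! p))"
  have "connected (range (L ! i))"
    using link_component(1)[OF L i] unfolding closed_curve_def by (intro connected_continuous_image) auto
  moreover have "range (M ! j) \<inter> V \<inter> range (L ! i) = {}"
  proof -
    have "x \<notin> V" if "x \<in> range (M ! j)" for x
    proof
      assume "x \<in> V"
      then obtain p t where "p < length M" "p \<noteq> j" "x = (M ! p) t" unfolding V_def by blast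
      moreover obtain s where "x = (M ! j) s" using \<open>x \<in> range (M ! j)\<close> by blast
      ultimately show False using link_components_ne[OF M j(1), of p s t] by simp
    qed
    then show ?thesis by blast
  qed
  moreover have sub': "range (L ! i) \<subseteq> range (M ! j) \<union> V" using sub unfolding V_def by blast
  moreover have "closed V" unfolding V_def by (intro closed_UN) (auto intro: closed)
  ultimately have "range (M ! j) \<inter> range (L ! i) = {} \<or> V \<inter> range (L ! i) = {}"
    using closed[OF j(1)] by (intro connected_closedD)
  moreover have "range (M ! j) \<inter> range (L ! i) \<noteq> {}" using j(2) by blast
  ultimately have "range (L ! i) \<subseteq> range (M ! j)"
    using sub' by blast
  with j(1) show thesis by (rule that)
qed

text \<open>Being injective modulo 1, b has a continuous inverse \<gamma> with values in the unit
  circle. A continuous logarithm lifts \<gamma> composed with a to the line, and \<phi> is that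
  lift.\<close>

lemma closed_curve_factor:
  assumes a: "closed_curve a" and b: "closed_curve b" and sub: "range a \<subseteq> range b"
    and inj: "\<And>s t. b s = b t \<Longrightarrow> s - t \<in> \<int>"
  obtains \<phi> d where "continuous_on {0..1} \<phi>" "\<phi> 1 = \<phi> 0 + of_int d" "\<And>s. s \<in> {0..1} \<Longrightarrow> a s = b (\<phi> s)"
proof -
  have per: "b (s + of_int n) = b s" for s n
    using b by (intro periodic_of_int) (simp add: closed_curve_def)
  have bc: "continuous_on UNIV b" and ac: "continuous_on UNIV a" using a b by (auto simp: closed_curve_def)
  \<comment> \<open>\<open>torus_embed 0\<close> serves as a parametrisation whose values are known
    to determine the parameter modulo 1.\<close>
  have cis_eq: "cis (2 * pi * s) = cis (2 * pi * t) \<longleftrightarrow> b s = b t" for s t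
  proof
    assume "cis (2 * pi * s) = cis (2 * pi * t)"
    then have "torus_embed 0 s = torus_embed 0 t" by (simp add: torus_embed_def)
    then obtain n :: int where "s = t + of_int n" by (auto simp: torus_embed_eq_iff elim!: Ints_cases simp: algebra_simps)
    then show "b s = b t" by (simp add: per)
  next
    assume "b s = b t"
    then have "torus_embed 0 s = torus_embed 0 t" using inj by (simp add: torus_embed_eq_iff)
    then show "cis (2 * pi * s) = cis (2 * pi * t)" by (simp add: torus_embed_def)
  qed
  define \<gamma> where "\<gamma> = (\<lambda>x. cis (2 * pi * (SOME s. b s = x)))"
  have \<gamma>: "\<gamma> (b s) = cis (2 * pi * s)" for s
  proof -
    have "b (SOME t. b t = b s) = b s" by (rule someI) (rule refl)
    then show ?thesis unfolding \<gamma>_def cis_eq .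
  qed
  have b01: "range b = b ` {0..1}"
  proof -
    have "b t \<in> b ` {0..1}" for t
      using per[of "frac t" "\<lfloor>t\<rfloor>"]
      by (intro image_eqI[of _ _ "frac t"]) (simp_all add: frac_def[of t] frac_lt_1 less_imp_le, (metis frac_def frac_ge_0 frac_lt_1 less_imp_le)+)
    then show ?thesis by blast
  qed
  \<comment> \<open>The preimage under \<gamma> of a closed set is the image under b of a compact
    set.\<close>
  have "continuous_on (range b) \<gamma>"
  proof (subst continuous_on_closed_vimage)
    show "closed (range b)" unfolding b01 by (intro compact_imp_closed loop_compact closed_curve_loop b)
    show "\<forall>T. closed T \<longrightarrow> closed (\<gamma> -` T \<inter> range b)"
    proof (intro allI impI)
      fix T :: "complex set" assume "closed T"
      have "continuous_on UNIV (\<lambda>s. cis (2 * pi * s))" by (intro continuous_intros)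
      then have "closed ((\<lambda>s. cis (2 * pi * s)) -` T)" using \<open>closed T\<close> by (intro closed_vimage) auto
      then have "compact ((\<lambda>s. cis (2 * pi * s)) -` T \<inter> {0..1})" by (intro closed_Int_compact) auto
      then have "compact (b ` ((\<lambda>s. cis (2 * pi * s)) -` T \<inter> {0..1}))"
        by (intro compact_continuous_image continuous_on_subset[OF bc]) auto
      moreover have "\<gamma> -` T \<inter> range b = b ` ((\<lambda>s. cis (2 * pi * s)) -` T \<inter> {0..1})"
        unfolding b01 by (auto simp: \<gamma>)
      ultimately show "closed (\<gamma> -` T \<inter> range b)" by (simp add: compact_imp_closed)
    qed
  qed
  from continuous_on_compose_intro[OF this continuous_on_subset[OF ac subset_UNIV]]
  have \<gamma>a: "continuous_on {0..1} (\<lambda>s. \<gamma> (a s))"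
    using sub by blast
  have ga: "\<exists>t. a s = b t" for s using sub by blast
  have norm: "cmod (\<gamma> (a s)) = 1" for s
  proof -
    obtain t where "a s = b t" using ga by blast
    then show ?thesis by (simp add: \<gamma>)
  qed
  have "\<gamma> (a s) \<noteq> 0" for s using norm[of s] by auto
  moreover have "contractible {0..1::real}" by (intro convex_imp_contractible) simp
  ultimately obtain l where l: "continuous_on {0..1} l" "\<And>s. s \<in> {0..1} \<Longrightarrow> \<gamma> (a s) = exp (l s)"
    using continuous_logarithm_on_contractible[OF \<gamma>a] by metis
  define \<phi> where "\<phi> = (\<lambda>s. Im (l s) / (2 * pi))"
  have eq: "a s = b (\<phi> s)" if s: "s \<in> {0..1}" for s
  proof -
    obtain t where t: "a s = b t" using ga by blast
    have "exp (Re (l s)) = 1" using norm[of s] l(2)[OF s] by (simp add: norm_exp_eq_Re)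
    then have "\<gamma> (a s) = cis (2 * pi * \<phi> s)"
      using l(2)[OF s] by (simp add: \<phi>_def exp_eq_polar)
    then have "cis (2 * pi * t) = cis (2 * pi * \<phi> s)" unfolding t \<gamma> .
    then show ?thesis unfolding t cis_eq .
  qed
  have "a 1 = a 0" using a unfolding closed_curve_def by (metis add_0)
  then have "\<phi> 1 - \<phi> 0 \<in> \<int>" using eq[of 0] eq[of 1] by (intro inj) simp
  then obtain d :: int where "\<phi> 1 = \<phi> 0 + of_int d" by (auto elim!: Ints_cases simp: algebra_simps)
  moreover have "continuous_on {0..1} \<phi>" unfolding \<phi>_def by (intro continuous_intros l) auto
  ultimately show thesis using eq that by blast
qed

text \<open>A set forgets numbering, orientation and parametrisation. Components of L run along
  components of M with certain degrees, and n is the product of two of these.\<close>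

lemma lk_renumbered:
  assumes L: "is_link L" and M: "is_link M" and eq: "link_set L = link_set M"
    and ij: "i < length L" "j < length L" "i \<noteq> j"
  obtains p q and n :: int where "p < length M" "q < length M" "p \<noteq> q" "lk (L ! i) (L ! j) = of_int n * lk (M ! p) (M ! q)"
proof -
  obtain p where p: "p < length M" "range (L ! i) \<subseteq> range (M ! p)" by (rule component_matching[OF L M eq ij(1)]) (rule that)
  obtain q where q: "q < length M" "range (L ! j) \<subseteq> range (M ! q)" by (rule component_matching[OF L M eq ij(2)]) (rule that)
  \<comment> \<open>Matched back, the component p of M lies in a single component of L, which would
    have to be both i and j.\<close>
  have pq: "p \<noteq> q"
  proof
    assume "p = q"
    obtain r where r: "r < length L" "range (M ! p) \<subseteq> range (L ! r)" by (rule component_matching[OF M L eq[symmetric] p(1)]) (rule that)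
    have same: "x = r" if "x < length L" "range (L ! x) \<subseteq> range (M ! p)" for x
    proof (rule ccontr)
      assume "x \<noteq> r"
      have "(L ! x) 0 \<in> range (L ! r)" using that(2) r(2) by blast
      then show False using link_components_ne[OF L that(1) r(1) \<open>x \<noteq> r\<close>] by blast
    qed
    show False using same[OF ij(1) p(2)] same[OF ij(2)] q(2) \<open>p = q\<close> ij(3) by simp
  qed
  have inj: "s - t \<in> \<int>" if "r < length M" "(M ! r) s = (M ! r) t" for r s t
    using M that by (auto simp: is_link_def)
  obtain \<phi> d where \<phi>: "continuous_on {0..1} \<phi>" "\<phi> 1 = \<phi> 0 + of_int d" "\<And>s. s \<in> {0..1} \<Longrightarrow> (L ! i) s = (M ! p) (\<phi> s)"
    by (rule closed_curve_factor[OF link_component(1)[OF L ij(1)] link_component(1)[OF M p(1)] p(2)], rule inj[OF p(1)], assumption, rule that)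
  obtain \<psi> e where \<psi>: "continuous_on {0..1} \<psi>" "\<psi> 1 = \<psi> 0 + of_int e" "\<And>s. s \<in> {0..1} \<Longrightarrow> (L ! j) s = (M ! q) (\<psi> s)"
    by (rule closed_curve_factor[OF link_component(1)[OF L ij(2)] link_component(1)[OF M q(1)] q(2)], rule inj[OF q(1)], assumption, rule that)
  have "lk (L ! i) (L ! j) = lk (\<lambda>s. (M ! p) (\<phi> s)) (\<lambda>s. (M ! q) (\<psi> s))"
    by (rule lk_cong) (simp_all add: \<phi>(3) \<psi>(3))
  also have "\<dots> = of_int (d * e) * lk (M ! p) (M ! q)"
    by (rule lk_comp[OF link_component(1)[OF M p(1)] link_component(1)[OF M q(1)] link_components_ne[OF M p(1) q(1) pq] \<phi>(1,2) \<psi>(1,2)])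
  finally show thesis using that p(1) q(1) pq by blast
qed

text \<open>The constant heights 0 and 1/2 fit a diagram without crossings and arrows. As they are
  distinct modulo 1, both projections can be shrunk to the centre of the disc, which leaves two
  constant loops.\<close>

lemma trivial_link_lk:
  assumes Y: "trivial_link Y" and L: "is_link L" "link_set L = Y" and ij: "i < length L" "j < length L" "i \<noteq> j"
  shows "lk (L ! i) (L ! j) = 0"
proof -
  obtain M D where M: "link_set M = Y" "arrow_diagram_of D M" and D: "\<And>p q. \<not> crossing D p q" "arrows D = {}"
    using Y by (auto simp: trivial_link_def)
  have "is_link M" using M(2) by (auto simp: arrow_diagram_of_def isotopic_def)
  then obtain p q n where pq: "p < length M" "q < length M" "p \<noteq> q" and n: "lk (L ! i) (L ! j) = of_int n * lk (M ! p) (M ! q)"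
    using lk_renumbered[OF L(1) _ _ ij, of M] L(2) M(1) by metis
  note DM = arrow_diagram_of_lk[OF M(2) pq]
  have lens: "p < length (curves D)" "q < length (curves D)" using DM(2) pq by simp_all
  define c d where "c = curves D ! p" and "d = curves D ! q"
  have cd: "c s \<noteq> d t" for s t
    using crossing_if_eq[OF DM(1) lens pq(3)] D(1) by (auto simp: c_def d_def)
  have no: "forward D = {}" "backward D = {}" using D(2) by (auto simp: arrows_def)
  have on: "heights_on D x y (\<lambda>_. r)" for x y r
    by (auto simp: heights_on_def turns_def total_turns_def fwd_def bwd_def no)
  have "over D = {}" using DM(1) D(1) unfolding is_arrow_diagram_def by auto
  then have "heights D p q (\<lambda>_. 0) (\<lambda>_. 1/2)" by (simp add: heights_def on)
  then have "lk (M ! p) (M ! q) = lk (lift D p (\<lambda>_. 0)) (lift D q (\<lambda>_. 1/2))"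
    using DM(4)[of "lk (lift D p (\<lambda>_. 0)) (lift D q (\<lambda>_. 1/2))"] unfolding diagram_lk_def by fastforce
  also have "\<dots> = 0"
  proof -
    define A where "A = (\<lambda>x s. torus_embed ((1 - complex_of_real x) * c s) 0)"
    define B where "B = (\<lambda>x s. torus_embed ((1 - complex_of_real x) * d s) (1/2))"
    have half: "torus_embed x 0 \<noteq> torus_embed y (1/2)" for x y
      by (rule torus_embed_neI) (intro exI[of _ "-1"], simp)
    have cont: "continuous_on {0..1} c" "continuous_on {0..1} d"
      using curves_props(1)[OF DM(1) lens(1)] curves_props(1)[OF DM(1) lens(2)]
      by (auto simp: c_def d_def intro: continuous_on_subset)
    have c01: "c 0 = c 1" "d 0 = d 1"
      using curves_props(2)[OF DM(1) lens(1), of 0] curves_props(2)[OF DM(1) lens(2), of 0] by (simp_all add: c_def d_def)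
    have "lk (A 0) (B 0) = lk (A 1) (B 1)"
    proof (rule lk_homotopic)
      show "continuous_on ({0..1} \<times> {0..1}) (\<lambda>(x, s). A x s)" "continuous_on ({0..1} \<times> {0..1}) (\<lambda>(x, s). B x s)"
        unfolding A_def B_def case_prod_beta
        by (intro continuous_on_torus_embed continuous_intros continuous_on_snd_comp cont)+
      show "A x s \<in> S3" "B x s \<in> S3" for x s unfolding A_def B_def by (rule torus_embed_in_S3)+
      show "A x 0 = A x 1" "B x 0 = B x 1" for x by (simp_all add: A_def B_def c01)
      show "A x s \<noteq> B x t" for x s t unfolding A_def B_def by (rule half)
    qed
    moreover have "lk (A 1) (B 1) = 0"
      unfolding A_def B_def by simp (rule lk_const[OF torus_embed_in_S3 torus_embed_in_S3 half])
    ultimately show ?thesis by (simp add: A_def B_def lift_def c_def d_def)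
  qed
  finally show ?thesis using n by simp
qed

section \<open>The Hopf link as an example\<close>

definition hopf_link :: link
  where "hopf_link = [torus_embed 0, torus_embed (1/2)]"

lemma regular_closed_curve_fibre: "regular_closed_curve (torus_embed x)"
proof -
  define r where "r = 1 / sqrt (1 + (cmod x)\<^sup>2)"
  have r: "r > 0" unfolding r_def by (rule torus_embed_pos)
  define F where "F = (\<lambda>n s. r *\<^sub>R (x * ((of_real (2 * pi) * \<i>) ^ n * cis (2 * pi * s)), (of_real (2 * pi) * \<i>) ^ n * cis (2 * pi * s)))"
  have F: "(F n has_vector_derivative F (Suc n) s) (at s)" for n s
  proof -
    have "((\<lambda>s. (of_real (2 * pi) * \<i>) ^ n * cis (2 * pi * s)) has_vector_derivative (of_real (2 * pi) * \<i>) ^ n * (of_real (2 * pi) * \<i> * cis (2 * pi * s))) (at s)"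
      by (rule has_vector_derivative_mult_right[OF has_vector_derivative_cis])
    then have c: "((\<lambda>s. (of_real (2 * pi) * \<i>) ^ n * cis (2 * pi * s)) has_vector_derivative (of_real (2 * pi) * \<i>) ^ Suc n * cis (2 * pi * s)) (at s)"
      by (simp add: mult_ac)
    show ?thesis
      unfolding F_def
      by (intro bounded_linear.has_vector_derivative[OF bounded_linear_scaleR_right] has_vector_derivative_Pair
          has_vector_derivative_mult_right[OF c] c)
  qed
  have F0: "F 0 = torus_embed x" by (simp add: F_def torus_embed_def r_def fun_eq_iff)
  have "vector_derivative (torus_embed x) (at s) = F 1 s" for s
    using vector_derivative_at[OF F[of 0 s]] by (simp add: F0)
  moreover have "F 1 s \<noteq> 0" for s using r by (simp add: F_def zero_prod_def)
  ultimately show ?thesis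
    unfolding regular_closed_curve_def smooth_curve_def
    using F F0 torus_embed_add_int[of x _ 1] by auto
qed

lemma is_link_hopf_link: "is_link hopf_link"
  unfolding is_link_def
proof (intro conjI ballI allI impI)
  fix c assume "c \<in> set hopf_link"
  then obtain x where c: "c = torus_embed x" by (auto simp: hopf_link_def)
  show "regular_closed_curve c" unfolding c by (rule regular_closed_curve_fibre)
  show "range c \<subseteq> S3" unfolding c using torus_embed_in_S3 by blast
next
  fix i j s t assume ij: "i < length hopf_link" "j < length hopf_link" and eq: "(hopf_link ! i) s = (hopf_link ! j) t"
  have "hopf_link ! x = torus_embed (of_nat x / 2)" if "x < length hopf_link" for x
    using that by (auto simp: hopf_link_def less_Suc_eq)
  with ij eq show "i = j" "s - t \<in> \<int>" by (auto simp: torus_embed_eq_iff)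
qed

text \<open>Seen from 0, the point 1/2 is the exponential of a constant: the second fibre winds 0
  times around the first in the disc and once along it, so \<open>lk_fibre_exp\<close> gives 0 +
  1.\<close>

lemma lk_hopf_link: "lk (hopf_link ! 0) (hopf_link ! 1) = 1" "lk (hopf_link ! 1) (hopf_link ! 0) = 1"
proof -
  have e: "exp (complex_of_real (ln (1/2))) = 1/2" unfolding exp_of_real by simp
  have "lk (torus_embed 0) (torus_embed (1/2)) = lk (\<lambda>s. torus_embed 0 s) (\<lambda>t. torus_embed (0 + exp ((\<lambda>_. complex_of_real (ln (1/2))) t)) t)"
    by (simp only: e add_0)
  also have "\<dots> = of_int (0 + 1)"
    by (rule lk_fibre_exp) (auto intro: continuous_intros)
  finally show 1: "lk (hopf_link ! 0) (hopf_link ! 1) = 1" by (simp add: hopf_link_def)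
  have len: "0 < length hopf_link" "1 < length hopf_link" by (simp_all add: hopf_link_def)
  have "lk (hopf_link ! 0) (hopf_link ! 1) = lk (hopf_link ! 1) (hopf_link ! 0)"
    by (rule lk_commute[OF closed_curve_loop[OF link_component(1)[OF is_link_hopf_link len(1)]]
          closed_curve_loop[OF link_component(1)[OF is_link_hopf_link len(2)]]])
      (rule apartI, rule link_components_ne[OF is_link_hopf_link len], simp)
  with 1 show "lk (hopf_link ! 1) (hopf_link ! 0) = 1" by simp
qed

text \<open>Comparing the two numberings in both directions shows that the degrees multiply to a unit.\<close>

lemma hopf_link_renumbered:
  assumes L: "is_link L" "link_set L = link_set hopf_link"
  obtains i j where "i < length L" "j < length L" "i \<noteq> j" "lk (L ! i) (L ! j) = 1 \<or> lk (L ! i) (L ! j) = -1"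
proof -
  have len: "0 < length hopf_link" "1 < length hopf_link" by (simp_all add: hopf_link_def)
  obtain i j n where ij: "i < length L" "j < length L" "i \<noteq> j" and n: "lk (hopf_link ! 0) (hopf_link ! 1) = of_int n * lk (L ! i) (L ! j)"
    using lk_renumbered[OF is_link_hopf_link L(1) L(2)[symmetric] len] by auto
  obtain p q m where pq: "p < length hopf_link" "q < length hopf_link" "p \<noteq> q" and m: "lk (L ! i) (L ! j) = of_int m * lk (hopf_link ! p) (hopf_link ! q)"
    using lk_renumbered[OF L(1) is_link_hopf_link L(2) ij] by auto
  have "p = 0 \<and> q = 1 \<or> p = 1 \<and> q = 0" using pq by (auto simp: hopf_link_def)
  then have m': "lk (L ! i) (L ! j) = of_int m" using m lk_hopf_link by auto
  then have "of_int (n * m) = (1::real)" using n lk_hopf_link by simp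
  then have "n * m = 1" by (simp only: of_int_eq_1_iff)
  then have "m = 1 \<or> m = - 1" using zmult_eq_1_iff by blast
  with m' ij show thesis using that by auto
qed

theorem proposition1:
  fixes k :: nat
  assumes "1 \<le> k"
  shows "(\<forall>L L' i j. k_equivalent k L L' \<and> i < length L \<and> j < length L \<and> i \<noteq> j \<longrightarrow>
            [linking_number (L ! i) (L ! j) = linking_number (L' ! i) (L' ! j)] (mod int k)) \<and>
         (2 \<le> k \<longrightarrow>
            (\<exists>X. unoriented_link X \<and> (\<forall>Y. trivial_link Y \<longrightarrow> \<not> unoriented_k_equivalent k X Y)))"
proof (intro conjI allI impI)
  fix L L' i j assume "k_equivalent k L L' \<and> i < length L \<and> j < length L \<and> i \<noteq> j"
  then have ij: "k_equivalent k L L'" "i < length L" "j < length L" "i \<noteq> j" by auto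
  obtain N where len: "length L' = length L" and L: "is_link L" "is_link L'"
    and N: "lk (L' ! i) (L' ! j) = lk (L ! i) (L ! j) + of_int (int k * N)"
    by (rule k_equivalent_lk[OF ij]) (rule that)
  have "linking_number (L' ! i) (L' ! j) = round (lk (L ! i) (L ! j) + of_int (int k * N))"
    using linking_number_lk[OF L(2)] ij len N by simp
  \<comment> \<open>\<open>round\<close> is the floor after adding 1/2 and so commutes with the
    addition of the integer \<open>int k * N\<close>.\<close>
  also have "\<dots> = linking_number (L ! i) (L ! j) + int k * N"
    using linking_number_lk[OF L(1) ij(2-4)] unfolding round_def by (simp add: floor_add_int[symmetric] add.assoc add.left_commute del: of_int_mult)
  finally show "[linking_number (L ! i) (L ! j) = linking_number (L' ! i) (L' ! j)] (mod int k)"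
    by (simp add: cong_iff_lin)
next
  assume k: "2 \<le> k"
  show "\<exists>X. unoriented_link X \<and> (\<forall>Y. trivial_link Y \<longrightarrow> \<not> unoriented_k_equivalent k X Y)"
  proof (intro exI[of _ "link_set hopf_link"] conjI allI impI notI)
    show "unoriented_link (link_set hopf_link)" using is_link_hopf_link by (auto simp: unoriented_link_def)
    fix Y assume Y: "trivial_link Y" and "unoriented_k_equivalent k (link_set hopf_link) Y"
    then obtain L L' where LL: "link_set L = link_set hopf_link" "link_set L' = Y" "k_equivalent k L L'"
      by (auto simp: unoriented_k_equivalent_def)
    have "is_link L" using LL(3) by (auto simp: k_equivalent_def arrow_diagram_of_def isotopic_def)
    then obtain i j where ij: "i < length L" "j < length L" "i \<noteq> j" and one: "lk (L ! i) (L ! j) = 1 \<or> lk (L ! i) (L ! j) = -1"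
      using hopf_link_renumbered LL(1) by blast
    obtain N where len: "length L' = length L" and L': "is_link L'"
      and N: "lk (L' ! i) (L' ! j) = lk (L ! i) (L ! j) + of_int (int k * N)"
      by (rule k_equivalent_lk[OF LL(3) ij]) (rule that)
    have "lk (L' ! i) (L' ! j) = 0"
      by (rule trivial_link_lk[OF Y L' LL(2)]) (use ij len in simp_all)
    \<comment> \<open>A multiple of k has to cancel a linking number 1 or -1, which forces k to
      divide 1.\<close>
    then have "of_int (int k * N) = (1::real) \<or> of_int (int k * N) = (-1::real)" using N one by linarith
    then have "int k * N = 1 \<or> int k * N = -1" by linarith
    then have "int k dvd 1" by (metis dvd_minus_iff dvd_triv_left)
    then show False using k by simp
  qed
qed

end
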